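(* Assume $\Delta(\mathbb R)$ is two nested ovals. If the IJT obstruction vanishes for $Y$, then $Y(\mathbb R)$ is connected.
   Context: Let $Q_1,Q_2,Q_3\in\mathbb R[u,v,w]$ be quadratic forms such that $\Delta=(Q_1Q_3-Q_2^2=0)\subset\mathbb P^2_{\mathbb R}$ is a smooth plane quartic and $\tilde\Delta=(Q_1-r^2=Q_2-rs=Q_3-s^2=0)\subset\mathbb P^4_{[u:v:w:r:s]}$, with $\varpi\colon\tilde\Delta\to\Delta$, $[u:v:w:r:s]\mapsto[u:v:w]$, is an étale double cover. Let $Y\to\mathbb P^1_{[t_0:t_1]}\times\mathbb P^2_{[u:v:w]}$ be the double cover $z^2=t_0^2Q_1+2t_0t_1Q_2+t_1^2Q_3$. The real locus of a smooth real plane quartic is, up to isotopy in $\mathbb P^2(\mathbb R)$, one of: empty, one oval, two nested ovals, two non-nested ovals, three ovals, four ovals. IJT obstruction. Let $M_i$ be the symmetric $3\times3$ matrix of $Q_i$ and let $\Gamma$ be the genus $2$ curve $y^2=-\det(t^2M_1+2tM_2+M_3)$. Let $\varpi_*\colon\mathbf{Pic}_{\tilde\Delta}\to\mathbf{Pic}_{\Delta}$ be the norm map. Then $\varpi_*^{-1}[\mathcal O_\Delta]\subset\mathbf{Pic}^0_{\tilde\Delta}$ is a disjoint union $P\sqcup\tilde P$, with $P$ the component containing $0$ (the Prym variety), and $\varpi_*^{-1}[\mathcal O_\Delta(1)]\subset\mathbf{Pic}^4_{\tilde\Delta}$ is a disjoint union $P^{(1)}\sqcup\tilde P^{(1)}$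 of two $P$-torsors. Here $\tilde P^{(1)}$ is the component whose real points are represented by the $\mathrm{Gal}(\mathbb C/\mathbb R)$-invariant effective divisors $p_1+p_2+p_3+p_4$ on $\tilde\Delta_{\mathbb C}$ (points counted with multiplicity) such that $\varpi_*(p_1+p_2+p_3+p_4)=\Delta\cap\ell$ for a real line $\ell\subset\mathbb P^2$ and such that the divisor is not contained in a $2$-plane of $\mathbb P^4$. The intermediate Jacobian of $Y$ is isomorphic to $P\cong\mathbf{Pic}^0_\Gamma$. The intermediate Jacobian torsor (IJT) obstruction (of Hassett–Tschinkel and Benoist–Wittenberg, over $\mathbb R$) vanishes for $Y$ if, for every Galois-invariant geometric curve class on $Y$, the associated torsor under the intermediate Jacobian is isomorphic to some $\mathbf{Pic}^i_\Gamma$. By known results $P^{(1)}\cong\mathbf{Pic}^1_\Gamma$ always has real points, and the IJT obstruction vanishes if and only if $\tilde P^{(1)}(\mathbb R)\neq\emptyset$; this may be taken as the definition. *)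

theory Defs
  imports
    "HOL-Analysis.Analysis"
    "HOL-Library.Multiset"
begin

unbundle no fps_syntax

text \<open>
  A real quadratic form in three variables is given by its symmetric matrix. The forms are
  evaluated over an arbitrary commutative ring, because the same equations are used over the
  real and complex numbers, over \<open>\<complex>[\<lambda>]\<close> (restriction to a line) and over \<open>\<complex>[[\<lambda>]]\<close>
  (local parameters on a curve).
\<close>

definition qform :: "'a::comm_ring_1^3^3 \<Rightarrow> 'a^3 \<Rightarrow> 'a" where
  "qform M x = (\<Sum>i\<in>UNIV. \<Sum>j\<in>UNIV. M$i$j * x$i * x$j)"

definition quartic :: "'a::comm_ring_1^3^3 \<Rightarrow> 'a^3^3 \<Rightarrow> 'a^3^3 \<Rightarrow> 'a^3 \<Rightarrow> 'a" where
  "quartic M1 M2 M3 x = qform M1 x * qform M3 x - (qform M2 x)\<^sup>2"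

abbreviation cmat :: "real^3^3 \<Rightarrow> complex^3^3" where
  "cmat \<equiv> map_matrix complex_of_real"

abbreviation cvec :: "real^3 \<Rightarrow> complex^3" where
  "cvec a \<equiv> (\<chi> i. complex_of_real (a$i))"

text \<open>Homogeneous coordinates: a point of projective space is the line spanned by a nonzero vector.\<close>

definition pt :: "'a::field^'n \<Rightarrow> ('a^'n) set" where
  "pt x = vec.span {x}"

text \<open>
  The Jacobian criterion at all complex points. The zero polynomial is not smooth in this sense.
\<close>

definition smooth_plane_quartic :: "real^3^3 \<Rightarrow> real^3^3 \<Rightarrow> real^3^3 \<Rightarrow> bool" where
  "smooth_plane_quartic M1 M2 M3 \<longleftrightarrow>
    (let F = quartic (cmat M1) (cmat M2) (cmat M3) in
      \<forall>x. x \<noteq> 0 \<and> F x = 0 \<longrightarrow> (\<exists>i. deriv (\<lambda>h. F (x + h *s axis i 1)) 0 \<noteq> 0))"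

text \<open>
  Coordinates on \<open>P^4\<close> are \<open>[u:v:w:r:s]\<close>. The equations \<open>Q\<^sub>1 = r\<^sup>2\<close>, \<open>Q\<^sub>2 = rs\<close>, \<open>Q\<^sub>3 = s\<^sup>2\<close> show that
  no point of the cover lies on \<open>u = v = w = 0\<close>, where the projection would be undefined.
\<close>

definition uvw :: "'a::zero^5 \<Rightarrow> 'a^3" where
  "uvw p = vector [p$1, p$2, p$3]"

definition on_cover :: "'a::comm_ring_1^3^3 \<Rightarrow> 'a^3^3 \<Rightarrow> 'a^3^3 \<Rightarrow> 'a^5 \<Rightarrow> bool" where
  "on_cover M1 M2 M3 p \<longleftrightarrow>
    qform M1 (uvw p) = (p$4)\<^sup>2 \<and> qform M2 (uvw p) = p$4 * p$5 \<and> qform M3 (uvw p) = (p$5)\<^sup>2"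

definition cover_points :: "real^3^3 \<Rightarrow> real^3^3 \<Rightarrow> real^3^3 \<Rightarrow> (complex^5) set set" where
  "cover_points M1 M2 M3 =
    {pt p | p. p \<noteq> 0 \<and> on_cover (cmat M1) (cmat M2) (cmat M3) p}"

text \<open>
  The cover is a complete intersection curve, finite over the quartic; over a smooth quartic the
  projection is therefore flat, so it is an etale double cover if and only if its geometric
  fibres have two points and it is unramified. The last clause is the latter: a tangent vector
  \<open>(0, 0, 0, \<rho>, \<sigma>)\<close> of the cover that is killed by the projection vanishes.
  (Both clauses in fact follow from smoothness of the quartic.)
\<close>

definition etale_double_cover :: "real^3^3 \<Rightarrow> real^3^3 \<Rightarrow> real^3^3 \<Rightarrow> bool" where
  "etale_double_cover M1 M2 M3 \<longleftrightarrow>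
    (\<forall>x. x \<noteq> 0 \<and> quartic (cmat M1) (cmat M2) (cmat M3) x = 0 \<longrightarrow>
        card {P \<in> cover_points M1 M2 M3. uvw ` P = pt x} = 2) \<and>
    (\<forall>p. p \<noteq> 0 \<and> on_cover (cmat M1) (cmat M2) (cmat M3) p \<longrightarrow>
        (\<forall>\<rho> \<sigma>. 2 * p$4 * \<rho> = 0 \<and> p$4 * \<sigma> + p$5 * \<rho> = 0 \<and> 2 * p$5 * \<sigma> = 0 \<longrightarrow> \<rho> = 0 \<and> \<sigma> = 0))"


definition quotient_topology :: "'a topology \<Rightarrow> ('a \<Rightarrow> 'b) \<Rightarrow> 'b topology" where
  "quotient_topology X f =
    topology (\<lambda>U. U \<subseteq> f ` topspace X \<and> openin X {x \<in> topspace X. f x \<in> U})"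

lemma openin_quotient_topology:
  "openin (quotient_topology X f) U \<longleftrightarrow>
    U \<subseteq> f ` topspace X \<and> openin X {x \<in> topspace X. f x \<in> U}"
proof -
  have "istopology (\<lambda>U. U \<subseteq> f ` topspace X \<and> openin X {x \<in> topspace X. f x \<in> U})"
    unfolding istopology_def
  proof (intro conjI allI impI; (elim conjE)?)
    fix S T assume "openin X {x \<in> topspace X. f x \<in> S}" "openin X {x \<in> topspace X. f x \<in> T}"
    then have "openin X ({x \<in> topspace X. f x \<in> S} \<inter> {x \<in> topspace X. f x \<in> T})"
      by (rule openin_Int)
    also have "{x \<in> topspace X. f x \<in> S} \<inter> {x \<in> topspace X. f x \<in> T} =
        {x \<in> topspace X. f x \<in> S \<inter> T}" by auto
    finally show "openin X {x \<in> topspace X. f x \<in> S \<inter> T}" .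
  next
    fix \<K> assume *: "\<forall>K\<in>\<K>. K \<subseteq> f ` topspace X \<and> openin X {x \<in> topspace X. f x \<in> K}"
    then have "openin X (\<Union>K\<in>\<K>. {x \<in> topspace X. f x \<in> K})"
      by blast
    also have "(\<Union>K\<in>\<K>. {x \<in> topspace X. f x \<in> K}) = {x \<in> topspace X. f x \<in> \<Union>\<K>}" by auto
    finally show "openin X {x \<in> topspace X. f x \<in> \<Union>\<K>}" .
  qed auto
  then show ?thesis
    by (simp add: quotient_topology_def topology_inverse')
qed

lemma quotient_map_quotient_topology: "quotient_map X (quotient_topology X f) f"
proof -
  have "openin (quotient_topology X f) (f ` topspace X)"
  proof -
    have "{x \<in> topspace X. f x \<in> f ` topspace X} = topspace X" by auto
    then show ?thesis by (simp add: openin_quotient_topology)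
  qed
  then have "topspace (quotient_topology X f) = f ` topspace X"
    by (metis openin_quotient_topology openin_subset openin_topspace subset_antisym)
  then show ?thesis
    by (auto simp: quotient_map_def openin_quotient_topology)
qed


definition real_projective_plane :: "(real^3) set topology" where
  "real_projective_plane = quotient_topology (top_of_set (UNIV - {0})) pt"

definition real_quartic_locus :: "real^3^3 \<Rightarrow> real^3^3 \<Rightarrow> real^3^3 \<Rightarrow> (real^3) set set" where
  "real_quartic_locus M1 M2 M3 = {pt x | x. x \<noteq> 0 \<and> quartic M1 M2 M3 x = 0}"

definition ambient_isotopic :: "'a topology \<Rightarrow> 'a set \<Rightarrow> 'a set \<Rightarrow> bool" where
  "ambient_isotopic X S T \<longleftrightarrow>
    (\<exists>H. continuous_map (prod_topology (top_of_set {0..1::real}) X) X H \<and>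
      (\<forall>t\<in>{0..1}. homeomorphic_map X X (\<lambda>x. H (t, x))) \<and>
      (\<forall>x\<in>topspace X. H (0, x) = x) \<and>
      (\<lambda>x. H (1, x)) ` S = T)"

text \<open>The model is a pair of concentric circles in the affine chart \<open>w = 1\<close>.\<close>

definition two_nested_ovals :: "(real^3) set set \<Rightarrow> bool" where
  "two_nested_ovals S \<longleftrightarrow> ambient_isotopic real_projective_plane S
    {pt x | x. x \<noteq> 0 \<and>
      ((x$1)\<^sup>2 + (x$2)\<^sup>2 = (x$3)\<^sup>2 \<or> (x$1)\<^sup>2 + (x$2)\<^sup>2 = 4 * (x$3)\<^sup>2)}"


text \<open>
  The double cover of \<open>P^1 \<times> P^2\<close> is branched over a divisor of bidegree \<open>(2, 2)\<close>, so \<open>z\<close> is a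
  coordinate on the line bundle \<open>O(1, 1)\<close>: the triples \<open>(t, x, z)\<close> and \<open>(\<lambda>t, \<mu>x, \<lambda>\<mu>z)\<close> are
  the same point.
\<close>

definition Y_cone :: "real^3^3 \<Rightarrow> real^3^3 \<Rightarrow> real^3^3 \<Rightarrow> ((real^2) \<times> (real^3) \<times> real) set" where
  "Y_cone M1 M2 M3 = {(t, x, z). t \<noteq> 0 \<and> x \<noteq> 0 \<and>
    z\<^sup>2 = (t$1)\<^sup>2 * qform M1 x + 2 * t$1 * t$2 * qform M2 x + (t$2)\<^sup>2 * qform M3 x}"

definition Y_pt :: "(real^2) \<times> (real^3) \<times> real \<Rightarrow> ((real^2) \<times> (real^3) \<times> real) set" where
  "Y_pt = (\<lambda>(t, x, z). {(l *s t, m *s x, l * m * z) | l m. l \<noteq> 0 \<and> m \<noteq> 0})"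

definition Y_real :: "real^3^3 \<Rightarrow> real^3^3 \<Rightarrow> real^3^3 \<Rightarrow> ((real^2) \<times> (real^3) \<times> real) set topology" where
  "Y_real M1 M2 M3 = quotient_topology (top_of_set (Y_cone M1 M2 M3)) Y_pt"


text \<open>
  \<open>E\<close> is the divisor cut out on the quartic by the line \<open>a\<^sub>1u + a\<^sub>2v + a\<^sub>3w = 0\<close>: the intersection
  multiplicity at \<open>[x]\<close> is the order of vanishing at \<open>\<lambda> = 0\<close> of the restriction of the quartic
  to the parametrization \<open>x + \<lambda>y\<close> of the line, for any other point \<open>[y]\<close> of the line. (The
  restriction is not the zero polynomial, since a smooth quartic contains no line.)
\<close>

definition line_section ::
    "real^3^3 \<Rightarrow> real^3^3 \<Rightarrow> real^3^3 \<Rightarrow> real^3 \<Rightarrow> (complex^3) set multiset \<Rightarrow> bool" where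
  "line_section M1 M2 M3 a E \<longleftrightarrow>
    (let on_line = (\<lambda>x. (\<Sum>i\<in>UNIV. cvec a $ i * x $ i) = 0);
         pmat = map_matrix (\<lambda>c. [:complex_of_real c:])
     in (\<forall>P \<in># E. \<exists>x. x \<noteq> 0 \<and> on_line x \<and> P = pt x) \<and>
        (\<forall>x y. x \<noteq> 0 \<and> on_line x \<and> on_line y \<and> y \<notin> vec.span {x} \<longrightarrow>
          count E (pt x) =
            order 0 (quartic (pmat M1) (pmat M2) (pmat M3) (\<chi> i. [:x$i, y$i:]))))"

text \<open>
  A local parametrization of the cover at \<open>[p]\<close>: a power series solution \<open>\<gamma>(\<lambda>)\<close> of the equations
  with \<open>\<gamma>(0) = p\<close> and nonzero velocity in projective space. As the cover is a smooth curve, one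
  exists at each of its points and is unique up to reparametrization and scaling by a unit. The
  order of vanishing along \<open>\<gamma>\<close> of a linear form is thus the order of its divisor on the cover at
  \<open>[p]\<close>.
\<close>

definition local_param ::
    "real^3^3 \<Rightarrow> real^3^3 \<Rightarrow> real^3^3 \<Rightarrow> complex^5 \<Rightarrow> complex fps^5 \<Rightarrow> bool" where
  "local_param M1 M2 M3 p \<gamma> \<longleftrightarrow>
    (let fmat = map_matrix (\<lambda>c. fps_const (complex_of_real c)) in
      p \<noteq> 0 \<and> on_cover (fmat M1) (fmat M2) (fmat M3) \<gamma> \<and>
      (\<chi> i. fps_nth (\<gamma>$i) 0) = p \<and> (\<chi> i. fps_nth (\<gamma>$i) 1) \<notin> vec.span {p})"

text \<open>
  Containment, as a subscheme, of an effective divisor \<open>D\<close> on the cover in the linear subspace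
  given by \<open>W\<close>: every linear form \<open>b\<close> that vanishes on \<open>W\<close> vanishes at each point of the cover to
  at least the order prescribed by \<open>D\<close>.
\<close>

definition contained_in_subspace ::
    "real^3^3 \<Rightarrow> real^3^3 \<Rightarrow> real^3^3 \<Rightarrow> (complex^5) set multiset \<Rightarrow> (complex^5) set \<Rightarrow> bool" where
  "contained_in_subspace M1 M2 M3 D W \<longleftrightarrow>
    (\<forall>b. (\<forall>x\<in>W. (\<Sum>i\<in>UNIV. b$i * x$i) = 0) \<longrightarrow>
      (\<forall>p \<gamma>. local_param M1 M2 M3 p \<gamma> \<longrightarrow>
        (\<forall>k < count D (pt p). fps_nth (\<Sum>i\<in>UNIV. fps_const (b$i) * \<gamma>$i) k = 0)))"

definition contained_in_plane ::
    "real^3^3 \<Rightarrow> real^3^3 \<Rightarrow> real^3^3 \<Rightarrow> (complex^5) set multiset \<Rightarrow> bool" where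
  "contained_in_plane M1 M2 M3 D \<longleftrightarrow>
    (\<exists>W. vec.subspace W \<and> vec.dim W = 3 \<and> contained_in_subspace M1 M2 M3 D W)"

definition conj_pt :: "(complex^'n) set \<Rightarrow> (complex^'n) set" where
  "conj_pt P = (\<lambda>x. \<chi> i. cnj (x$i)) ` P"

text \<open>
  The divisors that represent the real points of the torsor \<open>P~^(1)\<close>. On the
  multisets, \<open>image_mset ((`) uvw)\<close> is the push-forward of divisors along the projection
  to the quartic.
\<close>

definition Ptilde1_real_divisors ::
    "real^3^3 \<Rightarrow> real^3^3 \<Rightarrow> real^3^3 \<Rightarrow> (complex^5) set multiset set" where
  "Ptilde1_real_divisors M1 M2 M3 =
    {D. size D = 4 \<and> set_mset D \<subseteq> cover_points M1 M2 M3 \<and> image_mset conj_pt D = D \<and>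
        (\<exists>a. a \<noteq> 0 \<and> line_section M1 M2 M3 a (image_mset ((`) uvw) D)) \<and>
        \<not> contained_in_plane M1 M2 M3 D}"

text \<open>
  The obstruction vanishes if and only if \<open>P~^(1)\<close> has a real point; this is taken as the
  definition.
\<close>

definition IJT_obstruction_vanishes :: "real^3^3 \<Rightarrow> real^3^3 \<Rightarrow> real^3^3 \<Rightarrow> bool" where
  "IJT_obstruction_vanishes M1 M2 M3 \<longleftrightarrow> Ptilde1_real_divisors M1 M2 M3 \<noteq> {}"

end

theory Submission
  imports Defs "HOL-Computational_Algebra.Fundamental_Theorem_Algebra"
begin

text \<open>
  Over a real point \<open>x\<close> of the plane the fibre of \<open>Y\<close> is the real conic \<open>z^2 = q\<^sub>x(t)\<close>, where
  \<open>q\<^sub>x(t) = t\<^sub>0^2 Q\<^sub>1 + 2 t\<^sub>0 t\<^sub>1 Q\<^sub>2 + t\<^sub>1^2 Q\<^sub>3\<close>; it is connected, and empty exactly if \<open>q\<^sub>x\<close> is negative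
  definite. Hence \<open>Y\<close> is connected unless \<open>q\<^sub>x\<close> is negative definite precisely on the annulus between
  the two ovals. In that case the quartic \<open>F = Q\<^sub>1 Q\<^sub>3 - Q\<^sub>2^2\<close> is positive on the annulus and negative inside
  and outside. The set \<open>{x. q\<^sub>x(t) \<ge> 0}\<close> is connected and misses the annulus for every \<open>t\<close>, so a
  connectedness argument on the circle of all \<open>t\<close> yields a negative definite member of the net. Then the cover
  has no real points, and a real divisor as in the definition of the torsor has the form
  \<open>P + conj P + R + conj R\<close>. So the sign of \<open>F\<close> is constant on the line cutting it out; it is negative since
  a line cannot be contained in a closed disc.

  On such a line \<open>q\<^sub>x\<close> is a pencil of binary quadratic forms in \<open>x\<close>. The set of \<open>t\<close> for which the
  form is positive semidefinite on the line is a nonempty interval, and at its ends the form is the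
  square of a real linear form \<open>L\<close>. Thus \<open>t\<^sub>0 r + t\<^sub>1 s = \<plusminus>L\<close> at the points of the divisor. If for both ends the
  signs at \<open>P\<close> and \<open>R\<close> differed, the products of the signs would agree, and the polar form of the two ends would be
  the product of the two linear forms, which makes \<open>F\<close> vanish on the line. Hence the divisor lies in a plane.
\<close>

section \<open>Pencils of binary quadratic forms\<close>

text \<open>A plane in P^4 needs two equations: that of the line, and a relation
  \<open>t0 r + t1 s = L\<close> with one \<open>L\<close> valid on the whole divisor. As
  \<open>t0\<close>, \<open>t1\<close> and \<open>L\<close> are real, conj P and conj R follow from
  P and R, so all that is at stake is a pair of signs. Two obstacles shape the proof. First, the
  parameters form a circle, and arcs of a circle that meet in pairs need not have a common point; a
  rotation puts the negative definite member at infinity, which turns the arcs into compact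
  intervals of the real line, where the supremum of the left ends lies below all right ends. Second,
  the containment in a plane is one of schemes. It is pointwise at simple points of the divisor, but
  for R = P the relation must hold to second order. Hence the algebra also records whether
  \<open>L\<close> vanishes at the root: if not, \<open>T + L\<close> (with
  \<open>T = t0 r + t1 s\<close>) is a unit there and can be cancelled from
  \<open>(T - L)(T + L)\<close>; the other case occurs at a real root, where \<open>L\<close> is
  zero and the line meets the quartic with multiplicity four.\<close>

definition binform :: "'a::comm_ring_1 \<Rightarrow> 'a \<Rightarrow> 'a \<Rightarrow> 'a \<Rightarrow> 'a \<Rightarrow> 'a" where
  "binform k m n a b = k * a^2 + 2 * m * a * b + n * b^2"

text \<open>Semidefiniteness makes the determinant \<open>k n - m^2\<close> nonnegative and a
  nontrivial zero makes it nonpositive, so the form has rank at most one.\<close>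

lemma binform_psd_square:
  fixes k m n :: real
  assumes psd: "\<And>a b. binform k m n a b \<ge> 0"
    and zero: "binform k m n a0 b0 = 0" "a0 \<noteq> 0 \<or> b0 \<noteq> 0"
  obtains l0 l1 where "k = l0^2" "m = l0 * l1" "n = l1^2"
proof -
  have k: "k \<ge> 0" using psd[of 1 0] by (simp add: binform_def)
  have n: "n \<ge> 0" using psd[of 0 1] by (simp add: binform_def)
  have disc: "k * n = m^2"
  proof (rule antisym)
    \<comment> \<open>The form times a diagonal coefficient is a determinant term plus a square, so
      at a zero the determinant cannot be positive.\<close>
    have "binform k m n a0 b0 * n = (k * n - m^2) * a0^2 + (m * a0 + n * b0)^2"
      "binform k m n a0 b0 * k = (k * n - m^2) * b0^2 + (k * a0 + m * b0)^2"
      unfolding binform_def by algebra+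
    then have *: "(k * n - m^2) * a0^2 + (m * a0 + n * b0)^2 = 0"
      "(k * n - m^2) * b0^2 + (k * a0 + m * b0)^2 = 0" using zero by auto
    show "k * n \<le> m^2"
    proof (rule ccontr)
      assume "\<not> ?thesis"
      then have pos: "k * n - m^2 > 0" by simp
      have "(k * n - m^2) * a0^2 \<le> 0" "(k * n - m^2) * b0^2 \<le> 0"
        using * zero_le_power2[of "m * a0 + n * b0"] zero_le_power2[of "k * a0 + m * b0"] by linarith+
      then have "a0^2 \<le> 0" "b0^2 \<le> 0" using pos by (simp_all add: mult_le_0_iff)
      then show False using zero by simp
    qed
    \<comment> \<open>Evaluation at (n, -m) and at (-m, k) gives the determinant times n and times
      k.\<close>
    have 1: "n * (k * n - m^2) \<ge> 0"
      using psd[of n "-m"] by (simp add: binform_def power2_eq_square algebra_simps)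
    have 2: "k * (k * n - m^2) \<ge> 0"
      using psd[of "-m" k] by (simp add: binform_def power2_eq_square algebra_simps)
    show "m^2 \<le> k * n"
    proof (rule ccontr)
      assume "\<not> ?thesis"
      then have neg0: "k * n - m^2 < 0" by simp
      then have "n \<le> 0" "k \<le> 0" using 1 2 by (simp_all add: zero_le_mult_iff)
      then have "n = 0" "k = 0" using k n by auto
      then have "m^2 \<le> 0" using psd[of 1 "-m"] by (simp add: binform_def power2_eq_square)
      then have "m = 0" by simp
      then show False using neg0 \<open>n = 0\<close> by simp
    qed
  qed
  show ?thesis
  \<comment> \<open>Only the product of the two roots sees the sign of \<open>m\<close>, so that
    sign is put on the second.\<close>
  proof (rule that[of "sqrt k" "(if m < 0 then -1 else 1) * sqrt n"])
    have "sqrt k * sqrt n = \<bar>m\<bar>" by (simp add: disc flip: real_sqrt_mult)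
    then show "m = sqrt k * ((if m < 0 then -1 else 1) * sqrt n)" by auto
  qed (use k n in \<open>auto simp: power2_eq_square\<close>)
qed

text \<open>For \<open>q1 < 0\<close> the parameters \<open>\<tau>\<close> with \<open>\<tau>^2 q1 + 2 \<tau> q2 + q3 \<ge> 0\<close> form an interval;
  \<open>lower_root\<close> is its left end.\<close>

definition lower_root :: "real \<Rightarrow> real \<Rightarrow> real \<Rightarrow> real" where
  "lower_root q1 q2 q3 = (- q2 + sqrt (q2^2 - q1 * q3)) / q1"

lemma complete_square:
  fixes q1 q2 q3 t :: "'a::comm_ring_1"
  shows "q1 * (t^2 * q1 + 2 * t * q2 + q3) = (q1 * t + q2)^2 - (q2^2 - q1 * q3)"
  by (simp add: power2_eq_square algebra_simps)

text \<open>The reflection of t to -t negates \<open>q2\<close> and exchanges the ends of the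
  interval; hence the right end is minus the lower root for \<open>-q2\<close>, and facts on right
  ends reduce to left ends.\<close>

lemma lower_root_iff:
  assumes "q1 < 0" "q1 * q3 - q2^2 \<le> 0"
  shows "t^2 * q1 + 2 * t * q2 + q3 \<ge> 0 \<longleftrightarrow> lower_root q1 q2 q3 \<le> t \<and> t \<le> - lower_root q1 (-q2) q3"
proof -
  let ?d = "sqrt (q2^2 - q1 * q3)"
  have "t^2 * q1 + 2 * t * q2 + q3 \<ge> 0 \<longleftrightarrow> q1 * (t^2 * q1 + 2 * t * q2 + q3) \<le> 0"
    using assms(1) by (simp add: mult_le_0_iff)
  also have "\<dots> \<longleftrightarrow> (q1 * t + q2)^2 \<le> q2^2 - q1 * q3" unfolding complete_square by simp
  also have "\<dots> \<longleftrightarrow> \<bar>q1 * t + q2\<bar> \<le> ?d"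
    using assms(2) by (metis real_sqrt_abs real_sqrt_le_iff)
  also have "\<dots> \<longleftrightarrow> q1 * t \<le> - q2 + ?d \<and> - q2 - ?d \<le> q1 * t" by auto
  also have "\<dots> \<longleftrightarrow> lower_root q1 q2 q3 \<le> t \<and> t \<le> (- q2 - ?d) / q1"
    using assms(1) by (simp add: lower_root_def field_simps)
  also have "(- q2 - ?d) / q1 = - lower_root q1 (-q2) q3"
    using assms(1) by (simp add: lower_root_def field_simps)
  finally show ?thesis .
qed

lemma lower_root_zero:
  assumes "q1 < 0" "q1 * q3 - q2^2 \<le> 0" "t = lower_root q1 q2 q3 \<or> t = - lower_root q1 (-q2) q3"
  shows "t^2 * q1 + 2 * t * q2 + q3 = 0"
proof -
  have "q1 * t + q2 = sqrt (q2^2 - q1 * q3) \<or> q1 * t + q2 = - sqrt (q2^2 - q1 * q3)"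
    using assms(1,3) by (auto simp: lower_root_def field_simps)
  then have "(q1 * t + q2)^2 = q2^2 - q1 * q3"
    using assms(2) by (auto simp: power2_minus)
  then have "q1 * (t^2 * q1 + 2 * t * q2 + q3) = 0" unfolding complete_square by simp
  then show ?thesis using assms by simp
qed

text \<open>\<open>q1 * t + q2\<close> is half the derivative in t of a concave quadratic whose
  vertex lies in the interval, so its sign tells on which side of the interval t lies. If the
  interval has positive length this includes its ends.\<close>

lemma lower_root_mid:
  assumes "q1 < 0" "q1 * q3 - q2^2 \<le> 0"
  shows "t < lower_root q1 q2 q3 \<Longrightarrow> q1 * t + q2 > 0" "- lower_root q1 (-q2) q3 < t \<Longrightarrow> q1 * t + q2 < 0"
    "t \<le> lower_root q1 q2 q3 \<Longrightarrow> q1 * q3 - q2^2 < 0 \<Longrightarrow> q1 * t + q2 > 0"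
    "- lower_root q1 (-q2) q3 \<le> t \<Longrightarrow> q1 * q3 - q2^2 < 0 \<Longrightarrow> q1 * t + q2 < 0"
proof -
  let ?d = "sqrt (q2^2 - q1 * q3)"
  have d: "?d \<ge> 0" using assms by simp
  { assume "t < lower_root q1 q2 q3"
    then have "q1 * t + q2 > ?d" using assms(1) by (simp add: lower_root_def field_simps)
    then show "q1 * t + q2 > 0" using d by linarith }
  { assume "- lower_root q1 (-q2) q3 < t"
    then have "q1 * t + q2 < - ?d" using assms(1) by (simp add: lower_root_def field_simps)
    then show "q1 * t + q2 < 0" using d by linarith }
  { assume t: "t \<le> lower_root q1 q2 q3" "q1 * q3 - q2^2 < 0"
    then have "q1 * t + q2 \<ge> ?d" "?d > 0" using assms(1) by (simp_all add: lower_root_def field_simps)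
    then show "q1 * t + q2 > 0" by linarith }
  { assume t: "- lower_root q1 (-q2) q3 \<le> t" "q1 * q3 - q2^2 < 0"
    then have "q1 * t + q2 \<le> - ?d" "?d > 0" using assms(1) by (simp_all add: lower_root_def field_simps)
    then show "q1 * t + q2 < 0" by linarith }
qed


text \<open>The net restricted to a line on which the quartic is nonpositive, with the negative
  definite member at parameter infinity. Each point [a:b] of the line then has a nonempty compact
  interval of parameters with nonnegative value.\<close>

locale binary_pencil =
  fixes k1 m1 n1 k2 m2 n2 k3 m3 n3 :: real
  assumes neg: "a \<noteq> 0 \<or> b \<noteq> 0 \<Longrightarrow> binform k1 m1 n1 a b < 0"
    and disc: "binform k1 m1 n1 a b * binform k3 m3 n3 a b - (binform k2 m2 n2 a b)^2 \<le> 0"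
begin

abbreviation "q1 \<equiv> binform k1 m1 n1"
abbreviation "q2 \<equiv> binform k2 m2 n2"
abbreviation "q3 \<equiv> binform k3 m3 n3"
abbreviation "qt t \<equiv> binform (t^2 * k1 + 2 * t * k2 + k3) (t^2 * m1 + 2 * t * m2 + m3)
  (t^2 * n1 + 2 * t * n2 + n3)"

definition lo where "lo a b = lower_root (q1 a b) (q2 a b) (q3 a b)"
definition hi where "hi a b = - lower_root (q1 a b) (- q2 a b) (q3 a b)"

lemma qt: "qt t a b = t^2 * q1 a b + 2 * t * q2 a b + q3 a b"
  by (simp add: binform_def algebra_simps)

lemma qt_nonneg: "a \<noteq> 0 \<or> b \<noteq> 0 \<Longrightarrow> qt t a b \<ge> 0 \<longleftrightarrow> lo a b \<le> t \<and> t \<le> hi a b"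
  unfolding qt lo_def hi_def using neg disc by (rule lower_root_iff)

lemma qt_zero: "a \<noteq> 0 \<or> b \<noteq> 0 \<Longrightarrow> qt (lo a b) a b = 0" "a \<noteq> 0 \<or> b \<noteq> 0 \<Longrightarrow> qt (hi a b) a b = 0"
  unfolding qt lo_def hi_def by (rule lower_root_zero; use neg disc in simp)+

lemma qt_segment:
  fixes a b a' b' s :: real
  shows "binform k m n ((1-s)*a+s*a') ((1-s)*b+s*b') =
    (1-s)^2 * binform k m n a b + 2 * s * (1-s) * (k*a*a'+m*(a*b'+b*a')+n*b*b') + s^2 * binform k m n a' b'"
  by (simp add: binform_def power2_eq_square algebra_simps)

lemma binform_scale: "binform k m n (c*a) (c*b) = c^2 * binform k m n a (b::real)"
  by (simp add: binform_def power2_eq_square algebra_simps)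

lemma lo_scale: assumes "c \<noteq> 0" shows "lo (c*a) (c*b) = lo a b" "hi (c*a) (c*b) = hi a b"
proof -
  have "(c^2 * q2 a b)^2 - c^2 * q1 a b * (c^2 * q3 a b) = (c^2)^2 * ((q2 a b)^2 - q1 a b * q3 a b)"
    by (simp add: power2_eq_square algebra_simps)
  moreover have "sqrt ((c^2)^2 * X) = c^2 * sqrt X" for X
    unfolding real_sqrt_mult real_sqrt_abs abs_power2 by (rule refl)
  ultimately have *: "sqrt ((c^2 * q2 a b)^2 - c^2 * q1 a b * (c^2 * q3 a b)) = c^2 * sqrt ((q2 a b)^2 - q1 a b * q3 a b)"
    by (simp only:)
  have c: "c^2 \<noteq> 0" using assms by simp
  have "(- (c^2 * q2 a b) + c^2 * sqrt ((q2 a b)^2 - q1 a b * q3 a b)) / (c^2 * q1 a b)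
      = (- q2 a b + sqrt ((q2 a b)^2 - q1 a b * q3 a b)) / q1 a b"
    unfolding mult_minus_right[symmetric] distrib_left[symmetric]
    using c by (rule mult_divide_mult_cancel_left)
  then show "lo (c*a) (c*b) = lo a b"
    unfolding lo_def lower_root_def binform_scale * .
  have "((c^2 * q2 a b) + c^2 * sqrt ((q2 a b)^2 - q1 a b * q3 a b)) / (c^2 * q1 a b)
      = (q2 a b + sqrt ((q2 a b)^2 - q1 a b * q3 a b)) / q1 a b"
    unfolding distrib_left[symmetric]
    using c by (rule mult_divide_mult_cancel_left)
  then show "hi (c*a) (c*b) = hi a b"
    by (simp only: hi_def lower_root_def binform_scale power2_minus minus_minus *)
qed

text \<open>If a parameter \<open>t\<close> with negative form values at both points separated the two intervals, then
  the form would be negative on a segment joining the points, while the interval moves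
  past \<open>t\<close> along that segment.\<close>

lemma lo_le_hi:
  assumes x: "a \<noteq> 0 \<or> b \<noteq> 0" and y: "a' \<noteq> 0 \<or> b' \<noteq> 0"
  shows "lo a b \<le> hi a' b'"
proof (rule ccontr)
  assume "\<not> ?thesis"
  then obtain t where t: "hi a' b' < t" "t < lo a b" using dense[of "hi a' b'" "lo a b"] by auto
  define K M N where "K = t^2 * k1 + 2 * t * k2 + k3" "M = t^2 * m1 + 2 * t * m2 + m3"
    "N = t^2 * n1 + 2 * t * n2 + n3"
  note KMN = this
  let ?B = "K*a*a'+M*(a*b'+b*a')+N*b*b'"
  \<comment> \<open>Negating the representative of the second point negates the polar term;
    \<open>e\<close> makes it nonpositive, which keeps the form negative along the segment.\<close>
  define e :: real where "e = (if ?B \<le> 0 then 1 else -1)"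
  have e: "e * ?B \<le> 0" "e^2 = 1" by (auto simp: e_def)
  let ?a = "\<lambda>s. (1-s)*a+s*(e*a')" and ?b = "\<lambda>s. (1-s)*b+s*(e*b')"
  have q: "qt t a b < 0" "qt t a' b' < 0" using t qt_nonneg[OF x, of t] qt_nonneg[OF y, of t] by linarith+
  have neg': "qt t (?a s) (?b s) < 0" if s: "0 \<le> s" "s \<le> 1" for s
  proof -
    have "K*a*(e*a')+M*(a*(e*b')+b*(e*a'))+N*b*(e*b') = e * ?B"
      by (simp add: algebra_simps)
    then have "qt t (?a s) (?b s) = (1-s)^2 * qt t a b + 2 * s * (1-s) * (e * ?B) + s^2 * qt t a' b'"
      unfolding KMN[symmetric] qt_segment by (simp only: binform_scale e(2) mult_1)
    moreover have "2 * s * (1-s) * (e * ?B) \<le> 0"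
      using s by (intro mult_nonneg_nonpos[OF _ e(1)]) auto
    moreover have "(1-s)^2 * qt t a b + s^2 * qt t a' b' < 0"
    proof (cases "s = 0")
      case False
      then have "s^2 * qt t a' b' < 0" using q by (intro mult_pos_neg) auto
      moreover have "(1-s)^2 * qt t a b \<le> 0" using q by (intro mult_nonneg_nonpos) auto
      ultimately show ?thesis by linarith
    qed (use q in simp)
    ultimately show ?thesis by linarith
  qed
  \<comment> \<open>Half the derivative in t. At its zero, \<open>q1\<close> times the form at t
    equals \<open>q1 * q3 - q2^2\<close>, hence is nonpositive, while both factors are
    negative.\<close>
  let ?g = "\<lambda>s. q1 (?a s) (?b s) * t + q2 (?a s) (?b s)"
  have "\<exists>s\<ge>0. s \<le> 1 \<and> ?g s = 0"
  proof (rule IVT2')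
    have "?g 1 = q1 a' b' * t + q2 a' b'"
      by (simp add: binform_scale e)
    also have "\<dots> \<le> 0"
      using lower_root_mid(2)[OF neg[OF y] disc, of t] t unfolding hi_def by simp
    finally show "?g 1 \<le> 0" .
    show "0 \<le> ?g 0" using lower_root_mid(1)[OF neg[OF x] disc, of t] t unfolding lo_def by simp
    show "continuous_on {0..1} ?g" unfolding binform_def by (intro continuous_intros)
  qed simp
  then obtain s where s: "0 \<le> s" "s \<le> 1" "?g s = 0" by blast
  have "q1 (?a s) (?b s) * qt t (?a s) (?b s) \<le> 0"
    unfolding qt complete_square s(3) using disc by simp
  moreover have nz: "?a s \<noteq> 0 \<or> ?b s \<noteq> 0"
  proof (rule ccontr)
    assume "\<not> ?thesis"
    then have "?a s = 0" "?b s = 0" by auto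
    then show False using neg'[OF s(1,2)] by (simp only:) (simp add: binform_def)
  qed
  ultimately show False using mult_neg_neg[OF neg[OF nz] neg'[OF s(1,2)]] by linarith
qed

text \<open>With equality the form at the common parameter would be semidefinite with zeros at both
  points, hence zero on the segment between them, while the half derivative changes sign there. At
  its zero \<open>q1 * q3 - q2^2\<close> vanishes, against \<open>strict\<close> unless the segment
  passes through the origin.\<close>

lemma lo_less_hi:
  assumes x: "a \<noteq> 0 \<or> b \<noteq> 0" and y: "a' \<noteq> 0 \<or> b' \<noteq> 0"
    and strict: "\<And>a b. a \<noteq> 0 \<or> b \<noteq> 0 \<Longrightarrow> q1 a b * q3 a b - (q2 a b)^2 < 0"
  shows "lo a b < hi a' b'"
proof (rule ccontr)
  assume "\<not> ?thesis"
  then have eq: "lo a b = hi a' b'" using lo_le_hi[OF x y] by simp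
  define t where "t = lo a b"
  have psd: "qt t c d \<ge> 0" for c d
  proof (cases "c \<noteq> 0 \<or> d \<noteq> 0")
    case True
    then show ?thesis using qt_nonneg[OF True] lo_le_hi[OF True y] lo_le_hi[OF x True] eq t_def by simp
  qed (simp add: binform_def)
  define K M N where "K = t^2 * k1 + 2 * t * k2 + k3" "M = t^2 * m1 + 2 * t * m2 + m3"
    "N = t^2 * n1 + 2 * t * n2 + n3"
  note KMN = this
  let ?B = "K*a*a'+M*(a*b'+b*a')+N*b*b'"
  have q: "binform K M N a b = 0" "binform K M N a' b' = 0"
    using qt_zero(1)[OF x] qt_zero(2)[OF y] eq unfolding KMN t_def by simp_all
  \<comment> \<open>The values at the sum and the difference are plus and minus twice the polar
    term, and both are nonnegative.\<close>
  have "binform K M N (a+a') (b+b') = 2 * ?B" "binform K M N (a-a') (b-b') = - (2 * ?B)"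
    using q by (simp_all add: binform_def power2_eq_square algebra_simps)
  then have "2 * ?B \<ge> 0" "- (2 * ?B) \<ge> 0"
    using psd[of "a+a'" "b+b'"] psd[of "a-a'" "b-b'"] unfolding KMN[symmetric] by simp_all
  then have B: "?B = 0" by simp
  let ?a = "\<lambda>s. (1-s)*a+s*a'" and ?b = "\<lambda>s. (1-s)*b+s*b'"
  have z: "qt t (?a s) (?b s) = 0" for s
    unfolding KMN[symmetric] qt_segment B q by simp
  let ?g = "\<lambda>s. q1 (?a s) (?b s) * t + q2 (?a s) (?b s)"
  have g1: "q1 a' b' * t + q2 a' b' < 0"
    using lower_root_mid(4)[OF neg[OF y] disc _ strict[OF y], of t] eq t_def unfolding hi_def by linarith
  have g0: "0 < q1 a b * t + q2 a b" 
    using lower_root_mid(3)[OF neg[OF x] disc _ strict[OF x], of t] t_def unfolding lo_def by linarith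
  have "\<exists>s\<ge>0. s \<le> 1 \<and> ?g s = 0"
  proof (rule IVT2')
    show "?g 1 \<le> 0" using g1 by simp
    show "0 \<le> ?g 0" using g0 by simp
    show "continuous_on {0..1} ?g" unfolding binform_def by (intro continuous_intros)
  qed simp
  then obtain s where s: "0 \<le> s" "s \<le> 1" "?g s = 0" by blast
  have "q1 (?a s) (?b s) * q3 (?a s) (?b s) - (q2 (?a s) (?b s))^2 = 0"
    using complete_square[of "q1 (?a s) (?b s)" t "q2 (?a s) (?b s)" "q3 (?a s) (?b s)"] z[of s]
    unfolding qt s(3) by simp
  then have zero: "?a s = 0" "?b s = 0" using strict[of "?a s" "?b s"] by (metis less_irrefl)+
  \<comment> \<open>The points are proportional, and scaling multiplies the half derivative by a
    square, so its signs at the two points cannot differ.\<close>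
  have "s \<noteq> 0" using zero x by auto
  then have "a' = (s - 1) / s * a" "b' = (s - 1) / s * b" using zero by (auto simp: field_simps)
  then have "q1 a' b' * t + q2 a' b' = ((s-1)/s)^2 * (q1 a b * t + q2 a b)"
    by (simp only: binform_scale distrib_left mult.assoc)
  also have "\<dots> \<ge> 0" using g0 by simp
  finally show False using g1 by simp
qed

lemma lo_attains_sup: 
  obtains a b where "a \<noteq> 0 \<or> b \<noteq> 0" "\<And>c d. c \<noteq> 0 \<or> d \<noteq> 0 \<Longrightarrow> lo c d \<le> lo a b"
proof -
  have "continuous_on (sphere (0::real\<times>real) 1) (\<lambda>v. lo (fst v) (snd v))"
    unfolding lo_def lower_root_def
  proof (rule continuous_on_divide)
    show "\<forall>v\<in>sphere 0 1. q1 (fst v) (snd v) \<noteq> 0"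
    proof
      fix v :: "real \<times> real" assume "v \<in> sphere 0 1"
      then have "fst v \<noteq> 0 \<or> snd v \<noteq> 0" by (cases v) auto
      then show "q1 (fst v) (snd v) \<noteq> 0" using neg by (metis less_irrefl)
    qed
  qed (auto simp: binform_def intro!: continuous_intros)
  moreover have "compact (sphere (0::real\<times>real) 1)" by simp
  moreover have "(1,0) \<in> sphere (0::real\<times>real) 1" by simp
  ultimately obtain v where v: "v \<in> sphere (0::real\<times>real) 1"
    "\<And>w. w \<in> sphere 0 1 \<Longrightarrow> lo (fst w) (snd w) \<le> lo (fst v) (snd v)"
    using continuous_attains_sup[of "sphere (0::real\<times>real) 1" "\<lambda>v. lo (fst v) (snd v)"] by blast
  show ?thesis
  proof (rule that[of "fst v" "snd v"])
    show "fst v \<noteq> 0 \<or> snd v \<noteq> 0" using v(1) by (cases v) auto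
    fix c d :: real assume cd: "c \<noteq> 0 \<or> d \<noteq> 0"
    define r where "r = inverse (norm (c,d))"
    have r: "r \<noteq> 0" using cd by (auto simp: r_def zero_prod_def)
    have "(r*c, r*d) = r *\<^sub>R (c,d)" by simp
    then have "norm (r*c, r*d) = 1" using cd by (simp add: r_def zero_prod_def del: scaleR_Pair)
    then have "(r*c,r*d) \<in> sphere 0 1" by simp
    from v(2)[OF this] show "lo c d \<le> lo (fst v) (snd v)" using lo_scale[OF r] by simp
  qed
qed

text \<open>Take the largest left end. It is at most every right end, so the form is semidefinite
  there, and it vanishes where the maximum is attained.\<close>

lemma lower_square:
  obtains t l0 l1 where
    "t^2 * k1 + 2 * t * k2 + k3 = l0^2" "t^2 * m1 + 2 * t * m2 + m3 = l0 * l1"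
    "t^2 * n1 + 2 * t * n2 + n3 = l1^2" 
    "\<And>a b. a \<noteq> 0 \<or> b \<noteq> 0 \<Longrightarrow> lo a b \<le> t" "\<exists>a b. (a \<noteq> 0 \<or> b \<noteq> 0) \<and> t = lo a b"
proof -
  obtain a b where ab: "a \<noteq> 0 \<or> b \<noteq> 0" "\<And>c d. c \<noteq> 0 \<or> d \<noteq> 0 \<Longrightarrow> lo c d \<le> lo a b"
    using lo_attains_sup by blast
  have "qt (lo a b) c d \<ge> 0" for c d
  proof (cases "c \<noteq> 0 \<or> d \<noteq> 0")
    case True
    then show ?thesis using qt_nonneg[OF True] lo_le_hi[OF ab(1) True] ab(2)[OF True] by simp
  qed (simp add: binform_def)
  then obtain l0 l1 where "(lo a b)^2 * k1 + 2 * (lo a b) * k2 + k3 = l0^2"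
    "(lo a b)^2 * m1 + 2 * (lo a b) * m2 + m3 = l0 * l1"
    "(lo a b)^2 * n1 + 2 * (lo a b) * n2 + n3 = l1^2"
    using binform_psd_square[OF _ qt_zero(1)[OF ab(1)] ab(1)] by blast
  then show ?thesis using that[OF _ _ _ ab(2)] ab(1) by blast
qed

end

text \<open>Reflecting the parameter negates the middle form and exchanges left and right ends, so
  \<open>upper_square\<close> follows from \<open>lower_square\<close>.\<close>

lemma binary_pencil_reflect:
  assumes "binary_pencil k1 m1 n1 k2 m2 n2 k3 m3 n3"
  shows "binary_pencil k1 m1 n1 (-k2) (-m2) (-n2) k3 m3 n3"
proof -
  interpret binary_pencil k1 m1 n1 k2 m2 n2 k3 m3 n3 by fact
  have "binform (-k2) (-m2) (-n2) a b = - binform k2 m2 n2 a b" for a b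
    by (simp add: binform_def)
  then show ?thesis using neg disc by unfold_locales (auto simp: power2_minus)
qed

context binary_pencil
begin

lemma upper_square:
  obtains t l0 l1 where
    "t^2 * k1 + 2 * t * k2 + k3 = l0^2" "t^2 * m1 + 2 * t * m2 + m3 = l0 * l1"
    "t^2 * n1 + 2 * t * n2 + n3 = l1^2" "\<exists>a b. (a \<noteq> 0 \<or> b \<noteq> 0) \<and> t = hi a b"
proof -
  interpret r: binary_pencil k1 m1 n1 "-k2" "-m2" "-n2" k3 m3 n3
    by (rule binary_pencil_reflect) unfold_locales
  have "binform (-k2) (-m2) (-n2) a b = - binform k2 m2 n2 a b" for a b
    by (simp add: binform_def)
  then have "hi a b = - r.lo a b" for a b by (simp add: hi_def r.lo_def)
  note hi = this
  obtain t l0 l1 a b where *: "t^2 * k1 + 2 * t * - k2 + k3 = l0^2"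
    "t^2 * m1 + 2 * t * - m2 + m3 = l0 * l1" "t^2 * n1 + 2 * t * - n2 + n3 = l1^2"
    "a \<noteq> 0 \<or> b \<noteq> 0" "t = r.lo a b"
    using r.lower_square by metis
  show ?thesis
  proof (rule that)
    show "(-t)^2 * k1 + 2 * (-t) * k2 + k3 = l0^2" "(-t)^2 * m1 + 2 * (-t) * m2 + m3 = l0 * l1"
      "(-t)^2 * n1 + 2 * (-t) * n2 + n3 = l1^2" using *(1-3) by simp_all
    show "\<exists>a b. (a \<noteq> 0 \<or> b \<noteq> 0) \<and> -t = hi a b"
      using *(4,5) hi[of a b] by (intro exI[of _ a] exI[of _ b]) simp
  qed
qed

end

text \<open>The conjugate of z is the other root, so the form is \<open>g2\<close> times
  \<open>(b - z a)(b - cnj z a)\<close>; for \<open>g2 = 0\<close> all coefficients vanish.\<close>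

lemma real_quadratic_nonreal_root:
  fixes g0 g1 g2 :: real and z :: complex
  assumes "of_real g0 + of_real g1 * z + of_real g2 * z^2 = 0" "z \<notin> \<real>"
  shows "g0 * a^2 + g1 * a * b + g2 * b^2 = g2 * (cmod (of_real b - z * of_real a))^2"
proof -
  obtain u v where z: "z = Complex u v" by (cases z)
  have v: "v \<noteq> 0" using assms(2) by (auto simp: z complex_is_Real_iff)
  have re: "g0 + g1 * u + g2 * (u^2 - v^2) = 0" and im: "v * (g1 + 2 * g2 * u) = 0"
    using assms(1) by (simp_all add: z complex_eq_iff power2_eq_square algebra_simps)
  from im v have g1: "g1 = - 2 * g2 * u" by simp
  with re have g0: "g0 = g2 * (u^2 + v^2)" by (simp add: power2_eq_square algebra_simps)
  show ?thesis
    unfolding g0 g1 z cmod_power2 by (simp add: power2_eq_square algebra_simps)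
qed

lemma nonreal_linear_form:
  fixes l0 l1 :: real and z :: complex
  assumes "z \<notin> \<real>" "of_real l0 + of_real l1 * z = 0"
  shows "l0 = 0" "l1 = 0"
proof -
  have "l1 * Im z = 0" using arg_cong[OF assms(2), of Im] by simp
  then show "l1 = 0" using assms(1) by (simp add: complex_is_Real_iff)
  then show "l0 = 0" using assms(2) by simp
qed

section \<open>Consistent signs at two lifted points\<close>

abbreviation cbin :: "real \<Rightarrow> real \<Rightarrow> real \<Rightarrow> complex \<Rightarrow> complex" where
  "cbin k m n \<equiv> binform (of_real k) (of_real m) (of_real n) 1"

text \<open>\<alpha> and \<beta> are the affine coordinates on the line of the images of P and R,
  and (r, s), (r', s') are the remaining coordinates on the cover. The quartic has the roots
  \<alpha>, \<beta> and their conjugates on the line; written with absolute values its sign is that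
  of \<open>c\<close>.\<close>

locale covered_pencil = binary_pencil +
  fixes c :: real and \<alpha> \<beta> r s r' s' :: complex
  assumes fact: "q1 a b * q3 a b - (q2 a b)^2 =
      c * (cmod (of_real b - \<alpha> * of_real a))^2 * (cmod (of_real b - \<beta> * of_real a))^2"
    and c: "c < 0"
    and at_\<alpha>: "cbin k1 m1 n1 \<alpha> = r^2"
      "cbin k2 m2 n2 \<alpha> = r * s"
      "cbin k3 m3 n3 \<alpha> = s^2"
    and at_\<beta>: "cbin k1 m1 n1 \<beta> = r'^2"
      "cbin k2 m2 n2 \<beta> = r' * s'"
      "cbin k3 m3 n3 \<beta> = s'^2"
    and nz: "r \<noteq> 0 \<or> s \<noteq> 0"
begin

definition square_at :: "real \<Rightarrow> real \<Rightarrow> real \<Rightarrow> bool" where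
  "square_at t l0 l1 \<longleftrightarrow> t^2 * k1 + 2 * t * k2 + k3 = l0^2 \<and>
    t^2 * m1 + 2 * t * m2 + m3 = l0 * l1 \<and> t^2 * n1 + 2 * t * n2 + n3 = l1^2"

text \<open>\<open>square_at\<close> gives \<open>T = L\<close> only up to a sign at each point;
  this demands the sign plus at both.\<close>

definition matches :: "real \<Rightarrow> real \<Rightarrow> real \<Rightarrow> bool" where
  "matches t l0 l1 \<longleftrightarrow> of_real t * r + s = of_real l0 + of_real l1 * \<alpha> \<and>
    of_real t * r' + s' = of_real l0 + of_real l1 * \<beta>"

lemma square_at_uminus: "square_at t l0 l1 \<Longrightarrow> square_at t (-l0) (-l1)"
  by (simp add: square_at_def)

lemma square_at_qt: "square_at t l0 l1 \<Longrightarrow> qt t a b = (l0 * a + l1 * b)^2"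
  unfolding square_at_def binform_def by (simp add: power2_eq_square algebra_simps)

lemma square_at_complex:
  assumes "square_at t l0 l1" 
    "cbin k1 m1 n1 z = x^2"
    "cbin k2 m2 n2 z = x * y"
    "cbin k3 m3 n3 z = y^2"
  shows "(of_real t * x + y)^2 = (of_real l0 + of_real l1 * z :: complex)^2"
proof -
  have l: "of_real (l0^2) = (of_real (t^2 * k1 + 2 * t * k2 + k3) :: complex)"
    "of_real (l0 * l1) = (of_real (t^2 * m1 + 2 * t * m2 + m3) :: complex)"
    "of_real (l1^2) = (of_real (t^2 * n1 + 2 * t * n2 + n3) :: complex)"
    using assms(1) by (simp_all add: square_at_def)
  have "(of_real t * x + y)^2 = (of_real t)^2 * x^2 + 2 * of_real t * (x * y) + y^2"
    by (simp add: power2_eq_square algebra_simps)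
  also have "\<dots> = of_real (l0^2) + 2 * of_real (l0 * l1) * z + of_real (l1^2) * z^2"
    unfolding assms(2-4)[symmetric] l binform_def by (simp add: algebra_simps)
  also have "\<dots> = (of_real l0 + of_real l1 * z)^2"
    by (simp add: power2_eq_square algebra_simps)
  finally show ?thesis .
qed

lemma sqrt_cases:
  assumes "square_at t l0 l1" 
  shows "of_real t * r + s = of_real l0 + of_real l1 * \<alpha> \<or> of_real t * r + s = - (of_real l0 + of_real l1 * \<alpha>)"
    "of_real t * r' + s' = of_real l0 + of_real l1 * \<beta> \<or> of_real t * r' + s' = - (of_real l0 + of_real l1 * \<beta>)"
  using square_at_complex[OF assms at_\<alpha>] square_at_complex[OF assms at_\<beta>]
  by (simp_all only: power2_eq_iff)

text \<open>Changing the sign of L normalises the first point; the second then agrees or not, and L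
  = 0 counts as agreement.\<close>

lemma match_or_mismatch:
  assumes "square_at t l0 l1"
  obtains l0' l1' where "square_at t l0' l1'" "matches t l0' l1'" "l0' = l0 \<and> l1' = l1 \<or> l0' = - l0 \<and> l1' = - l1"
  | l0' l1' where "square_at t l0' l1'" "l0' \<noteq> 0 \<or> l1' \<noteq> 0"
      "of_real t * r + s = of_real l0' + of_real l1' * \<alpha>"
      "of_real t * r' + s' = - (of_real l0' + of_real l1' * \<beta>)"
proof (cases "l0 = 0 \<and> l1 = 0")
  case True
  then have "matches t l0 l1" using sqrt_cases[OF assms] by (auto simp: matches_def)
  then show ?thesis using that assms by blast
next
  case False
  consider "matches t l0 l1" | "matches t (-l0) (-l1)"
    | "of_real t * r + s = of_real l0 + of_real l1 * \<alpha>" "of_real t * r' + s' = - (of_real l0 + of_real l1 * \<beta>)"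
    | "of_real t * r + s = of_real (-l0) + of_real (-l1) * \<alpha>" "of_real t * r' + s' = - (of_real (-l0) + of_real (-l1) * \<beta>)"
    using sqrt_cases[OF assms] by (auto simp: matches_def)
  then show ?thesis
    using that assms square_at_uminus[OF assms] False by cases (metis neg_equal_0_iff_equal)+
qed

lemma lower_square_at:
  obtains t l0 l1 where "square_at t l0 l1" "\<And>a b. a \<noteq> 0 \<or> b \<noteq> 0 \<Longrightarrow> lo a b \<le> t"
    "\<exists>a b. (a \<noteq> 0 \<or> b \<noteq> 0) \<and> t = lo a b"
  using lower_square unfolding square_at_def by metis

lemma upper_square_at:
  obtains t l0 l1 where "square_at t l0 l1" "\<exists>a b. (a \<noteq> 0 \<or> b \<noteq> 0) \<and> t = hi a b"
  using upper_square unfolding square_at_def by metis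

text \<open>At a real branch point both roots coincide, so \<open>t\<close> is that double root.\<close>

lemma match_real:
  assumes "\<alpha> \<in> \<real>"
  obtains t l0 l1 where "square_at t l0 l1" "matches t l0 l1" "\<alpha> = \<beta> \<longrightarrow> l0 = 0 \<and> l1 = 0"
proof -
  obtain a where a: "\<alpha> = of_real a" using assms by (auto elim: Reals_cases)
  obtain t l0 l1 where t: "square_at t l0 l1" "\<And>a b. a \<noteq> 0 \<or> b \<noteq> 0 \<Longrightarrow> lo a b \<le> t"
    "\<exists>a b. (a \<noteq> 0 \<or> b \<noteq> 0) \<and> t = lo a b" using lower_square_at by blast
  have d0: "q1 1 a * q3 1 a - (q2 1 a)^2 = 0" using fact[of 1 a] by (simp add: a)
  then have "(q2 1 a)^2 - q1 1 a * q3 1 a = 0" by simp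
  then have lohi: "lo 1 a = hi 1 a" by (simp add: lo_def hi_def lower_root_def)
  have "lo 1 a \<le> t" using t(2) by simp
  moreover have "t \<le> hi 1 a" using t(3) lo_le_hi by fastforce
  ultimately have "t = lo 1 a" using lohi by simp
  then have q0: "qt t 1 a = 0" using qt_zero(1)[of 1 a] by simp
  then have la: "l0 + l1 * a = 0" using square_at_qt[OF t(1), of 1 a] by simp
  \<comment> \<open>For \<alpha> = \<beta> real the quartic restricts to \<open>c (x - a)^4\<close>.
    Both sides of the completed square are divisible by \<open>(x - a)^2\<close>; the quotient at
    \<open>a\<close> says that \<open>q1 l1^2\<close> is a square, while
    \<open>q1 < 0\<close>.\<close>
  have zero: "l0 = 0 \<and> l1 = 0" if eq: "\<alpha> = \<beta>"
  proof -
    define p0 p1 p2 where "p0 = t * k1 + k2" "p1 = 2 * (t * m1 + m2)" "p2 = t * n1 + n2"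
    note p = this
    have pq: "q1 1 x * t + q2 1 x = p0 + p1 * x + p2 * x^2" for x
      unfolding p binform_def by (simp add: power2_eq_square algebra_simps)
    have f: "q1 1 x * q3 1 x - (q2 1 x)^2 = c * (x - a) ^ 4" for x
    proof -
      have "cmod (of_real x - of_real a) = \<bar>x - a\<bar>" by (metis norm_of_real of_real_diff)
      then have "q1 1 x * q3 1 x - (q2 1 x)^2 = c * \<bar>x - a\<bar>^2 * \<bar>x - a\<bar>^2"
        using fact[of 1 x] eq by (simp add: a)
      then show ?thesis by (simp add: power2_eq_square power4_eq_xxxx)
    qed
    have main: "q1 1 x * (l0 + l1 * x)^2 = (p0 + p1 * x + p2 * x^2)^2 + c * (x - a) ^ 4" for x
      using complete_square[of "q1 1 x" t "q2 1 x" "q3 1 x"] f[of x] square_at_qt[OF t(1), of 1 x]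
      unfolding pq[symmetric] qt by simp
    have "(p0 + p1 * a + p2 * a^2)^2 = 0" using main[of a] la by simp
    then have p0: "p0 = - p1 * a - p2 * a^2" by simp
    have l0: "l0 = - l1 * a" using la by simp
    define D where "D x = q1 1 x * l1^2 - (p1 + p2 * (x + a))^2 - c * (x - a)^2" for x
    have "(x - a)^2 * D x = 0" for x
    proof -
      have E1: "p0 + p1 * x + p2 * x^2 = (x - a) * (p1 + p2 * (x + a))"
        unfolding p0 by (simp add: power2_eq_square algebra_simps)
      have E2: "l0 + l1 * x = (x - a) * l1" unfolding l0 by (simp add: algebra_simps)
      show ?thesis using main[of x] unfolding E1 E2 D_def by algebra
    qed
    then have D0: "D (a+1) = 0" "D (a-1) = 0" "D (a+2) = 0" "D (a-2) = 0"
      by (metis add_diff_cancel_left' diff_diff_eq2 mult_eq_0_iff power_eq_0_iff one_neq_zero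
          zero_neq_numeral diff_add_cancel add.right_neutral diff_0_right eq_iff_diff_eq_0 neg_equal_0_iff_equal minus_diff_eq)+
    \<comment> \<open>\<open>D\<close> is a polynomial of degree at most two, so its fourth
      difference vanishes and its value at \<open>a\<close> follows from four values where
      \<open>x - a\<close> could be cancelled.\<close>
    have "6 * D a = 4 * (D (a+1) + D (a-1)) - (D (a+2) + D (a-2))"
      unfolding D_def binform_def by (simp add: power2_eq_square algebra_simps)
    then have "q1 1 a * l1^2 = (p1 + p2 * (2 * a))^2" unfolding D0 by (simp add: D_def)
    then have "q1 1 a * l1^2 \<ge> 0" by simp
    then have "l1 = 0" using neg[of 1 a] by (simp add: zero_le_mult_iff)
    then show ?thesis using l0 by simp
  qed
  have "(of_real t * r + s)^2 = (of_real (l0 + l1 * a))^2"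
    using square_at_complex[OF t(1) at_\<alpha>] by (simp add: a)
  then have r0: "of_real t * r + s = 0" unfolding la by simp
  have la': "complex_of_real l0 + of_real l1 * \<alpha> = 0" using la a by (metis of_real_0 of_real_add of_real_mult)
  moreover have "complex_of_real (-l0) + of_real (-l1) * \<alpha> = - (of_real l0 + of_real l1 * \<alpha>)"
    "complex_of_real (-l0) + of_real (-l1) * \<beta> = - (of_real l0 + of_real l1 * \<beta>)" by simp_all
  ultimately have "matches t l0 l1 \<or> matches t (-l0) (-l1)"
    unfolding matches_def using r0 sqrt_cases(2)[OF t(1)] by (metis neg_0_equal_iff_equal)
  then show ?thesis using that[of t l0 l1] that[of t "-l0" "-l1"] t(1) square_at_uminus[OF t(1)] zero by auto
qed

text \<open>If both end squares L (at t) and J (at u) had mismatched signs, the polar form of the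
  two ends minus L J would vanish at \<alpha> and \<beta>. For four distinct roots of the quartic it
  would then be zero; the argument also covers coinciding roots.\<close>

lemma match_nonreal:
  assumes "\<alpha> \<notin> \<real>" "\<beta> \<notin> \<real>"
  obtains t l0 l1 where "square_at t l0 l1" "matches t l0 l1" 
    "\<alpha> = \<beta> \<and> r = r' \<and> s = s' \<longrightarrow> l0 \<noteq> 0 \<or> l1 \<noteq> 0"
proof -
  note result = that
  have pos: "cmod (of_real b - z * of_real a) > 0" if "z \<notin> \<real>" "a \<noteq> 0 \<or> b \<noteq> 0" for z a b
  proof (rule ccontr)
    assume "\<not> ?thesis"
    then have "of_real b + of_real (-a) * z = 0" by (simp add: mult.commute)
    then show False using nonreal_linear_form[OF that(1), of b "-a"] that(2) by simp
  qed
  have strict: "q1 a b * q3 a b - (q2 a b)^2 < 0" if "a \<noteq> 0 \<or> b \<noteq> 0" for a b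
    unfolding fact using c pos[OF assms(1) that] pos[OF assms(2) that]
    by (intro mult_neg_pos) auto
  obtain t l0 l1 where t: "square_at t l0 l1" "\<exists>a b. (a \<noteq> 0 \<or> b \<noteq> 0) \<and> t = lo a b"
    by (rule lower_square_at)
  obtain u j0 j1 where u: "square_at u j0 j1" "\<exists>a b. (a \<noteq> 0 \<or> b \<noteq> 0) \<and> u = hi a b"
    by (rule upper_square_at)
  have tu: "t < u" using t(2) u(2) lo_less_hi[OF _ _ strict] by blast
  show ?thesis
  proof (cases "\<alpha> = \<beta> \<and> r = r' \<and> s = s'")
    case True
    \<comment> \<open>If both squares were zero, \<open>t r + s = u r + s = 0\<close> with
      \<open>t < u\<close> would give r = s = 0.\<close>
    have "l0 \<noteq> 0 \<or> l1 \<noteq> 0 \<or> j0 \<noteq> 0 \<or> j1 \<noteq> 0"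
    proof (rule ccontr)
      assume "\<not> ?thesis"
      then have "of_real t * r + s = 0" "of_real u * r + s = 0"
        using sqrt_cases(1)[OF t(1)] sqrt_cases(1)[OF u(1)] by auto
      moreover have "of_real (u - t) * r = (of_real u * r + s) - (of_real t * r + s)"
        by (simp add: algebra_simps)
      ultimately have "of_real (u - t) * r = 0" "s = - (of_real t * r)"
        by (simp_all add: eq_neg_iff_add_eq_0 add.commute)
      then show False using tu nz by auto
    qed
    moreover have ?thesis if v: "square_at v i0 i1" "i0 \<noteq> 0 \<or> i1 \<noteq> 0" for v i0 i1
    proof (rule match_or_mismatch[OF v(1)])
      fix i0' i1' assume "square_at v i0' i1'" "matches v i0' i1'" "i0' = i0 \<and> i1' = i1 \<or> i0' = - i0 \<and> i1' = - i1"
      then show ?thesis using result[of v i0' i1'] v(2) by auto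
    next
      fix i0' i1' assume i: "i0' \<noteq> 0 \<or> i1' \<noteq> 0"
        "of_real v * r + s = of_real i0' + of_real i1' * \<alpha>"
        "of_real v * r' + s' = - (of_real i0' + of_real i1' * \<beta>)"
      \<comment> \<open>Both points have the same lift, so a mismatch says that the value of the
        linear form is its own negative; but a nonzero real linear form has no nonreal zero.\<close>
      then have "of_real i0' + of_real i1' * \<alpha> = - (of_real i0' + of_real i1' * \<alpha>)" using True by metis
      moreover have "x = 0" if "x = - x" for x :: complex using that by (simp add: eq_neg_iff_add_eq_0 flip: mult_2)
      ultimately have "of_real i0' + of_real i1' * \<alpha> = 0" by blast
      then show ?thesis using nonreal_linear_form[OF assms(1)] i(1) by blast
    qed
    ultimately show ?thesis using t(1) u(1) by blast
  next
    case False
    show ?thesis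
    proof (rule match_or_mismatch[OF t(1)])
      fix l0 l1 assume "square_at t l0 l1" "matches t l0 l1"
      then show ?thesis using that False by blast
    next
      fix l0 l1 assume L: "square_at t l0 l1" "l0 \<noteq> 0 \<or> l1 \<noteq> 0"
        "of_real t * r + s = of_real l0 + of_real l1 * \<alpha>"
        "of_real t * r' + s' = - (of_real l0 + of_real l1 * \<beta>)"
      show ?thesis
      proof (rule match_or_mismatch[OF u(1)])
        fix j0 j1 assume "square_at u j0 j1" "matches u j0 j1"
        then show ?thesis using that False by blast
      next
        fix j0 j1 assume J: "square_at u j0 j1" "j0 \<noteq> 0 \<or> j1 \<noteq> 0"
          "of_real u * r + s = of_real j0 + of_real j1 * \<alpha>"
          "of_real u * r' + s' = - (of_real j0 + of_real j1 * \<beta>)"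
        \<comment> \<open>Coefficients of \<open>G\<close>, the polar form of the two ends minus the
          product of the two linear forms. At \<beta> the two minus signs cancel, so
          \<open>G\<close> vanishes there too.\<close>
        define g0 g1 g2 where "g0 = t * u * k1 + (t + u) * k2 + k3 - l0 * j0"
          "g1 = 2 * (t * u * m1 + (t + u) * m2 + m3) - (l0 * j1 + l1 * j0)"
          "g2 = t * u * n1 + (t + u) * n2 + n3 - l1 * j1"
        note g = this
        have gval: "of_real g0 + of_real g1 * z + of_real g2 * z^2 = 
            of_real t * of_real u * cbin k1 m1 n1 z
            + (of_real t + of_real u) * cbin k2 m2 n2 z
            + cbin k3 m3 n3 z
            - (of_real l0 + of_real l1 * z) * (of_real j0 + of_real j1 * z)" for z :: complex
          unfolding g binform_def by (simp add: power2_eq_square algebra_simps)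
        have ga: "of_real g0 + of_real g1 * \<alpha> + of_real g2 * \<alpha>^2 = 0"
          unfolding gval at_\<alpha> L(3)[symmetric] J(3)[symmetric]
          by (simp add: power2_eq_square algebra_simps)
        have "(of_real l0 + of_real l1 * \<beta>) * (of_real j0 + of_real j1 * \<beta>)
          = (of_real t * r' + s') * (of_real u * r' + s')" 
          unfolding L(4) J(4) by (rule minus_mult_minus[symmetric])
        then have gb: "of_real g0 + of_real g1 * \<beta> + of_real g2 * \<beta>^2 = 0"
          unfolding gval at_\<beta> by (simp add: power2_eq_square algebra_simps)
        define G where "G a b = g0 * a^2 + g1 * a * b + g2 * b^2" for a b
        have Ga: "G a b = g2 * (cmod (of_real b - \<alpha> * of_real a))^2"
          and Gb: "G a b = g2 * (cmod (of_real b - \<beta> * of_real a))^2" for a b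
          unfolding G_def using real_quadratic_nonreal_root ga gb assms by blast+
        \<comment> \<open>The two expressions of \<open>G\<close>, through \<alpha> and through
          \<beta>, multiply to a multiple of the quartic.\<close>
        have GG: "c * (G a b)^2 = g2^2 * (q1 a b * q3 a b - (q2 a b)^2)" for a b
        proof -
          have "(G a b)^2 = (g2 * (cmod (of_real b - \<alpha> * of_real a))^2) * (g2 * (cmod (of_real b - \<beta> * of_real a))^2)"
            using Ga[of a b] Gb[of a b] by (simp add: power2_eq_square)
          then show ?thesis unfolding fact by (simp add: power2_eq_square)
        qed
        \<comment> \<open>The determinant formed by the ends t, u and their polar form is
          \<open>(t - u)^2\<close> times the quartic. In terms of L, J and \<open>G\<close> it is
          \<open>(L J)^2 - (G + L J)^2\<close>.\<close>
        have key: "(t - u)^2 * (q1 a b * q3 a b - (q2 a b)^2)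
          = - G a b * (2 * ((l0 * a + l1 * b) * (j0 * a + j1 * b)) + G a b)" for a b
        proof -
          let ?P = "t * u * q1 a b + (t + u) * q2 a b + q3 a b"
          have P: "?P = G a b + (l0 * a + l1 * b) * (j0 * a + j1 * b)"
            unfolding G_def g binform_def by (simp add: power2_eq_square algebra_simps)
          have "(t - u)^2 * (q1 a b * q3 a b - (q2 a b)^2) = qt t a b * qt u a b - ?P^2"
            unfolding qt by (simp add: power2_eq_square algebra_simps)
          also have "\<dots> = (l0 * a + l1 * b)^2 * (j0 * a + j1 * b)^2 - (G a b + (l0 * a + l1 * b) * (j0 * a + j1 * b))^2"
            unfolding square_at_qt[OF L(1)] square_at_qt[OF J(1)] P ..
          finally show ?thesis by (simp add: power2_eq_square algebra_simps)
        qed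
        \<comment> \<open>This point is the zero of L. There \<open>key\<close> forces
          \<open>G\<close> to be nonzero, so \<open>g2\<close> is nonzero and \<open>G\<close> has
          no real zero. Cancelling \<open>G\<close> from \<open>key\<close> and evaluating here once
          more kills the coefficient of \<open>G\<close>, which leaves L J = 0.\<close>
        have nz': "-l1 \<noteq> 0 \<or> l0 \<noteq> 0" using L(2) by auto
        have d: "(t - u)^2 > 0" using tu by simp
        have k0: "(t - u)^2 * (q1 (-l1) l0 * q3 (-l1) l0 - (q2 (-l1) l0)^2) = - ((G (-l1) l0)^2)"
          unfolding key by (simp add: power2_eq_square)
        then have "G (-l1) l0 \<noteq> 0" using strict[OF nz'] d by (metis less_irrefl mult_eq_0_iff
              neg_equal_0_iff_equal zero_power2)
        then have g2: "g2 \<noteq> 0" by (auto simp: Ga)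
        have Gnz: "G a b \<noteq> 0" if "a \<noteq> 0 \<or> b \<noteq> 0" for a b
          using g2 pos[OF assms(1) that] by (auto simp: Ga)
        have rel: "2 * g2^2 * ((l0 * a + l1 * b) * (j0 * a + j1 * b)) = - (g2^2 + (t - u)^2 * c) * G a b"
          if "a \<noteq> 0 \<or> b \<noteq> 0" for a b
        proof -
          have "(t - u)^2 * (c * (G a b)^2) = g2^2 * (- G a b * (2 * ((l0 * a + l1 * b) * (j0 * a + j1 * b)) + G a b))"
            unfolding GG key[symmetric] by (simp add: algebra_simps)
          then have "G a b * (2 * g2^2 * ((l0 * a + l1 * b) * (j0 * a + j1 * b)) + (g2^2 + (t - u)^2 * c) * G a b) = 0"
            by (simp add: power2_eq_square algebra_simps)
          then have "2 * g2^2 * ((l0 * a + l1 * b) * (j0 * a + j1 * b)) + (g2^2 + (t - u)^2 * c) * G a b = 0"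
            using Gnz[OF that] by (simp only: mult_eq_0_iff) simp
          then show ?thesis by (simp only: mult_minus_left eq_neg_iff_add_eq_0)
        qed
        have "2 * g2^2 * ((l0 * (-l1) + l1 * l0) * (j0 * (-l1) + j1 * l0)) = 0" by simp
        with rel[OF nz'] have "(g2^2 + (t - u)^2 * c) * G (-l1) l0 = 0"
          by (simp only: mult_minus_left neg_0_equal_iff_equal neg_equal_0_iff_equal)
        then have "g2^2 + (t - u)^2 * c = 0" using Gnz[OF nz'] by (simp only: mult_eq_0_iff) simp
        then have "2 * g2^2 * ((l0 * a + l1 * b) * (j0 * a + j1 * b)) = 0" if "a \<noteq> 0 \<or> b \<noteq> 0" for a b
          using rel[OF that] by simp
        then have LJ: "(l0 * a + l1 * b) * (j0 * a + j1 * b) = 0" if "a \<noteq> 0 \<or> b \<noteq> 0" for a b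
          using g2 that by (metis mult_eq_0_iff power_eq_0_iff zero_neq_numeral)
        have "l0 * j0 = 0" "l1 * j1 = 0" "(l0 + l1) * (j0 + j1) = 0" "(l0 - l1) * (j0 - j1) = 0"
          using LJ[of 1 0] LJ[of 0 1] LJ[of 1 1] LJ[of 1 "-1"] by simp_all
        then show ?thesis using L(2) J(2) by auto
      qed
    qed
  qed
qed

end

lemma covered_pencil_swap:
  assumes "covered_pencil k1 m1 n1 k2 m2 n2 k3 m3 n3 c \<alpha> \<beta> r s r' s'" "r' \<noteq> 0 \<or> s' \<noteq> 0"
  shows "covered_pencil k1 m1 n1 k2 m2 n2 k3 m3 n3 c \<beta> \<alpha> r' s' r s"
proof -
  interpret covered_pencil k1 m1 n1 k2 m2 n2 k3 m3 n3 c \<alpha> \<beta> r s r' s' by fact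
  show ?thesis
    using at_\<alpha> at_\<beta> c assms(2) by unfold_locales (simp_all add: fact mult.commute mult.left_commute)
qed

lemma (in covered_pencil) real_plane:
  assumes "r' \<noteq> 0 \<or> s' \<noteq> 0"
  obtains t l0 l1 where "square_at t l0 l1" "matches t l0 l1"
    "\<alpha> = \<beta> \<and> r = r' \<and> s = s' \<longrightarrow> (\<alpha> \<notin> \<real> \<and> (l0 \<noteq> 0 \<or> l1 \<noteq> 0)) \<or> (\<alpha> \<in> \<real> \<and> l0 = 0 \<and> l1 = 0)"
proof -
  consider "\<alpha> \<in> \<real>" | "\<beta> \<in> \<real>" "\<alpha> \<notin> \<real>" | "\<alpha> \<notin> \<real>" "\<beta> \<notin> \<real>" by blast
  then show ?thesis
  proof cases
    case 1
    obtain t l0 l1 where "square_at t l0 l1" "matches t l0 l1" "\<alpha> = \<beta> \<longrightarrow> l0 = 0 \<and> l1 = 0"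
      using match_real[OF 1] by blast
    with 1 that[of t l0 l1] show ?thesis by blast
  next
    \<comment> \<open>Only \<beta> is real, so the points differ and the clause on equal lifts is
      vacuous.\<close>
    case 2
    interpret sw: covered_pencil k1 m1 n1 k2 m2 n2 k3 m3 n3 c \<beta> \<alpha> r' s' r s
      using covered_pencil_swap[OF covered_pencil_axioms assms] .
    obtain t l0 l1 where "sw.square_at t l0 l1" "sw.matches t l0 l1"
      using sw.match_real[OF 2(1)] by blast
    with 2 that[of t l0 l1] show ?thesis
      by (auto simp: sw.square_at_def square_at_def sw.matches_def matches_def)
  next
    case 3
    obtain t l0 l1 where "square_at t l0 l1" "matches t l0 l1" 
      "\<alpha> = \<beta> \<and> r = r' \<and> s = s' \<longrightarrow> l0 \<noteq> 0 \<or> l1 \<noteq> 0"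
      using match_nonreal[OF 3] by blast
    with 3 that[of t l0 l1] show ?thesis by blast
  qed
qed

text \<open>A rotation of the parameter circle, up to scale, moves the negative definite member to
  infinity, where the results on pencils apply; the parameter found there is rotated back.\<close>

lemma real_plane_through_conjugate_lifts:
  fixes k1 m1 n1 k2 m2 n2 k3 m3 n3 c \<nu>0 \<nu>1 :: real and \<alpha> \<beta> r s r' s' :: complex
  assumes neg: "\<And>a b. a \<noteq> 0 \<or> b \<noteq> 0 \<Longrightarrow> \<nu>0^2 * binform k1 m1 n1 a b + 2 * \<nu>0 * \<nu>1 * binform k2 m2 n2 a b
      + \<nu>1^2 * binform k3 m3 n3 a b < 0"
    and fact: "\<And>a b. binform k1 m1 n1 a b * binform k3 m3 n3 a b - (binform k2 m2 n2 a b)^2 =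
      c * (cmod (of_real b - \<alpha> * of_real a))^2 * (cmod (of_real b - \<beta> * of_real a))^2"
    and c: "c < 0"
    and at_\<alpha>: "cbin k1 m1 n1 \<alpha> = r^2"
      "cbin k2 m2 n2 \<alpha> = r * s"
      "cbin k3 m3 n3 \<alpha> = s^2"
    and at_\<beta>: "cbin k1 m1 n1 \<beta> = r'^2"
      "cbin k2 m2 n2 \<beta> = r' * s'"
      "cbin k3 m3 n3 \<beta> = s'^2"
    and nontriv: "r \<noteq> 0 \<or> s \<noteq> 0" "r' \<noteq> 0 \<or> s' \<noteq> 0"
  obtains t0 t1 l0 l1 :: real where "t0 \<noteq> 0 \<or> t1 \<noteq> 0"
    "t0^2 * k1 + 2 * t0 * t1 * k2 + t1^2 * k3 = l0^2"
    "t0^2 * m1 + 2 * t0 * t1 * m2 + t1^2 * m3 = l0 * l1"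
    "t0^2 * n1 + 2 * t0 * t1 * n2 + t1^2 * n3 = l1^2"
    "of_real t0 * r + of_real t1 * s = of_real l0 + of_real l1 * \<alpha>"
    "of_real t0 * r' + of_real t1 * s' = of_real l0 + of_real l1 * \<beta>"
    "\<alpha> = \<beta> \<and> r = r' \<and> s = s' \<longrightarrow> (\<alpha> \<notin> \<real> \<and> (l0 \<noteq> 0 \<or> l1 \<noteq> 0)) \<or> (\<alpha> \<in> \<real> \<and> l0 = 0 \<and> l1 = 0)"
proof -
  \<comment> \<open>The net after replacing \<open>r\<close> by \<open>\<nu>0 r + \<nu>1 s\<close>
    and \<open>s\<close> by \<open>- \<nu>1 r + \<nu>0 s\<close>, so that the definite member
    becomes the first form. The quartic is multiplied by \<open>N^2\<close>.\<close>
  define f1 where "f1 a b c = \<nu>0^2 * a + 2 * \<nu>0 * \<nu>1 * b + \<nu>1^2 * c" for a b c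
  define f2 where "f2 a b c = - \<nu>0 * \<nu>1 * a + (\<nu>0^2 - \<nu>1^2) * b + \<nu>0 * \<nu>1 * c" for a b c
  define f3 where "f3 a b c = \<nu>1^2 * a - 2 * \<nu>0 * \<nu>1 * b + \<nu>0^2 * c" for a b c
  note f = f1_def f2_def f3_def
  define N where "N = \<nu>0^2 + \<nu>1^2"
  have nn: "\<nu>0 \<noteq> 0 \<or> \<nu>1 \<noteq> 0" using neg[of 1 0] by auto
  then have N: "N > 0" by (simp add: N_def sum_power2_gt_zero_iff)
  let ?rt = "\<lambda>r s. of_real \<nu>0 * r + of_real \<nu>1 * s" and ?st = "\<lambda>r s. - of_real \<nu>1 * r + of_real \<nu>0 * s"
  have F1: "binform (f1 k1 k2 k3) (f1 m1 m2 m3) (f1 n1 n2 n3) a b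
      = \<nu>0^2 * binform k1 m1 n1 a b + 2 * \<nu>0 * \<nu>1 * binform k2 m2 n2 a b + \<nu>1^2 * binform k3 m3 n3 a b"
    and F2: "binform (f2 k1 k2 k3) (f2 m1 m2 m3) (f2 n1 n2 n3) a b
      = f2 (binform k1 m1 n1 a b) (binform k2 m2 n2 a b) (binform k3 m3 n3 a b)"
    and F3: "binform (f3 k1 k2 k3) (f3 m1 m2 m3) (f3 n1 n2 n3) a b
      = f3 (binform k1 m1 n1 a b) (binform k2 m2 n2 a b) (binform k3 m3 n3 a b)" for a b
    unfolding f binform_def by (simp_all add: algebra_simps)
  have disc: "f1 x y z * f3 x y z - (f2 x y z)^2 = N^2 * (x * z - y^2)" for x y z
    unfolding f N_def by (simp add: power2_eq_square algebra_simps)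
  have cx: "cbin (f1 k1 k2 k3) (f1 m1 m2 m3) (f1 n1 n2 n3) w = (?rt x y)^2"
      "cbin (f2 k1 k2 k3) (f2 m1 m2 m3) (f2 n1 n2 n3) w = ?rt x y * ?st x y"
      "cbin (f3 k1 k2 k3) (f3 m1 m2 m3) (f3 n1 n2 n3) w = (?st x y)^2"
    if "cbin k1 m1 n1 w = x^2"
      "cbin k2 m2 n2 w = x * y"
      "cbin k3 m3 n3 w = y^2" for w x y :: complex
  proof -
    let ?b1 = "cbin k1 m1 n1 w"
      and ?b2 = "cbin k2 m2 n2 w"
      and ?b3 = "cbin k3 m3 n3 w"
    have "cbin (f1 k1 k2 k3) (f1 m1 m2 m3) (f1 n1 n2 n3) w =
        (of_real \<nu>0)^2 * ?b1 + 2 * of_real \<nu>0 * of_real \<nu>1 * ?b2 + (of_real \<nu>1)^2 * ?b3"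
      "cbin (f2 k1 k2 k3) (f2 m1 m2 m3) (f2 n1 n2 n3) w =
        - of_real \<nu>0 * of_real \<nu>1 * ?b1 + ((of_real \<nu>0)^2 - (of_real \<nu>1)^2) * ?b2 + of_real \<nu>0 * of_real \<nu>1 * ?b3"
      "cbin (f3 k1 k2 k3) (f3 m1 m2 m3) (f3 n1 n2 n3) w =
        (of_real \<nu>1)^2 * ?b1 - 2 * of_real \<nu>0 * of_real \<nu>1 * ?b2 + (of_real \<nu>0)^2 * ?b3"
      unfolding f binform_def by (simp_all add: algebra_simps)
    then show "cbin (f1 k1 k2 k3) (f1 m1 m2 m3) (f1 n1 n2 n3) w = (?rt x y)^2"
      "cbin (f2 k1 k2 k3) (f2 m1 m2 m3) (f2 n1 n2 n3) w = ?rt x y * ?st x y"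
      "cbin (f3 k1 k2 k3) (f3 m1 m2 m3) (f3 n1 n2 n3) w = (?st x y)^2"
      unfolding that by (simp_all add: power2_eq_square algebra_simps)
  qed
  have rot: "of_real \<nu>0 * ?rt x y - of_real \<nu>1 * ?st x y = of_real N * x"
    "of_real \<nu>1 * ?rt x y + of_real \<nu>0 * ?st x y = of_real N * y" for x y :: complex
    unfolding N_def by (simp_all add: power2_eq_square algebra_simps)
  have nz': "?rt x y \<noteq> 0 \<or> ?st x y \<noteq> 0" if "x \<noteq> 0 \<or> y \<noteq> 0" for x y :: complex
    using rot[of x y] that N by auto
  interpret covered_pencil "f1 k1 k2 k3" "f1 m1 m2 m3" "f1 n1 n2 n3" "f2 k1 k2 k3" "f2 m1 m2 m3" "f2 n1 n2 n3"
    "f3 k1 k2 k3" "f3 m1 m2 m3" "f3 n1 n2 n3" "N^2 * c" \<alpha> \<beta> "?rt r s" "?st r s" "?rt r' s'" "?st r' s'"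
  proof unfold_locales
    show "binform (f1 k1 k2 k3) (f1 m1 m2 m3) (f1 n1 n2 n3) a b < 0" if "a \<noteq> 0 \<or> b \<noteq> 0" for a b
      unfolding F1 using neg[OF that] .
    show eq: "binform (f1 k1 k2 k3) (f1 m1 m2 m3) (f1 n1 n2 n3) a b * binform (f3 k1 k2 k3) (f3 m1 m2 m3) (f3 n1 n2 n3) a b
      - (binform (f2 k1 k2 k3) (f2 m1 m2 m3) (f2 n1 n2 n3) a b)^2
      = N^2 * c * (cmod (of_real b - \<alpha> * of_real a))^2 * (cmod (of_real b - \<beta> * of_real a))^2" for a b
      unfolding F1 F2 F3 f1_def[symmetric] disc fact by (simp add: mult.assoc)
    show nc: "N^2 * c < 0" using N c by (simp add: mult_pos_neg)
    show "binform (f1 k1 k2 k3) (f1 m1 m2 m3) (f1 n1 n2 n3) a b * binform (f3 k1 k2 k3) (f3 m1 m2 m3) (f3 n1 n2 n3) a b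
      - (binform (f2 k1 k2 k3) (f2 m1 m2 m3) (f2 n1 n2 n3) a b)^2 \<le> 0" for a b
      unfolding eq by (rule mult_nonpos_nonneg[OF mult_nonpos_nonneg[OF less_imp_le[OF nc]]]) (rule zero_le_power2)+
  qed (rule cx[OF at_\<alpha>] cx[OF at_\<beta>] nz'[OF nontriv(1)])+
  obtain t l0 l1 where t: "square_at t l0 l1" "matches t l0 l1"
    "\<alpha> = \<beta> \<and> ?rt r s = ?rt r' s' \<and> ?st r s = ?st r' s' \<longrightarrow> (\<alpha> \<notin> \<real> \<and> (l0 \<noteq> 0 \<or> l1 \<noteq> 0)) \<or> (\<alpha> \<in> \<real> \<and> l0 = 0 \<and> l1 = 0)"
    using real_plane[OF nz'[OF nontriv(2)]] by blast
  \<comment> \<open>Coefficients of \<open>r\<close> and \<open>s\<close> in \<open>t\<close> times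
    the new \<open>r\<close> plus the new \<open>s\<close>.\<close>
  let ?t0 = "t * \<nu>0 - \<nu>1" and ?t1 = "t * \<nu>1 + \<nu>0"
  have sq: "?t0^2 * x + 2 * ?t0 * ?t1 * y + ?t1^2 * z = t^2 * f1 x y z + 2 * t * f2 x y z + f3 x y z" for x y z
    unfolding f by (simp add: power2_eq_square algebra_simps)
  show ?thesis
  proof (rule that[of ?t0 ?t1 l0 l1])
    have "?t0^2 + ?t1^2 = (t^2 + 1) * N" unfolding N_def by (simp add: power2_eq_square algebra_simps)
    also have "\<dots> > 0" using N by (intro mult_pos_pos) (auto simp: add_nonneg_pos)
    finally show "?t0 \<noteq> 0 \<or> ?t1 \<noteq> 0" by auto
    show "?t0^2 * k1 + 2 * ?t0 * ?t1 * k2 + ?t1^2 * k3 = l0^2"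
    "?t0^2 * m1 + 2 * ?t0 * ?t1 * m2 + ?t1^2 * m3 = l0 * l1"
    "?t0^2 * n1 + 2 * ?t0 * ?t1 * n2 + ?t1^2 * n3 = l1^2"
      unfolding sq using t(1) by (simp_all add: square_at_def)
    have "of_real ?t0 * x + of_real ?t1 * y = of_real t * ?rt x y + ?st x y" for x y :: complex
      by (simp add: algebra_simps)
    then show "of_real ?t0 * r + of_real ?t1 * s = of_real l0 + of_real l1 * \<alpha>"
      "of_real ?t0 * r' + of_real ?t1 * s' = of_real l0 + of_real l1 * \<beta>"
      using t(2) by (simp_all only: matches_def)
  qed (use t(3) in blast)
qed

section \<open>Ternary quadratic forms and the plane quartic\<close>

definition polar :: "'a::comm_ring_1^3^3 \<Rightarrow> 'a^3 \<Rightarrow> 'a^3 \<Rightarrow> 'a" where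
  "polar M x y = (\<Sum>i\<in>UNIV. \<Sum>j\<in>UNIV. M$i$j * x$i * y$j)"

lemma qform_polar: "qform M x = polar M x x"
  by (simp add: qform_def polar_def)

lemma polar_commute:
  assumes "transpose M = M"
  shows "polar M x y = polar M y x"
proof -
  have "M$i$j = M$j$i" for i j
    using arg_cong[OF assms, of "\<lambda>A. A$j$i"] by (simp add: transpose_def)
  then show ?thesis
    unfolding polar_def by (subst sum.swap) (simp add: mult.commute mult.left_commute)
qed

lemma polar_linear:
  "polar M (x + x') y = polar M x y + polar M x' y" "polar M x (y + y') = polar M x y + polar M x y'"
  "polar M (c *s x) y = c * polar M x y" "polar M x (c *s y) = c * polar M x y"
  by (simp_all add: polar_def sum.distrib sum_distrib_left algebra_simps)

lemma qform_scale: "qform M (c *s x) = c^2 * qform M x"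
  by (simp add: qform_polar polar_linear power2_eq_square)

lemma qform_add:
  assumes "transpose M = M"
  shows "qform M (x + y) = qform M x + 2 * polar M x y + qform M y"
  using polar_commute[OF assms, of y x] by (simp add: qform_polar polar_linear)

lemma qform_lincomb:
  assumes "transpose M = M"
  shows "qform M (a *s x + b *s y) = binform (qform M x) (polar M x y) (qform M y) a b"
  unfolding qform_add[OF assms] qform_scale binform_def polar_linear by (simp add: algebra_simps)

text \<open>The same formulas are used over the reals, the complex numbers, polynomials and power
  series. Every change of coefficients is an instance, so each transfer lemma is proved
  once.\<close>

locale ring_hom_pair =
  fixes h :: "'a::comm_ring_1 \<Rightarrow> 'b::comm_ring_1"
  assumes hom_add: "h (x + y) = h x + h y" and hom_mult: "h (x * y) = h x * h y"
    and hom_one: "h 1 = 1"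
begin

lemma hom_zero: "h 0 = 0"
  using hom_add[of 0 0] by simp

lemma hom_sum: "h (sum f A) = (\<Sum>x\<in>A. h (f x))"
  by (induction A rule: infinite_finite_induct) (simp_all add: hom_zero hom_add)

lemma hom_polar: "polar (map_matrix h M) (\<chi> i. h (x$i)) (\<chi> i. h (y$i)) = h (polar M x y)"
  by (simp add: polar_def map_matrix_def hom_sum hom_mult)

lemma hom_qform: "qform (map_matrix h M) (\<chi> i. h (x$i)) = h (qform M x)"
  by (simp add: qform_polar hom_polar)

lemma hom_transpose: "transpose M = M \<Longrightarrow> transpose (map_matrix h M) = map_matrix h M"
  by (simp add: transpose_def map_matrix_def vec_eq_iff)

end

interpretation cpx: ring_hom_pair complex_of_real
  by unfold_locales simp_all

interpretation fps: ring_hom_pair "\<lambda>c. fps_const (complex_of_real c)"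
  by unfold_locales (simp_all add: fps_const_1_eq_1)

interpretation cpoly: ring_hom_pair "\<lambda>c. [:complex_of_real c:]"
  by unfold_locales (simp_all add: one_pCons)

text \<open>Half of the derivative of the quartic at \<open>x\<close> in direction \<open>v\<close>.\<close>

definition dquartic :: "'a::comm_ring_1^3^3 \<Rightarrow> 'a^3^3 \<Rightarrow> 'a^3^3 \<Rightarrow> 'a^3 \<Rightarrow> 'a^3 \<Rightarrow> 'a" where
  "dquartic M1 M2 M3 x v = polar M1 x v * qform M3 x + qform M1 x * polar M3 x v
    - 2 * qform M2 x * polar M2 x v"

lemma dquartic_linear:
  "dquartic M1 M2 M3 x (v + w) = dquartic M1 M2 M3 x v + dquartic M1 M2 M3 x w"
  "dquartic M1 M2 M3 x (c *s v) = c * dquartic M1 M2 M3 x v"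
  by (simp_all add: dquartic_def polar_linear algebra_simps)

lemma dquartic_self: "dquartic M1 M2 M3 x x = 2 * quartic M1 M2 M3 x"
  by (simp add: dquartic_def quartic_def qform_polar power2_eq_square)

lemma quartic_scale: "quartic M1 M2 M3 (c *s x) = c ^ 4 * quartic M1 M2 M3 x"
  by (simp add: quartic_def qform_scale algebra_simps power2_eq_square power4_eq_xxxx)

lemma (in ring_hom_pair) hom_dquartic:
  "dquartic (map_matrix h M1) (map_matrix h M2) (map_matrix h M3) (\<chi> i. h (x$i)) (\<chi> i. h (v$i))
    = h (dquartic M1 M2 M3 x v)"
proof -
  have "h (a - b) = h a - h b" for a b using hom_add[of "a - b" b] by simp
  moreover have "h 2 = 2" using hom_add[of 1 1] hom_one by simp
  ultimately show ?thesis by (simp add: dquartic_def hom_polar hom_qform hom_add hom_mult)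
qed

lemma (in ring_hom_pair) hom_quartic:
  "quartic (map_matrix h M1) (map_matrix h M2) (map_matrix h M3) (\<chi> i. h (x$i)) = h (quartic M1 M2 M3 x)"
proof -
  have "h (a - b) = h a - h b" for a b using hom_add[of "a - b" b] by simp
  then show ?thesis by (simp add: quartic_def hom_qform hom_mult power2_eq_square)
qed

text \<open>Nested in this way the cofactor of \<open>c\<close>, and its value at \<open>c = 0\<close>, can be read off.\<close>

lemma quartic_add:
  assumes "transpose M1 = M1" "transpose M2 = M2" "transpose M3 = M3"
  shows "quartic M1 M2 M3 (x + c *s v) = quartic M1 M2 M3 x + c * (2 * dquartic M1 M2 M3 x v
    + c * (qform M1 x * qform M3 v + qform M1 v * qform M3 x + 4 * polar M1 x v * polar M3 x v
          - 4 * (polar M2 x v)^2 - 2 * qform M2 x * qform M2 v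
      + c * (2 * polar M1 x v * qform M3 v + 2 * polar M3 x v * qform M1 v - 4 * polar M2 x v * qform M2 v
        + c * quartic M1 M2 M3 v)))"
  unfolding quartic_def dquartic_def qform_add[OF assms(1)] qform_add[OF assms(2)] qform_add[OF assms(3)]
    qform_scale polar_linear by (simp add: algebra_simps power2_eq_square)

lemma has_field_derivative_quartic:
  fixes x v :: "'a::real_normed_field^3"
  assumes "transpose M1 = M1" "transpose M2 = M2" "transpose M3 = M3"
  shows "((\<lambda>h. quartic M1 M2 M3 (x + h *s v)) has_field_derivative 2 * dquartic M1 M2 M3 x v) (at 0)"
  unfolding quartic_add[OF assms] by (rule derivative_eq_intros refl | simp)+

lemma map_matrix_axis: "(\<chi> i. complex_of_real ((axis k 1 :: real^3)$i)) = axis k 1"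
  by (simp add: axis_def vec_eq_iff)

lemma smooth_gradient:
  assumes sym: "transpose M1 = M1" "transpose M2 = M2" "transpose M3 = M3"
    and "smooth_plane_quartic M1 M2 M3" "x \<noteq> 0" "quartic (cmat M1) (cmat M2) (cmat M3) x = 0"
  obtains i where "dquartic (cmat M1) (cmat M2) (cmat M3) x (axis i 1) \<noteq> 0"
proof -
  obtain i where "deriv (\<lambda>h. quartic (cmat M1) (cmat M2) (cmat M3) (x + h *s axis i 1)) 0 \<noteq> 0"
    using assms(4-6) unfolding smooth_plane_quartic_def Let_def by blast
  moreover have "deriv (\<lambda>h. quartic (cmat M1) (cmat M2) (cmat M3) (x + h *s axis i 1)) 0 =
      2 * dquartic (cmat M1) (cmat M2) (cmat M3) x (axis i 1)"
    using sym by (intro DERIV_imp_deriv has_field_derivative_quartic cpx.hom_transpose)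
  ultimately show ?thesis using that by auto
qed

lemma smooth_gradient_real:
  assumes sym: "transpose M1 = M1" "transpose M2 = M2" "transpose M3 = M3"
    and "smooth_plane_quartic M1 M2 M3" "x \<noteq> 0" "quartic M1 M2 M3 x = 0"
  obtains v where "dquartic M1 M2 M3 x v \<noteq> 0"
proof -
  have "cvec x \<noteq> 0" using assms(5) by (simp add: vec_eq_iff)
  moreover have "quartic (cmat M1) (cmat M2) (cmat M3) (cvec x) = 0"
    using cpx.hom_quartic[of M1 M2 M3 x] assms(6) by simp
  ultimately obtain i where "dquartic (cmat M1) (cmat M2) (cmat M3) (cvec x) (axis i 1) \<noteq> 0"
    using smooth_gradient[OF assms(1-4)] by blast
  then show ?thesis
    using cpx.hom_dquartic[of M1 M2 M3 x "axis i 1"] that unfolding map_matrix_axis by auto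
qed

text \<open>Some directional derivative is nonzero. This later excludes equal signs of the quartic
  on the two sides of an oval.\<close>

lemma smooth_sign_change:
  assumes sym: "transpose M1 = M1" "transpose M2 = M2" "transpose M3 = M3"
    and "smooth_plane_quartic M1 M2 M3" "x \<noteq> 0" "quartic M1 M2 M3 x = 0"
    and U: "open U" "x \<in> U"
  shows "\<exists>y\<in>U. quartic M1 M2 M3 y > 0" "\<exists>y\<in>U. quartic M1 M2 M3 y < 0"
proof -
  obtain v0 where v0: "dquartic M1 M2 M3 x v0 \<noteq> 0" using smooth_gradient_real[OF assms(1-6)] .
  define v where "v = sgn (dquartic M1 M2 M3 x v0) *s v0"
  have v: "dquartic M1 M2 M3 x v > 0"
    using v0 by (simp add: v_def dquartic_linear sgn_if)
  have der: "((\<lambda>h. quartic M1 M2 M3 (x + h *s v)) has_field_derivative 2 * dquartic M1 M2 M3 x v) (at 0)"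
    by (rule has_field_derivative_quartic[OF sym])
  have "continuous_on UNIV (\<lambda>h. x + h *s v)"
    unfolding scalar_mult_eq_scaleR by (intro continuous_intros)
  then have "open ((\<lambda>h. x + h *s v) -` U)"
    using U(1) by (metis continuous_on_open_vimage open_UNIV inf_top_right)
  moreover have "0 \<in> (\<lambda>h. x + h *s v) -` U" using U(2) by simp
  ultimately have "\<exists>e>0. \<forall>h. dist h 0 < e \<longrightarrow> h \<in> (\<lambda>h. x + h *s v) -` U"
    unfolding open_dist by blast
  then obtain e where e: "e > 0" "\<And>h. \<bar>h\<bar> < e \<Longrightarrow> x + h *s v \<in> U"
    by auto
  obtain d where d: "d > 0" "\<And>h. 0 < h \<Longrightarrow> h < d \<Longrightarrow> quartic M1 M2 M3 (x + h *s v) > 0"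
    using DERIV_pos_inc_right[OF der] v assms(6) by auto
  obtain d' where d': "d' > 0" "\<And>h. 0 < h \<Longrightarrow> h < d' \<Longrightarrow> quartic M1 M2 M3 (x - h *s v) < 0"
    using DERIV_pos_inc_left[OF der] v assms(6) by auto
  define h where "h = min e (min d d') / 2"
  have h: "0 < h" "h < e" "h < d" "h < d'" using e(1) d(1) d'(1) by (auto simp: h_def)
  show "\<exists>y\<in>U. quartic M1 M2 M3 y > 0" using d(2)[OF h(1,3)] e(2)[of h] h by (intro bexI[of _ "x + h *s v"]) auto
  show "\<exists>y\<in>U. quartic M1 M2 M3 y < 0" using d'(2)[OF h(1,4)] e(2)[of "-h"] h by (intro bexI[of _ "x - h *s v"]) auto
qed

text \<open>Half a great circle leads from \<open>x\<close> to \<open>-x\<close>, where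
  \<open>g\<close> takes opposite values.\<close>

lemma odd_function_zero:
  fixes g :: "real^3 \<Rightarrow> real"
  assumes cont: "continuous_on (sphere 0 1) g" and odd: "\<And>w. norm w = 1 \<Longrightarrow> g (- w) = - g w"
    and x: "norm x = 1" and y: "norm y = 1" and orth: "x \<bullet> y = 0"
  obtains a b where "a^2 + b^2 = 1" "g (a *s x + b *s y) = 0"
proof -
  let ?w = "\<lambda>t. cos t *s x + sin t *s y"
  have nw: "norm (a *s x + b *s y) = 1" if "a^2 + b^2 = 1" for a b
  proof -
    have "(norm (a *s x + b *s y))^2 = a^2 * (norm x)^2 + b^2 * (norm y)^2"
      using orth unfolding power2_norm_eq_inner scalar_mult_eq_scaleR
      by (simp add: inner_add inner_commute power2_eq_square)
    then have "(norm (a *s x + b *s y))^2 = 1" using that x y by simp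
    then show ?thesis by (simp add: power2_eq_1_iff) (metis norm_ge_zero not_one_le_zero neg_0_le_iff_le)
  qed
  have w: "norm (?w t) = 1" for t by (rule nw) (simp add: sin_cos_squared_add2)
  have contw: "continuous_on {0..pi} (\<lambda>t. g (?w t))"
  proof (rule continuous_on_compose2[OF cont])
    show "continuous_on {0..pi} ?w" unfolding scalar_mult_eq_scaleR by (intro continuous_intros)
    show "?w ` {0..pi} \<subseteq> sphere 0 1" using w by auto
  qed
  have ends: "?w 0 = x" "?w pi = - x" by (simp_all add: vec_eq_iff)
  have "\<exists>t. 0 \<le> t \<and> t \<le> pi \<and> g (?w t) = 0"
  proof (cases "g x \<ge> 0")
    case True
    then show ?thesis using IVT2'[of "\<lambda>t. g (?w t)" pi 0 0] contw odd[OF x] ends by simp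
  next
    case False
    then show ?thesis using IVT'[of "\<lambda>t. g (?w t)" 0 0 pi] contw odd[OF x] ends by simp
  qed
  then obtain t where "g (?w t) = 0" by blast
  then show ?thesis using that[of "cos t" "sin t"] by (simp add: sin_cos_squared_add2)
qed

text \<open>\<open>z\<close> is the unit normal of a line and \<open>x\<close>, \<open>y\<close>
  span it. Coordinates in this frame serve over every coefficient ring.\<close>

locale frame =
  fixes x y z :: "real^3"
  assumes unit: "norm x = 1" "norm y = 1" "norm z = 1"
    and orth: "x \<bullet> y = 0" "x \<bullet> z = 0" "y \<bullet> z = 0"
begin

text \<open>A square matrix with orthonormal rows has orthonormal columns. Stated entrywise, the
  relation passes through ring homomorphisms.\<close>

lemma complete: "x$i * x$j + y$i * y$j + z$i * z$j = (if i = j then 1 else 0)"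
proof -
  let ?A = "vector [x, y, z] :: real^3^3"
  have row: "row 1 ?A = x" "row 2 ?A = y" "row 3 ?A = z" by (simp_all add: row_def vec_eq_iff)
  have "orthogonal_matrix ?A"
    unfolding orthogonal_matrix_orthonormal_rows using unit orth
    by (simp add: forall_3 row orthogonal_def inner_commute)
  then have "(transpose ?A ** ?A)$i$j = (mat 1 :: real^3^3)$i$j" by (simp add: orthogonal_matrix_def)
  then show ?thesis by (simp add: matrix_matrix_mult_def transpose_def mat_def sum_3)
qed

end

lemma frame_exists:
  assumes "norm y = 1" "norm z = 1" "y \<bullet> z = 0"
  obtains x where "frame x y z"
proof
  show "frame (cross3 y z) y z"
  proof unfold_locales
    have "(norm (cross3 y z))^2 = 1" using norm_cross[of y z] assms by simp
    then show "norm (cross3 y z) = 1" by (simp add: power2_eq_1_iff) (metis norm_ge_zero not_one_le_zero neg_0_le_iff_le)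
  qed (use assms in \<open>simp_all add: dot_cross_self inner_commute\<close>)
qed

context ring_hom_pair
begin

definition coord :: "'a^3 \<Rightarrow> 'b^3 \<Rightarrow> 'b" where
  "coord x v = (\<Sum>j\<in>UNIV. h (x$j) * v$j)"

abbreviation lift :: "'a^3 \<Rightarrow> 'b^3" where
  "lift x \<equiv> \<chi> i. h (x$i)"

lemma coord_linear: "coord x (v + w) = coord x v + coord x w" "coord x (c *s v) = c * coord x v"
  by (simp_all add: coord_def sum.distrib sum_distrib_left algebra_simps)

lemma coord_lift: "coord x (lift y) = h (\<Sum>j\<in>UNIV. x$j * y$j)"
  by (simp add: coord_def hom_sum hom_mult)

lemma coord_expand:
  assumes "\<And>i j. x$i * x$j + y$i * y$j + z$i * z$j = (if i = j then 1 else 0)"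
  shows "v = coord x v *s lift x + coord y v *s lift y + coord z v *s lift z"
proof -
  have "coord x v * h (x$i) + coord y v * h (y$i) + coord z v * h (z$i) = v$i" for i
  proof -
    have "coord x v * h (x$i) + coord y v * h (y$i) + coord z v * h (z$i)
        = (\<Sum>j\<in>UNIV. h (x$j * x$i + y$j * y$i + z$j * z$i) * v$j)"
      by (simp add: coord_def sum_distrib_left sum_distrib_right hom_add hom_mult sum.distrib algebra_simps)
    also have "\<dots> = (\<Sum>j\<in>UNIV. (if j = i then v$j else 0))"
      unfolding assms by (intro sum.cong) (auto simp: hom_zero hom_one)
    also have "\<dots> = v$i" by simp
    finally show ?thesis .
  qed
  then show ?thesis by (simp add: vec_eq_iff)
qed

end

text \<open>Equal polynomials have equal coefficients; the five identities are carried along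
  \<open>h\<close> and homogenised. It is used with the identity of the complex numbers and with
  their embedding into power series.\<close>

lemma binform_factorization:
  fixes k1 m1 n1 k2 m2 n2 k3 m3 n3 c a1 a2 a3 a4 :: complex and h :: "complex \<Rightarrow> 'b::comm_ring_1"
  assumes "[:k1, 2 * m1, n1:] * [:k3, 2 * m3, n3:] - [:k2, 2 * m2, n2:]^2
      = smult c ([:-a1, 1:] * [:-a2, 1:] * [:-a3, 1:] * [:-a4, 1:])"
    and h: "ring_hom_pair h"
  shows "binform (h k1) (h m1) (h n1) a b * binform (h k3) (h m3) (h n3) a b - (binform (h k2) (h m2) (h n2) a b)^2
    = h c * ((b - h a1 * a) * (b - h a2 * a) * (b - h a3 * a) * (b - h a4 * a))"
proof -
  interpret ring_hom_pair h by fact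
  have h_diff: "h (u - v) = h u - h v" for u v using hom_add[of "u - v" v] by simp
  have h_minus: "h (- u) = - h u" for u using h_diff[of 0 u] by (simp add: hom_zero)
  have h2: "h 2 = 2" "h 4 = 4" using hom_add[of 1 1] hom_add[of 2 2] hom_one by simp_all
  note hs = hom_add hom_mult h_diff h_minus h2 hom_zero hom_one
  have "k1 * k3 - k2 * k2 = c * (a1 * a2 * a3 * a4)"
    "2 * k1 * m3 + 2 * m1 * k3 - 4 * k2 * m2 = - c * (a1 * a2 * a3 + a1 * a2 * a4 + a1 * a3 * a4 + a2 * a3 * a4)"
    "k1 * n3 + 4 * m1 * m3 + n1 * k3 - 2 * k2 * n2 - 4 * m2 * m2 = c * (a1 * a2 + a1 * a3 + a1 * a4 + a2 * a3 + a2 * a4 + a3 * a4)"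
    "2 * m1 * n3 + 2 * n1 * m3 - 4 * m2 * n2 = - c * (a1 + a2 + a3 + a4)"
    "n1 * n3 - n2 * n2 = c"
    using assms(1) by (simp_all add: power2_eq_square algebra_simps)
  from this[THEN arg_cong[of _ _ h]]
  have "h k1 * h k3 - h k2 * h k2 = h c * (h a1 * h a2 * h a3 * h a4)"
    "2 * h k1 * h m3 + 2 * h m1 * h k3 - 4 * h k2 * h m2 = - h c * (h a1 * h a2 * h a3 + h a1 * h a2 * h a4 + h a1 * h a3 * h a4 + h a2 * h a3 * h a4)"
    "h k1 * h n3 + 4 * h m1 * h m3 + h n1 * h k3 - 2 * h k2 * h n2 - 4 * h m2 * h m2 = h c * (h a1 * h a2 + h a1 * h a3 + h a1 * h a4 + h a2 * h a3 + h a2 * h a4 + h a3 * h a4)"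
    "2 * h m1 * h n3 + 2 * h n1 * h m3 - 4 * h m2 * h n2 = - h c * (h a1 + h a2 + h a3 + h a4)"
    "h n1 * h n3 - h n2 * h n2 = h c"
    by (simp_all only: hs)
  note E = this
  have "binform (h k1) (h m1) (h n1) a b * binform (h k3) (h m3) (h n3) a b - (binform (h k2) (h m2) (h n2) a b)^2
    = (h k1 * h k3 - h k2 * h k2) * (a * a * a * a)
      + (2 * h k1 * h m3 + 2 * h m1 * h k3 - 4 * h k2 * h m2) * (a * a * a * b)
      + (h k1 * h n3 + 4 * h m1 * h m3 + h n1 * h k3 - 2 * h k2 * h n2 - 4 * h m2 * h m2) * (a * a * b * b)
      + (2 * h m1 * h n3 + 2 * h n1 * h m3 - 4 * h m2 * h n2) * (a * b * b * b)
      + (h n1 * h n3 - h n2 * h n2) * (b * b * b * b)"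
    unfolding binform_def by (simp add: power2_eq_square algebra_simps)
  also have "\<dots> = h c * ((b - h a1 * a) * (b - h a2 * a) * (b - h a3 * a) * (b - h a4 * a))"
    unfolding E by (simp add: algebra_simps)
  finally show ?thesis .
qed

section \<open>Coordinates on P^4 and planes in it\<close>

lemma exhaust_5: "x = 1 \<or> x = 2 \<or> x = 3 \<or> x = 4 \<or> x = 5" for x :: 5
proof (induct x)
  case (of_int z)
  then have "z = 0 \<or> z = 1 \<or> z = 2 \<or> z = 3 \<or> z = 4" by fastforce
  then show ?case by auto
qed

lemma UNIV_5: "UNIV = {1, 2, 3, 4, 5 :: 5}"
  using exhaust_5 by auto

lemma sum_5: "sum f (UNIV :: 5 set) = f 1 + f 2 + f 3 + f 4 + f 5"
  unfolding UNIV_5 by (simp add: ac_simps)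

lemma forall_5: "(\<forall>i::5. P i) \<longleftrightarrow> P 1 \<and> P 2 \<and> P 3 \<and> P 4 \<and> P 5"
  by (metis exhaust_5)

definition emb5 :: "'a::zero^3 \<Rightarrow> 'a \<Rightarrow> 'a \<Rightarrow> 'a^5" where
  "emb5 u r s = (\<chi> i. if i = 1 then u$1 else if i = 2 then u$2 else if i = 3 then u$3 else if i = 4 then r else s)"

lemma emb5_nth [simp]: "emb5 u r s $ 1 = u$1" "emb5 u r s $ 2 = u$2" "emb5 u r s $ 3 = u$3"
  "emb5 u r s $ 4 = r" "emb5 u r s $ 5 = s"
  by (simp_all add: emb5_def)

lemma emb5_eq: "p = emb5 (uvw p) (p$4) (p$5)"
  by (simp add: vec_eq_iff forall_5 uvw_def)

lemma uvw_emb5 [simp]: "uvw (emb5 u r s) = u"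
  by (simp add: vec_eq_iff forall_3 uvw_def)

lemma uvw_linear: "uvw (p + q) = uvw p + uvw q" "uvw (c *s p) = c *s uvw (p :: 'a::comm_ring_1^5)"
  by (simp_all add: vec_eq_iff forall_3 uvw_def)

text \<open>The plane spanned by the line and the real linear relation \<open>t0 r + t1 s = l0 A + l1 B\<close>, where
  \<open>A, B, C\<close> are the coordinates in the frame \<open>x, y, z\<close> and the line is \<open>C = 0\<close>.\<close>

lemma (in frame) contained_in_plane_relation:
  fixes t0 t1 l0 l1 :: real
  assumes t: "t0 \<noteq> 0 \<or> t1 \<noteq> 0"
    and van: "\<And>p \<gamma> k. local_param M1 M2 M3 p \<gamma> \<Longrightarrow> k < count D (pt p) \<Longrightarrow>
      fps_nth (fps.coord z (uvw \<gamma>)) k = 0 \<and>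
      fps_nth (fps_const (of_real t0) * \<gamma>$4 + fps_const (of_real t1) * \<gamma>$5 -
        (fps_const (of_real l0) * fps.coord x (uvw \<gamma>) + fps_const (of_real l1) * fps.coord y (uvw \<gamma>))) k = 0"
  shows "contained_in_plane M1 M2 M3 D"
proof -
  define N where "N = complex_of_real (t0^2 + t1^2)"
  have "t0^2 + t1^2 \<noteq> 0" using t by (simp add: sum_power2_eq_zero_iff)
  then have N: "N \<noteq> 0" unfolding N_def by (metis of_real_eq_0_iff)
  \<comment> \<open>\<open>w1\<close> and \<open>w2\<close> lift \<open>x\<close> and
    \<open>y\<close> to solutions of the relation with (r, s) proportional to (t0, t1);
    \<open>w3\<close> spans the solutions over the origin.\<close>
  define w1 where "w1 = emb5 (cpx.lift x) (of_real l0 * of_real t0 / N) (of_real l0 * of_real t1 / N)"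
  define w2 where "w2 = emb5 (cpx.lift y) (of_real l1 * of_real t0 / N) (of_real l1 * of_real t1 / N)"
  define w3 where "w3 = emb5 0 (- complex_of_real t1) (of_real t0)"
  let ?W = "vec.span {w1, w2, w3}"
  have xx: "cpx.coord u (cpx.lift v) = of_real (u \<bullet> v)" for u v
    by (simp add: cpx.coord_lift inner_vec_def)
  have xy: "cpx.coord x (cpx.lift x) = 1" "cpx.coord y (cpx.lift x) = 0" "cpx.coord x (cpx.lift y) = 0"
    "cpx.coord y (cpx.lift y) = 1"
    using unit orth by (simp_all add: xx norm_eq_1 inner_commute)
  have zero: "cpx.coord u 0 = 0" for u by (simp add: cpx.coord_def)
  have w3: "w3 \<noteq> 0" using t by (auto simp: w3_def vec_eq_iff forall_5)
  have w2: "w2 \<notin> vec.span {w3}"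
  proof
    assume "w2 \<in> vec.span {w3}"
    then obtain c where "w2 = c *s w3" by (auto simp: vec.span_singleton)
    then have "cpx.coord y (uvw w2) = c * cpx.coord y (uvw w3)" by (simp add: uvw_linear cpx.coord_linear)
    then show False by (simp add: w2_def w3_def xy zero)
  qed
  have w1: "w1 \<notin> vec.span {w2, w3}"
  proof
    assume "w1 \<in> vec.span {w2, w3}"
    then obtain c d where "w1 - c *s w2 = d *s w3" by (auto simp: vec.span_insert vec.span_singleton)
    then have "w1 = c *s w2 + d *s w3" by (simp add: algebra_simps)
    then have "cpx.coord x (uvw w1) = c * cpx.coord x (uvw w2) + d * cpx.coord x (uvw w3)"
      by (simp add: uvw_linear cpx.coord_linear)
    then show False by (simp add: w1_def w2_def w3_def xy zero)
  qed
  have "vec.independent {w1, w2, w3}"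
    using w1 w2 w3 by (simp add: vec.independent_insert vec.dependent_single vec.span_singleton)
  moreover have "w1 \<noteq> w2" "w1 \<noteq> w3" "w2 \<noteq> w3" using w1 w2 by (auto intro: vec.span_base)
  ultimately have dim: "vec.dim ?W = 3" by (simp add: vec.dim_eq_card_independent)
  have "contained_in_subspace M1 M2 M3 D ?W"
    unfolding contained_in_subspace_def
  proof (intro allI impI)
    fix b p \<gamma> k
    assume b: "\<forall>u\<in>?W. (\<Sum>i\<in>UNIV. b$i * u$i) = 0" and lp: "local_param M1 M2 M3 p \<gamma>" and k: "k < count D (pt p)"
    \<comment> \<open>Vanishing on \<open>w3\<close> makes (b4, b5) a multiple of (t0, t1), with
      factor \<kappa>; so \<open>b\<close> is a combination of the relation and the equation of the
      line.\<close>
    define \<kappa> where "\<kappa> = (b$4 * of_real t0 + b$5 * of_real t1) / N"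
    have bw: "(\<Sum>i\<in>UNIV. b$i * w1$i) = 0" "(\<Sum>i\<in>UNIV. b$i * w2$i) = 0" "(\<Sum>i\<in>UNIV. b$i * w3$i) = 0"
      using b by (auto intro: vec.span_base)
    have b45: "b$5 * of_real t0 = b$4 * of_real t1" using bw(3) by (simp add: w3_def sum_5)
    have "b$4 * N = (b$4 * of_real t0 + b$5 * of_real t1) * of_real t0"
      unfolding N_def using b45 by (simp add: power2_eq_square algebra_simps)
    then have b4: "b$4 = \<kappa> * of_real t0" using N by (simp add: \<kappa>_def field_simps)
    have "b$5 * N = (b$4 * of_real t0 + b$5 * of_real t1) * of_real t1"
      unfolding N_def using b45 by (simp add: power2_eq_square algebra_simps)
    then have b5: "b$5 = \<kappa> * of_real t1" using N by (simp add: \<kappa>_def field_simps)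
    define \<beta> where "\<beta> v = b$1 * v$1 + b$2 * v$2 + b$3 * v$3" for v :: "complex^3"
    have "(\<Sum>i\<in>UNIV. b$i * w1$i) = \<beta> (cpx.lift x) + \<kappa> * of_real l0"
      unfolding w1_def sum_5 emb5_nth \<beta>_def \<kappa>_def by (simp add: add_divide_distrib algebra_simps)
    then have \<beta>x: "\<beta> (cpx.lift x) = - \<kappa> * of_real l0"
      unfolding bw by (metis add_eq_0_iff2 mult_minus_left)
    have "(\<Sum>i\<in>UNIV. b$i * w2$i) = \<beta> (cpx.lift y) + \<kappa> * of_real l1"
      unfolding w2_def sum_5 emb5_nth \<beta>_def \<kappa>_def by (simp add: add_divide_distrib algebra_simps)
    then have \<beta>y: "\<beta> (cpx.lift y) = - \<kappa> * of_real l1"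
      unfolding bw by (metis add_eq_0_iff2 mult_minus_left)
    define A B C where "A = fps.coord x (uvw \<gamma>)" "B = fps.coord y (uvw \<gamma>)" "C = fps.coord z (uvw \<gamma>)"
    note ABC = this
    have g: "uvw \<gamma> = A *s fps.lift x + B *s fps.lift y + C *s fps.lift z"
      unfolding ABC by (rule fps.coord_expand[OF complete])
    have g': "\<gamma>$1 = A * fps_const (of_real (x$1)) + B * fps_const (of_real (y$1)) + C * fps_const (of_real (z$1))"
      "\<gamma>$2 = A * fps_const (of_real (x$2)) + B * fps_const (of_real (y$2)) + C * fps_const (of_real (z$2))"
      "\<gamma>$3 = A * fps_const (of_real (x$3)) + B * fps_const (of_real (y$3)) + C * fps_const (of_real (z$3))"
      using g by (simp_all add: vec_eq_iff forall_3 uvw_def)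
    let ?U = "fps_const (of_real t0) * \<gamma>$4 + fps_const (of_real t1) * \<gamma>$5 - (fps_const (of_real l0) * A + fps_const (of_real l1) * B)"
    have fc: "fps_const (u * v) = fps_const u * fps_const v" "fps_const (u + v) = fps_const u + fps_const v"
      "fps_const (- u) = - fps_const u" for u v :: complex by simp_all
    have "(\<Sum>i\<in>UNIV. fps_const (b$i) * \<gamma>$i) =
        A * fps_const (\<beta> (cpx.lift x)) + B * fps_const (\<beta> (cpx.lift y)) + C * fps_const (\<beta> (cpx.lift z))
        + fps_const (b$4) * \<gamma>$4 + fps_const (b$5) * \<gamma>$5"
      unfolding sum_5 g' \<beta>_def vec_lambda_beta fc by (simp only: algebra_simps)
    also have "\<dots> = fps_const \<kappa> * ?U + fps_const (\<beta> (cpx.lift z)) * C"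
      unfolding \<beta>x \<beta>y b4 b5 fc by algebra
    finally have eq: "(\<Sum>i\<in>UNIV. fps_const (b$i) * \<gamma>$i) = fps_const \<kappa> * ?U + fps_const (\<beta> (cpx.lift z)) * C" .
    show "fps_nth (\<Sum>i\<in>UNIV. fps_const (b$i) * \<gamma>$i) k = 0"
      unfolding eq using van[OF lp k] unfolding ABC[symmetric] by simp
  qed
  then show ?thesis using dim unfolding contained_in_plane_def by blast
qed

section \<open>Local parameters and multiplicities\<close>

interpretation fconst: ring_hom_pair "fps_const :: complex \<Rightarrow> complex fps"
  by unfold_locales (simp_all add: fps_const_1_eq_1)

interpretation nth0: ring_hom_pair "\<lambda>f :: complex fps. fps_nth f 0"
  by unfold_locales simp_all

interpretation cid: ring_hom_pair "\<lambda>c :: complex. c"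
  by unfold_locales simp_all

abbreviation fmat :: "real^3^3 \<Rightarrow> complex fps^3^3" where
  "fmat \<equiv> map_matrix (\<lambda>c. fps_const (complex_of_real c))"

abbreviation pmat :: "real^3^3 \<Rightarrow> complex poly^3^3" where
  "pmat \<equiv> map_matrix (\<lambda>c. [:complex_of_real c:])"

lemma dquartic_scale: "dquartic M1 M2 M3 (c *s x) v = c ^ 3 * dquartic M1 M2 M3 x v"
  by (simp add: dquartic_def qform_scale polar_linear power2_eq_square power3_eq_cube algebra_simps)

lemma coord_lift_inner: "cpx.coord u (cpx.lift v) = of_real (u \<bullet> v)"
  by (simp add: cpx.coord_lift inner_vec_def)

text \<open>The restriction of the quartic to the line through \<open>x\<close> and \<open>y\<close>, in the affine coordinate of
  \<open>x + \<lambda> y\<close>.\<close>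

definition line_poly :: "real^3^3 \<Rightarrow> real^3^3 \<Rightarrow> real^3^3 \<Rightarrow> real^3 \<Rightarrow> real^3 \<Rightarrow> complex poly" where
  "line_poly M1 M2 M3 x y =
    [:of_real (qform M1 x), 2 * of_real (polar M1 x y), of_real (qform M1 y):]
    * [:of_real (qform M3 x), 2 * of_real (polar M3 x y), of_real (qform M3 y):]
    - [:of_real (qform M2 x), 2 * of_real (polar M2 x y), of_real (qform M2 y):]^2"

lemma poly_line_poly:
  assumes sym: "transpose M1 = M1" "transpose M2 = M2" "transpose M3 = M3"
  shows "poly (line_poly M1 M2 M3 x y) w = quartic (cmat M1) (cmat M2) (cmat M3) (cpx.lift x + w *s cpx.lift y)"
proof -
  have q: "qform (cmat M) (cpx.lift x + w *s cpx.lift y)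
      = poly [:of_real (qform M x), 2 * of_real (polar M x y), of_real (qform M y):] w"
    if "transpose M = M" for M
    using qform_lincomb[OF cpx.hom_transpose[OF that], of 1 "cpx.lift x" w "cpx.lift y"]
    by (simp add: cpx.hom_qform cpx.hom_polar binform_def power2_eq_square algebra_simps)
  show ?thesis
    unfolding quartic_def line_poly_def q[OF sym(1)] q[OF sym(2)] q[OF sym(3)] poly_diff poly_mult poly_power ..
qed

lemma poly_pderiv_line_poly:
  assumes sym: "transpose M1 = M1" "transpose M2 = M2" "transpose M3 = M3"
  shows "poly (pderiv (line_poly M1 M2 M3 x y)) w
    = 2 * dquartic (cmat M1) (cmat M2) (cmat M3) (cpx.lift x + w *s cpx.lift y) (cpx.lift y)"
proof -
  let ?P = "\<lambda>M. [:of_real (qform M x), 2 * of_real (polar M x y), of_real (qform M y):] :: complex poly"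
  have q: "qform (cmat M) (cpx.lift x + w *s cpx.lift y) = poly (?P M) w"
    if "transpose M = M" for M
    using qform_lincomb[OF cpx.hom_transpose[OF that], of 1 "cpx.lift x" w "cpx.lift y"]
    by (simp add: cpx.hom_qform cpx.hom_polar binform_def power2_eq_square algebra_simps)
  have p: "2 * polar (cmat M) (cpx.lift x + w *s cpx.lift y) (cpx.lift y) = poly (pderiv (?P M)) w" for M
    by (simp add: polar_linear cpx.hom_polar pderiv_pCons algebra_simps flip: qform_polar)
      (simp add: qform_polar cpx.hom_polar)
  have "poly (pderiv (line_poly M1 M2 M3 x y)) w =
      poly (pderiv (?P M1)) w * poly (?P M3) w + poly (?P M1) w * poly (pderiv (?P M3)) w
      - 2 * poly (?P M2) w * poly (pderiv (?P M2)) w"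
    unfolding line_poly_def power2_eq_square pderiv_diff pderiv_mult poly_diff poly_add poly_mult
    by (simp only: algebra_simps) simp
  then show ?thesis
    unfolding p[symmetric] q[OF sym(1), symmetric] q[OF sym(2), symmetric] q[OF sym(3), symmetric] dquartic_def
    by (simp add: algebra_simps)
qed

text \<open>\<open>line_section\<close> measures orders at parameter 0 from each base point; moving
  the base point along the line is the substitution of \<open>w + \<lambda>\<close>.\<close>

lemma quartic_pmat_line:
  assumes sym: "transpose M1 = M1" "transpose M2 = M2" "transpose M3 = M3"
  shows "quartic (pmat M1) (pmat M2) (pmat M3) (\<chi> i. [:(cpx.lift x + w *s cpx.lift y)$i, (cpx.lift y)$i:])
    = pcompose (line_poly M1 M2 M3 x y) [:w, 1:]"
proof -
  have v: "(\<chi> i. [:(cpx.lift x + w *s cpx.lift y)$i, (cpx.lift y)$i:]) = 1 *s cpoly.lift x + [:w, 1:] *s cpoly.lift y"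
    by (simp add: vec_eq_iff)
  have q: "qform (pmat M) (1 *s cpoly.lift x + [:w, 1:] *s cpoly.lift y)
      = pcompose [:of_real (qform M x), 2 * of_real (polar M x y), of_real (qform M y):] [:w, 1:]"
    if "transpose M = M" for M
    unfolding qform_lincomb[OF cpoly.hom_transpose[OF that]] cpoly.hom_qform cpoly.hom_polar binform_def
    by (simp add: pcompose_pCons power2_eq_square numeral_poly algebra_simps)
  show ?thesis
    unfolding v quartic_def line_poly_def q[OF sym(1)] q[OF sym(2)] q[OF sym(3)]
      pcompose_diff pcompose_mult power2_eq_square ..
qed

lemma pcompose_power: "pcompose (p ^ n) q = pcompose p q ^ n"
  by (induction n) (simp_all add: pcompose_mult one_pCons pcompose_pCons)

lemma order_pcompose_shift:
  fixes p :: "'a::field poly"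
  assumes "p \<noteq> 0"
  shows "order 0 (pcompose p [:w, 1:]) = order w p"
proof (rule order_unique_lemma)
  obtain q where q: "p = [:-w, 1:] ^ order w p * q" using order_1[of w p] by (auto elim: dvdE)
  then have qw: "poly q w \<noteq> 0" using order_2[OF assms, of w] by (metis dvdI dvd_mult_left mult_dvd_mono poly_eq_0_iff_dvd power_Suc2 dvd_refl)
  have "pcompose p [:w, 1:] = [:0, 1:] ^ order w p * pcompose q [:w, 1:]"
    by (subst q) (simp add: pcompose_mult pcompose_power pcompose_pCons)
  then show "[:- 0, 1:] ^ order w p dvd pcompose p [:w, 1:]" by simp
  show "\<not> [:- 0, 1:] ^ Suc (order w p) dvd pcompose p [:w, 1:]"
  proof
    assume "[:- 0, 1:] ^ Suc (order w p) dvd pcompose p [:w, 1:]"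
    then have "[:0, 1:] ^ order w p * [:0, 1:] dvd [:0, 1:] ^ order w p * pcompose q [:w, 1:]"
      using \<open>pcompose p [:w, 1:] = _\<close> by (simp add: mult.commute)
    then have "[:0, 1:] dvd pcompose q [:w, 1:]" by (subst (asm) dvd_mult_cancel_left) auto
    then have "poly (pcompose q [:w, 1:]) 0 = 0" by (metis poly_eq_0_iff_dvd minus_zero)
    then show False using qw by (simp add: poly_pcompose)
  qed
qed

lemma fps_X_power_dvd_nth:
  assumes "fps_X ^ n dvd (f :: 'a::comm_ring_1 fps)" "k < n"
  shows "fps_nth f k = 0"
proof -
  obtain g where "f = fps_X ^ n * g" using assms(1) by (auto elim: dvdE)
  then show ?thesis using assms(2) by (simp add: fps_X_power_mult_nth)
qed

lemma fps_X_power_dvd_mult_unit: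
  assumes "fps_X ^ n dvd f * (g :: 'a::field fps)" "fps_nth g 0 \<noteq> 0"
  shows "fps_X ^ n dvd f"
proof -
  have "f = f * g * inverse g" using assms(2) by (simp add: mult.assoc inverse_mult_eq_1')
  then show ?thesis using assms(1) by (metis dvd_mult2)
qed

lemma fps_X_power_dvd_linear:
  assumes "fps_nth b 0 = w * fps_nth (a :: complex fps) 0"
  shows "fps_X dvd b - fps_const w * a"
proof -
  have "fps_nth (b - fps_const w * a) 0 = 0" using assms by simp
  then have "b - fps_const w * a = fps_X * fps_shift 1 (b - fps_const w * a)"
    by (intro fps_ext) (simp add: fps_X_mult_nth split: if_splits)
  then show ?thesis by (metis dvd_triv_left)
qed

lemma fps_coord_nth0: "fps_nth (fps.coord x (uvw \<gamma>)) 0 = cpx.coord x (uvw (\<chi> i. fps_nth (\<gamma>$i) 0))"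
  by (simp add: fps.coord_def cpx.coord_def fps_sum_nth sum_3 uvw_def)

context frame
begin

text \<open>At a multiple point of the section the derivatives of the quartic along the line vanish, so by
  smoothness the derivative in the direction \<open>z\<close> does not.\<close>

lemma normal_derivative:
  assumes sym: "transpose M1 = M1" "transpose M2 = M2" "transpose M3 = M3"
    and smooth: "smooth_plane_quartic M1 M2 M3"
    and root: "poly (line_poly M1 M2 M3 x y) w = 0" "poly (pderiv (line_poly M1 M2 M3 x y)) w = 0"
  shows "dquartic (cmat M1) (cmat M2) (cmat M3) (cpx.lift x + w *s cpx.lift y) (cpx.lift z) \<noteq> 0"
proof
  let ?u = "cpx.lift x + w *s cpx.lift y" and ?d = "dquartic (cmat M1) (cmat M2) (cmat M3)"
  assume dz: "?d ?u (cpx.lift z) = 0"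
  have Fu: "quartic (cmat M1) (cmat M2) (cmat M3) ?u = 0" using root(1) poly_line_poly[OF sym] by simp
  have dy: "?d ?u (cpx.lift y) = 0" using root(2) poly_pderiv_line_poly[OF sym, of x y w] by simp
  have "?d ?u ?u = 0" by (simp add: dquartic_self Fu)
  then have dx: "?d ?u (cpx.lift x) = 0" using dy by (simp add: dquartic_linear)
  have "cpx.coord x ?u = 1"
    using unit orth by (simp add: cpx.coord_linear coord_lift_inner norm_eq_1)
  moreover have "cpx.coord x 0 = 0" by (simp add: cpx.coord_def)
  ultimately have "?u \<noteq> 0" by (metis zero_neq_one)
  then obtain i where i: "?d ?u (axis i 1) \<noteq> 0" using smooth_gradient[OF sym smooth _ Fu] by blast
  have "axis i 1 = cpx.coord x (axis i 1) *s cpx.lift x + cpx.coord y (axis i 1) *s cpx.lift y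
      + cpx.coord z (axis i 1) *s cpx.lift z" by (rule cpx.coord_expand[OF complete])
  from arg_cong[OF this, of "?d ?u"] have "?d ?u (axis i 1) = cpx.coord x (axis i 1) * ?d ?u (cpx.lift x)
      + cpx.coord y (axis i 1) * ?d ?u (cpx.lift y) + cpx.coord z (axis i 1) * ?d ?u (cpx.lift z)"
    unfolding dquartic_linear .
  then show False using i dx dy dz by simp
qed

text \<open>Expanding the quartic around the component \<open>v\<close> in the line gives
  \<open>F(v) + C G = 0\<close>, where \<open>G\<close> starts with twice the normal derivative.
  That is nonzero at a multiple root, so \<open>G\<close> is a unit and \<open>C\<close> vanishes as
  often as \<open>F(v)\<close>, a constant times the product of the factors
  \<open>B - a_i A\<close>.\<close>

lemma normal_coord_order:
  assumes sym: "transpose M1 = M1" "transpose M2 = M2" "transpose M3 = M3"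
    and smooth: "smooth_plane_quartic M1 M2 M3"
    and fact: "line_poly M1 M2 M3 x y = smult c ([:-a1, 1:] * [:-a2, 1:] * [:-a3, 1:] * [:-a4, 1:])"
    and root: "poly (pderiv (line_poly M1 M2 M3 x y)) w = 0" "poly (line_poly M1 M2 M3 x y) w = 0"
    and lp: "local_param M1 M2 M3 p \<gamma>" and p: "uvw p = \<mu> *s (cpx.lift x + w *s cpx.lift y)" "\<mu> \<noteq> 0"
    and A: "A = fps.coord x (uvw \<gamma>)" and B: "B = fps.coord y (uvw \<gamma>)"
    and dvd: "fps_X ^ n dvd (B - fps_const a1 * A) * (B - fps_const a2 * A) * (B - fps_const a3 * A) * (B - fps_const a4 * A)"
  shows "fps_X ^ n dvd fps.coord z (uvw \<gamma>)"
proof -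
  define C where "C = fps.coord z (uvw \<gamma>)"
  define v where "v = A *s fps.lift x + B *s fps.lift y"
  have g: "uvw \<gamma> = v + C *s fps.lift z"
    unfolding v_def A B C_def by (rule fps.coord_expand[OF complete])
  note symf = sym[THEN fps.hom_transpose]
  have oc: "on_cover (fmat M1) (fmat M2) (fmat M3) \<gamma>" and p0: "(\<chi> i. fps_nth (\<gamma>$i) 0) = p"
    using lp unfolding local_param_def Let_def by blast+
  then have "quartic (fmat M1) (fmat M2) (fmat M3) (uvw \<gamma>) = 0"
    unfolding on_cover_def quartic_def by (simp add: power2_eq_square algebra_simps)
  then obtain H where H: "quartic (fmat M1) (fmat M2) (fmat M3) v + C * (2 * dquartic (fmat M1) (fmat M2) (fmat M3) v (fps.lift z) + C * H) = 0"
    unfolding g quartic_add[OF symf] by blast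
  have qv: "quartic (fmat M1) (fmat M2) (fmat M3) v =
     fps_const c * ((B - fps_const a1 * A) * (B - fps_const a2 * A) * (B - fps_const a3 * A) * (B - fps_const a4 * A))"
    unfolding quartic_def v_def qform_lincomb[OF symf(1)] qform_lincomb[OF symf(2)] qform_lincomb[OF symf(3)]
      fps.hom_qform fps.hom_polar
    using fact[unfolded line_poly_def] fconst.ring_hom_pair_axioms by (rule binform_factorization)
  have C0: "fps_nth C 0 = 0"
  proof -
    have "cpx.coord z (cpx.lift x + w *s cpx.lift y) = 0"
      using orth by (simp add: cpx.coord_linear coord_lift_inner inner_commute)
    then show ?thesis unfolding C_def fps_coord_nth0 p0 p(1) cpx.coord_linear(2) by simp
  qed
  let ?G = "2 * dquartic (fmat M1) (fmat M2) (fmat M3) v (fps.lift z) + C * H"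
  have mm: "map_matrix (\<lambda>f. fps_nth f 0) (fmat M) = cmat M" for M
    by (simp add: map_matrix_def vec_eq_iff)
  have "(\<chi> i. fps_nth (v$i) 0) = \<mu> *s (cpx.lift x + w *s cpx.lift y)"
  proof -
    have "(\<chi> i. fps_nth (v$i) 0) = (\<chi> i. fps_nth (uvw \<gamma>$i) 0)" unfolding g using C0 by (simp add: vec_eq_iff)
    also have "\<dots> = uvw p" unfolding p0[symmetric] by (simp add: vec_eq_iff forall_3 uvw_def)
    finally show ?thesis using p(1) by simp
  qed
  then have "fps_nth (dquartic (fmat M1) (fmat M2) (fmat M3) v (fps.lift z)) 0
      = dquartic (cmat M1) (cmat M2) (cmat M3) (\<mu> *s (cpx.lift x + w *s cpx.lift y)) (cpx.lift z)"
    using nth0.hom_dquartic[of "fmat M1" "fmat M2" "fmat M3" v "fps.lift z"] by (simp add: mm)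
  also have "\<dots> \<noteq> 0"
    unfolding dquartic_scale using normal_derivative[OF sym smooth root(2,1)] p(2) by simp
  finally have G0: "fps_nth ?G 0 \<noteq> 0" using C0 by (simp add: fps_numeral_nth fps_mult_nth_0)
  have CG: "C * ?G = - quartic (fmat M1) (fmat M2) (fmat M3) v" using H by (metis add_eq_0_iff)
  have "fps_X ^ n dvd C * ?G" unfolding CG qv dvd_minus_iff by (rule dvd_mult[OF dvd])
  from fps_X_power_dvd_mult_unit[OF this G0] show ?thesis unfolding C_def .
qed

text \<open>The linear relation of the plane and its image under the covering involution multiply to
  a multiple of the equation of the line.\<close>

lemma relation_product:
  fixes t0 t1 l0 l1 :: real
  assumes sym: "transpose M1 = M1" "transpose M2 = M2" "transpose M3 = M3"
    and sq: "t0^2 * qform M1 x + 2 * t0 * t1 * qform M2 x + t1^2 * qform M3 x = l0^2"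
      "t0^2 * polar M1 x y + 2 * t0 * t1 * polar M2 x y + t1^2 * polar M3 x y = l0 * l1"
      "t0^2 * qform M1 y + 2 * t0 * t1 * qform M2 y + t1^2 * qform M3 y = l1^2"
    and lp: "local_param M1 M2 M3 p \<gamma>"
  defines "T \<equiv> fps_const (of_real t0) * \<gamma>$4 + fps_const (of_real t1) * \<gamma>$5"
    and "L \<equiv> fps_const (of_real l0) * fps.coord x (uvw \<gamma>) + fps_const (of_real l1) * fps.coord y (uvw \<gamma>)"
  shows "fps.coord z (uvw \<gamma>) dvd (T - L) * (T + L)"
proof -
  define A B C where "A = fps.coord x (uvw \<gamma>)" "B = fps.coord y (uvw \<gamma>)" "C = fps.coord z (uvw \<gamma>)"
  note ABC = this
  define v where "v = A *s fps.lift x + B *s fps.lift y"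
  have g: "uvw \<gamma> = v + C *s fps.lift z"
    unfolding v_def ABC by (rule fps.coord_expand[OF complete])
  let ?c = "\<lambda>c. fps_const (complex_of_real c)"
  have q: "\<exists>K. qform (fmat M) (uvw \<gamma>) = binform (?c (qform M x)) (?c (polar M x y)) (?c (qform M y)) A B + C * K"
    if "transpose M = M" for M
  proof -
    note s = fps.hom_transpose[OF that]
    have "qform (fmat M) (uvw \<gamma>) = binform (?c (qform M x)) (?c (polar M x y)) (?c (qform M y)) A B
       + C * (2 * polar (fmat M) v (fps.lift z) + C * qform (fmat M) (fps.lift z))"
      unfolding g qform_add[OF s] qform_scale polar_linear v_def qform_lincomb[OF s] fps.hom_qform fps.hom_polar
        binform_def by (simp add: algebra_simps power2_eq_square)
    then show ?thesis by blast
  qed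
  obtain K1 where K1: "qform (fmat M1) (uvw \<gamma>) = binform (?c (qform M1 x)) (?c (polar M1 x y)) (?c (qform M1 y)) A B + C * K1"
    using q[OF sym(1)] by blast
  obtain K2 where K2: "qform (fmat M2) (uvw \<gamma>) = binform (?c (qform M2 x)) (?c (polar M2 x y)) (?c (qform M2 y)) A B + C * K2"
    using q[OF sym(2)] by blast
  obtain K3 where K3: "qform (fmat M3) (uvw \<gamma>) = binform (?c (qform M3 x)) (?c (polar M3 x y)) (?c (qform M3 y)) A B + C * K3"
    using q[OF sym(3)] by blast
  have "on_cover (fmat M1) (fmat M2) (fmat M3) \<gamma>" using lp unfolding local_param_def Let_def by blast
  then have oc: "(\<gamma>$4)^2 = qform (fmat M1) (uvw \<gamma>)" "\<gamma>$4 * \<gamma>$5 = qform (fmat M2) (uvw \<gamma>)"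
    "(\<gamma>$5)^2 = qform (fmat M3) (uvw \<gamma>)" by (simp_all add: on_cover_def)
  have sq': "(?c t0)^2 * ?c (qform M1 x) + 2 * ?c t0 * ?c t1 * ?c (qform M2 x) + (?c t1)^2 * ?c (qform M3 x) = (?c l0)^2"
      "(?c t0)^2 * ?c (polar M1 x y) + 2 * ?c t0 * ?c t1 * ?c (polar M2 x y) + (?c t1)^2 * ?c (polar M3 x y) = ?c l0 * ?c l1"
      "(?c t0)^2 * ?c (qform M1 y) + 2 * ?c t0 * ?c t1 * ?c (qform M2 y) + (?c t1)^2 * ?c (qform M3 y) = (?c l1)^2"
  proof -
    have two: "?c 2 = 2" by (simp add: numeral_fps_const)
    note hm = fps.hom_mult fps.hom_add two power2_eq_square
    show "(?c t0)^2 * ?c (qform M1 x) + 2 * ?c t0 * ?c t1 * ?c (qform M2 x) + (?c t1)^2 * ?c (qform M3 x) = (?c l0)^2"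
      using arg_cong[OF sq(1), of ?c] unfolding hm .
    show "(?c t0)^2 * ?c (polar M1 x y) + 2 * ?c t0 * ?c t1 * ?c (polar M2 x y) + (?c t1)^2 * ?c (polar M3 x y) = ?c l0 * ?c l1"
      using arg_cong[OF sq(2), of ?c] unfolding hm .
    show "(?c t0)^2 * ?c (qform M1 y) + 2 * ?c t0 * ?c t1 * ?c (qform M2 y) + (?c t1)^2 * ?c (qform M3 y) = (?c l1)^2"
      using arg_cong[OF sq(3), of ?c] unfolding hm .
  qed
  have "T^2 = (?c t0)^2 * (\<gamma>$4)^2 + 2 * ?c t0 * ?c t1 * (\<gamma>$4 * \<gamma>$5) + (?c t1)^2 * (\<gamma>$5)^2"
    unfolding T_def by algebra
  also have "\<dots> = ((?c l0)^2) * A^2 + 2 * (?c l0 * ?c l1) * A * B + (?c l1)^2 * B^2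
      + C * ((?c t0)^2 * K1 + 2 * ?c t0 * ?c t1 * K2 + (?c t1)^2 * K3)"
    unfolding oc K1 K2 K3 sq'[symmetric] binform_def by algebra
  finally have "(T - L) * (T + L) = C * ((?c t0)^2 * K1 + 2 * ?c t0 * ?c t1 * K2 + (?c t1)^2 * K3)"
    unfolding L_def ABC[symmetric] by algebra
  then show ?thesis unfolding ABC by simp
qed

end

section \<open>Divisors on the cover\<close>

lemma mem_pt: "x \<in> pt x"
  by (simp add: pt_def vec.span_base)

lemma pt_eqD:
  assumes "pt x = pt y"
  obtains c where "x = c *s y"
proof -
  have "x \<in> pt y" using mem_pt[of x] assms by simp
  then show ?thesis using that by (auto simp: pt_def vec.span_singleton)
qed

lemma pt_scale: "c \<noteq> 0 \<Longrightarrow> pt (c *s x) = pt x"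
  unfolding pt_def vec.span_singleton
proof (intro equalityI subsetI)
  fix v assume c: "c \<noteq> 0" and "v \<in> range (\<lambda>k. k *s x)"
  then obtain k where "v = k *s x" by blast
  then have "v = (k / c) *s (c *s x)" using c by simp
  then show "v \<in> range (\<lambda>k. k *s (c *s x))" by blast
qed auto

lemma uvw_pt: "uvw ` pt p = pt (uvw p)"
  unfolding pt_def vec.span_singleton by (simp add: image_image uvw_linear)

section \<open>Complex conjugation of points and divisors\<close>

definition cnjv :: "complex^'n \<Rightarrow> complex^'n" where
  "cnjv p = (\<chi> i. cnj (p$i))"

lemma cnjv_nth [simp]: "cnjv p $ i = cnj (p$i)"
  by (simp add: cnjv_def)

lemma conj_pt: "conj_pt (pt p) = pt (cnjv p)"
proof -
  have "cnjv (k *s p) = cnj k *s cnjv p" for k by (simp add: vec_eq_iff)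
  moreover have "\<exists>k. cnj k = c" for c by (metis complex_cnj_cnj)
  ultimately show ?thesis
    unfolding conj_pt_def pt_def vec.span_singleton cnjv_def[symmetric]
    by (auto simp: image_iff) metis
qed

lemma conj_pt_invol: "conj_pt (conj_pt P) = P"
  by (force simp: conj_pt_def image_image vec_eq_iff image_iff)

text \<open>Scaled so that a nonzero coordinate is 1, the representative is unique, so conjugation
  fixes it.\<close>

lemma conj_pt_fixed:
  assumes "conj_pt (pt p) = pt p" "p \<noteq> 0"
  obtains k q where "k \<noteq> 0" "p = k *s (\<chi> i. complex_of_real (q$i))" "q \<noteq> 0"
proof -
  have "cnjv p \<in> pt p" using assms(1) mem_pt[of "cnjv p"] by (simp add: conj_pt)
  then obtain c where c: "cnjv p = c *s p" by (auto simp: pt_def vec.span_singleton)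
  obtain i where i: "p$i \<noteq> 0" using assms(2) by (auto simp: vec_eq_iff)
  define q where "q = (\<chi> j. Re (p$j / p$i))"
  have "p$j / p$i \<in> \<real>" for j
  proof -
    have "cnj (p$j) = c * p$j" for j using arg_cong[OF c, of "\<lambda>v. v$j"] by simp
    moreover have "c \<noteq> 0" using calculation[of i] i by auto
    ultimately have "cnj (p$j / p$i) = p$j / p$i" using i by simp
    then show ?thesis by (simp add: Reals_cnj_iff)
  qed
  then have "complex_of_real (q$j) = p$j / p$i" for j by (simp add: q_def of_real_Re)
  then have p: "p = (p$i) *s (\<chi> i. complex_of_real (q$i))" using i by (simp add: vec_eq_iff)
  show ?thesis
  proof (rule that[OF i p])
    have "q$i = 1" using i by (simp add: q_def)
    then show "q \<noteq> 0" by (metis zero_index zero_neq_one)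
  qed
qed

text \<open>An involution without fixed points splits the divisor into two conjugate pairs. Naming
  their members suitably leaves R = P as the only way in which the pairs can coincide.\<close>

lemma real_divisor_cases:
  fixes D :: "'a multiset"
  assumes "size D = 4" "image_mset f D = D" "\<And>P. f (f P) = P" "\<And>P. P \<in># D \<Longrightarrow> f P \<noteq> P"
  obtains P R where "D = {#P, f P, R, f R#}" "R \<noteq> f P"
proof -
  have step: "\<exists>P E'. E = {#P, f P#} + E'"
    if E: "image_mset f E = E" "E \<noteq> {#}" "set_mset E \<subseteq> set_mset D" for E
  proof -
    obtain P where P: "P \<in># E" using E(2) by auto
    then have fP: "f P \<in># E" using E(1) by (metis imageI set_image_mset)
    have "f P \<noteq> P" using assms(4) P E(3) by blast
    then have "f P \<in># E - {#P#}" using fP by (simp add: in_diff_count)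
    then obtain E' where "E - {#P#} = add_mset (f P) E'" by (metis insert_DiffM)
    then have "E = {#P, f P#} + E'" using P by (metis insert_DiffM add_mset_add_single union_mset_add_mset_left add_0)
    then show ?thesis by blast
  qed
  have "D \<noteq> {#}" using assms(1) by auto
  then obtain P E where PE: "D = {#P, f P#} + E" using step[OF assms(2) _ subset_refl] by blast
  have E: "image_mset f E = E"
  proof -
    have "image_mset f D = {#f P, P#} + image_mset f E" unfolding PE by (simp add: assms(3))
    then have "{#f P, P#} + image_mset f E = {#P, f P#} + E" using assms(2) PE by simp
    then show ?thesis by (metis add_mset_commute add_left_cancel)
  qed
  have "size E = 2" using assms(1) unfolding PE by simp
  then obtain R E' where RE: "E = {#R, f R#} + E'" using step[OF E] PE by fastforce
  then have "E' = {#}" using \<open>size E = 2\<close> by simp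
  then have D: "D = {#P, f P, R, f R#}" using PE RE by simp
  show ?thesis
  proof (cases "R = f P")
    \<comment> \<open>Both pairs are then equal, and P itself can serve as R.\<close>
    case True
    then have "D = {#P, f P, P, f P#}" using D assms(3) by (simp add: add_mset_commute)
    moreover have "P \<noteq> f P" using assms(4)[of P] D by auto
    ultimately show ?thesis using that by blast
  qed (use that D in blast)
qed

text \<open>At a real point the form at the parameter (\<nu>0, \<nu>1) would be the square of
  \<open>\<nu>0 r + \<nu>1 s\<close>, against its negativity.\<close>

lemma cover_no_real_point:
  assumes sym: "transpose M1 = M1" "transpose M2 = M2" "transpose M3 = M3"
    and neg: "\<And>u. u \<noteq> 0 \<Longrightarrow> \<nu>0^2 * qform M1 u + 2 * \<nu>0 * \<nu>1 * qform M2 u + \<nu>1^2 * qform M3 u < 0"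
    and P: "P \<in> cover_points M1 M2 M3"
  shows "conj_pt P \<noteq> P"
proof
  assume fixed: "conj_pt P = P"
  obtain p where p: "P = pt p" "p \<noteq> 0" "on_cover (cmat M1) (cmat M2) (cmat M3) p"
    using P by (auto simp: cover_points_def)
  obtain k q where kq: "k \<noteq> 0" "p = k *s (\<chi> i. complex_of_real (q$i))" "q \<noteq> 0"
    using conj_pt_fixed[of p] fixed p by auto
  have u: "uvw p = k *s cpx.lift (uvw q)" unfolding kq(2) by (simp add: vec_eq_iff forall_3 uvw_def)
  have "of_real (qform M1 (uvw q)) = (complex_of_real (q$4))^2"
    "of_real (qform M2 (uvw q)) = complex_of_real (q$4) * of_real (q$5)"
    "of_real (qform M3 (uvw q)) = (complex_of_real (q$5))^2"
    using p(3) kq(1) unfolding on_cover_def u qform_scale cpx.hom_qform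
    by (simp_all add: kq(2) power2_eq_square)
  then have q: "qform M1 (uvw q) = (q$4)^2" "qform M2 (uvw q) = q$4 * q$5" "qform M3 (uvw q) = (q$5)^2"
    by (metis of_real_eq_iff of_real_power of_real_mult)+
  have "\<nu>0^2 * qform M1 (uvw q) + 2 * \<nu>0 * \<nu>1 * qform M2 (uvw q) + \<nu>1^2 * qform M3 (uvw q)
      = (\<nu>0 * q$4 + \<nu>1 * q$5)^2" unfolding q by (simp add: power2_eq_square algebra_simps)
  then have "\<not> \<nu>0^2 * qform M1 (uvw q) + 2 * \<nu>0 * \<nu>1 * qform M2 (uvw q) + \<nu>1^2 * qform M3 (uvw q) < 0" by simp
  then have "uvw q = 0" using neg by blast
  moreover from this have "q$4 = 0" "q$5 = 0" using q by (simp_all add: qform_def)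
  ultimately have "q = 0" by (simp add: vec_eq_iff forall_5 forall_3 uvw_def)
  then show False using kq(3) by simp
qed

section \<open>Lines and the points of the cover above them\<close>

lemma continuous_polar: "continuous_on S (\<lambda>w. polar M (f w) (g w))"
  if "continuous_on S f" "continuous_on S g" for f g :: "'b::topological_space \<Rightarrow> real^3"
  unfolding polar_def by (intro continuous_intros that)

lemma continuous_qform: "continuous_on S (\<lambda>w. qform M (f w))"
  if "continuous_on S f" for f :: "'b::topological_space \<Rightarrow> real^3"
  unfolding qform_polar by (intro continuous_polar that)

text \<open>If the quartic contained the line, the normal derivative along it would be an odd function,
  and its zero would be a singular point.\<close>

lemma smooth_contains_no_line:
  assumes sym: "transpose M1 = M1" "transpose M2 = M2" "transpose M3 = M3"
    and smooth: "smooth_plane_quartic M1 M2 M3" and z: "norm z = 1"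
  obtains y where "norm y = 1" "y \<bullet> z = 0" "quartic M1 M2 M3 y \<noteq> 0"
proof -
  obtain y0 where y0: "y0 \<noteq> 0" "orthogonal z y0" using orthogonal_to_vector_exists[of z] by auto
  define y where "y = y0 /\<^sub>R norm y0"
  have y: "norm y = 1" "y \<bullet> z = 0" using y0 by (simp_all add: y_def orthogonal_def inner_commute)
  obtain x where "frame x y z" using frame_exists[OF y(1) z y(2)] .
  then interpret frame x y z .
  have "\<exists>a b. a^2 + b^2 = 1 \<and> quartic M1 M2 M3 (a *s x + b *s y) \<noteq> 0"
  proof (rule ccontr)
    assume "\<not> ?thesis"
    then have van1: "quartic M1 M2 M3 (a *s x + b *s y) = 0" if "a^2 + b^2 = 1" for a b using that by blast
    have van: "quartic M1 M2 M3 (a *s x + b *s y) = 0" for a b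
    proof (cases "a^2 + b^2 = 0")
      case True
      then have "a = 0" "b = 0" by (simp_all add: sum_power2_eq_zero_iff)
      then show ?thesis by (simp add: quartic_def qform_def)
    next
      case False
      define r where "r = sqrt (a^2 + b^2)"
      have r2: "r^2 = a^2 + b^2" and r: "r \<noteq> 0" using False by (simp_all add: r_def)
      have "(a/r)^2 + (b/r)^2 = 1" 
        unfolding power_divide add_divide_distrib[symmetric] r2[symmetric] using r by simp
      moreover have "a *s x + b *s y = r *s ((a/r) *s x + (b/r) *s y)" using r by (simp add: vector_add_ldistrib)
      ultimately show ?thesis using van1[of "a/r" "b/r"] by (simp only: quartic_scale)
    qed
    let ?g = "\<lambda>w. dquartic M1 M2 M3 w z"
    have "continuous_on (sphere 0 1) ?g"
      unfolding dquartic_def by (intro continuous_intros continuous_polar continuous_qform)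
    moreover have "?g (- w) = - ?g w" for w
      using dquartic_scale[of M1 M2 M3 "-1" w z] by simp
    ultimately obtain a b where ab: "a^2 + b^2 = 1" "?g (a *s x + b *s y) = 0"
      using odd_function_zero[OF _ _ unit(1,2) orth(1)] by metis
    let ?w = "a *s x + b *s y"
    have zero: "dquartic M1 M2 M3 ?w v = 0" if v: "\<And>h. quartic M1 M2 M3 (?w + h *s v) = 0" for v
    proof -
      have "((\<lambda>h. quartic M1 M2 M3 (?w + h *s v)) has_field_derivative 2 * dquartic M1 M2 M3 ?w v) (at 0)"
        by (rule has_field_derivative_quartic[OF sym])
      then have "((\<lambda>h. 0) has_field_derivative 2 * dquartic M1 M2 M3 ?w v) (at (0::real))" unfolding v .
      then have "2 * dquartic M1 M2 M3 ?w v = 0" using DERIV_unique[OF _ DERIV_const] by blast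
      then show ?thesis by simp
    qed
    have "?w + h *s x = (a + h) *s x + b *s y" "?w + h *s y = a *s x + (b + h) *s y" for h
      by (simp_all add: vector_sadd_rdistrib)
    then have dxy: "dquartic M1 M2 M3 ?w x = 0" "dquartic M1 M2 M3 ?w y = 0" using van by (intro zero; simp only:)+
    have expand: "v = (x \<bullet> v) *s x + (y \<bullet> v) *s y + (z \<bullet> v) *s z" for v
    proof (unfold vec_eq_iff, rule allI)
      fix i
      have "v$i = (\<Sum>j\<in>UNIV. (x$i * x$j + y$i * y$j + z$i * z$j) * v$j)"
        unfolding complete by (simp add: if_distrib[of "\<lambda>c. c * _"] cong: if_cong)
      also have "\<dots> = ((x \<bullet> v) *s x + (y \<bullet> v) *s y + (z \<bullet> v) *s z)$i"
        by (simp add: inner_vec_def sum_3 algebra_simps)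
      finally show "v$i = ((x \<bullet> v) *s x + (y \<bullet> v) *s y + (z \<bullet> v) *s z)$i" .
    qed
    have "dquartic M1 M2 M3 ?w v = 0" for v
      using arg_cong[OF expand[of v], of "dquartic M1 M2 M3 ?w"] unfolding dquartic_linear dxy ab(2) by simp
    moreover have "?w \<noteq> 0"
    proof
      assume "?w = 0"
      then have "(x \<bullet> ?w)^2 + (y \<bullet> ?w)^2 = 0" by simp
      moreover have "x \<bullet> ?w = a" "y \<bullet> ?w = b" using unit orth
        by (simp_all add: scalar_mult_eq_scaleR inner_add_right norm_eq_1 inner_commute)
      ultimately show False using ab(1) by simp
    qed
    ultimately show False using smooth_gradient_real[OF sym smooth _ van] by blast
  qed
  then obtain a b where ab: "a^2 + b^2 = 1" "quartic M1 M2 M3 (a *s x + b *s y) \<noteq> 0" by blast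
  show ?thesis
  proof (rule that[OF _ _ ab(2)])
    show "(a *s x + b *s y) \<bullet> z = 0" using orth by (simp add: scalar_mult_eq_scaleR inner_add_left)
    have "(a *s x + b *s y) \<bullet> (a *s x + b *s y) = a^2 + b^2" using unit orth
      by (simp add: scalar_mult_eq_scaleR inner_add_left inner_add_right norm_eq_1 inner_commute power2_eq_square)
    then show "norm (a *s x + b *s y) = 1" using ab(1) by (simp add: norm_eq_1)
  qed
qed

lemma on_cover_scale:
  fixes p :: "'a::comm_ring_1^5"
  shows "on_cover M1 M2 M3 p \<Longrightarrow> on_cover M1 M2 M3 (c *s p)"
  by (simp add: on_cover_def uvw_linear qform_scale power2_eq_square mult.assoc mult.left_commute)

context frame
begin

abbreviation line_pt :: "complex \<Rightarrow> complex^3" where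
  "line_pt w \<equiv> cpx.lift x + w *s cpx.lift y"

lemma coord_line_pt: "cpx.coord x (line_pt w) = 1" "cpx.coord y (line_pt w) = w" "cpx.coord z (line_pt w) = 0"
  using unit orth by (simp_all add: cpx.coord_linear coord_lift_inner norm_eq_1 inner_commute)

lemma line_pt_nonzero: "line_pt w \<noteq> 0"
proof
  assume "line_pt w = 0"
  then have "cpx.coord x (line_pt w) = cpx.coord x 0" by simp
  then show False unfolding coord_line_pt by (simp add: cpx.coord_def)
qed

lemma inj_line_pt: "inj (\<lambda>w. pt (line_pt w))"
proof (rule injI)
  fix v w assume "pt (line_pt v) = pt (line_pt w)"
  then obtain c where c: "line_pt v = c *s line_pt w" by (rule pt_eqD)
  have "c = 1" using arg_cong[OF c, of "cpx.coord x"] unfolding cpx.coord_linear(2) coord_line_pt by simp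
  then show "v = w" using arg_cong[OF c, of "cpx.coord y"] unfolding cpx.coord_linear(2) coord_line_pt by simp
qed

lemma line_section_order:
  assumes sym: "transpose M1 = M1" "transpose M2 = M2" "transpose M3 = M3"
    and a: "a = \<mu> *s z" and E: "line_section M1 M2 M3 a E" and nz: "line_poly M1 M2 M3 x y \<noteq> 0"
  shows "count E (pt (line_pt w)) = order w (line_poly M1 M2 M3 x y)"
proof -
  have onl: "(\<Sum>i\<in>UNIV. cvec a $ i * u $ i) = of_real \<mu> * cpx.coord z u" for u
    unfolding a by (simp add: cpx.coord_def sum_distrib_left mult.assoc)
  have cy: "cpx.coord z (cpx.lift y) = 0" using orth by (simp add: coord_lift_inner inner_commute)
  have "cpx.lift y \<notin> vec.span {line_pt w}"
  proof
    assume "cpx.lift y \<in> vec.span {line_pt w}"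
    then obtain c where c: "cpx.lift y = c *s line_pt w" by (auto simp: vec.span_singleton)
    have "cpx.coord x (cpx.lift y) = c"
      using arg_cong[OF c, of "cpx.coord x"] unfolding cpx.coord_linear(2) coord_line_pt by simp
    moreover have "cpx.coord x (cpx.lift y) = 0" using orth by (simp add: coord_lift_inner)
    moreover have "cpx.coord y (cpx.lift y) = 1" using unit by (simp add: coord_lift_inner norm_eq_1)
    ultimately show False
      using arg_cong[OF c, of "cpx.coord y"] unfolding cpx.coord_linear(2) coord_line_pt by simp
  qed
  then have "count E (pt (line_pt w)) = order 0 (quartic (pmat M1) (pmat M2) (pmat M3) (\<chi> i. [:line_pt w$i, cpx.lift y$i:]))"
    using E line_pt_nonzero[of w] unfolding line_section_def Let_def onl
    by (simp add: coord_line_pt cy del: vec_lambda_beta vector_add_component)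
  also have "\<dots> = order w (line_poly M1 M2 M3 x y)"
    unfolding quartic_pmat_line[OF sym] by (rule order_pcompose_shift[OF nz])
  finally show ?thesis .
qed

text \<open>Since \<open>y\<close> lies off the quartic, no point of the cover lies over it, so the
  \<open>x\<close>-coordinate is nonzero and can be scaled to 1.\<close>

lemma cover_point_over_line:
  assumes sym: "transpose M1 = M1" "transpose M2 = M2" "transpose M3 = M3"
    and y: "quartic M1 M2 M3 y \<noteq> 0"
    and p: "p \<noteq> 0" "on_cover (cmat M1) (cmat M2) (cmat M3) p" "cpx.coord z (uvw p) = 0"
  obtains w r s where "pt p = pt (emb5 (line_pt w) r s)" 
    "on_cover (cmat M1) (cmat M2) (cmat M3) (emb5 (line_pt w) r s)"
proof -
  define A B where "A = cpx.coord x (uvw p)" "B = cpx.coord y (uvw p)"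
  have u: "uvw p = A *s cpx.lift x + B *s cpx.lift y"
    using cpx.coord_expand[OF complete, of "uvw p"] unfolding p(3) A_B_def by simp
  have "A \<noteq> 0"
  proof
    assume A: "A = 0"
    have "quartic (cmat M1) (cmat M2) (cmat M3) (uvw p) = 0"
      using p(2) unfolding on_cover_def quartic_def by (simp add: power2_eq_square algebra_simps)
    then have "B ^ 4 * of_real (quartic M1 M2 M3 y) = 0"
      unfolding u A by (simp add: quartic_scale cpx.hom_quartic)
    then have "B = 0" using y by simp
    then have "uvw p = 0" using u A by simp
    moreover from this have "p$4 = 0" "p$5 = 0" using p(2) by (simp_all add: on_cover_def qform_def)
    ultimately have "p = 0" by (simp add: vec_eq_iff forall_5 forall_3 uvw_def)
    then show False using p(1) by simp
  qed
  let ?p = "inverse A *s p"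
  have "uvw ?p = line_pt (B / A)" using \<open>A \<noteq> 0\<close> by (simp add: uvw_linear u divide_inverse mult.commute)
  then have e: "?p = emb5 (line_pt (B / A)) (?p$4) (?p$5)" by (metis emb5_eq)
  have "pt p = pt ?p" using \<open>A \<noteq> 0\<close> by (simp add: pt_scale)
  moreover have "on_cover (cmat M1) (cmat M2) (cmat M3) ?p" by (rule on_cover_scale[OF p(2)])
  ultimately show ?thesis using that e by metis
qed

text \<open>Vanishing to second order of the relation \<open>T = L\<close> at a point of multiplicity two: over a nonreal
  root \<open>T + L\<close> does not vanish, and over a real one \<open>L = 0\<close> and the root is a quadruple one.\<close>

lemma double_point:
  fixes t0 t1 l0 l1 :: real
  assumes sym: "transpose M1 = M1" "transpose M2 = M2" "transpose M3 = M3"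
    and smooth: "smooth_plane_quartic M1 M2 M3"
    and sq: "t0^2 * qform M1 x + 2 * t0 * t1 * qform M2 x + t1^2 * qform M3 x = l0^2"
      "t0^2 * polar M1 x y + 2 * t0 * t1 * polar M2 x y + t1^2 * polar M3 x y = l0 * l1"
      "t0^2 * qform M1 y + 2 * t0 * t1 * qform M2 y + t1^2 * qform M3 y = l1^2"
    and fact: "line_poly M1 M2 M3 x y = smult c ([:-\<alpha>, 1:] * [:-cnj \<alpha>, 1:] * [:-\<alpha>, 1:] * [:-cnj \<alpha>, 1:])"
    and w: "w = \<alpha> \<or> w = cnj \<alpha>"
    and cases: "(\<alpha> \<notin> \<real> \<and> (l0 \<noteq> 0 \<or> l1 \<noteq> 0)) \<or> (\<alpha> \<in> \<real> \<and> l0 = 0 \<and> l1 = 0)"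
    and rel: "of_real t0 * r + of_real t1 * s = of_real l0 + of_real l1 * w"
    and lp: "local_param M1 M2 M3 p \<gamma>" and p: "p = \<mu> *s emb5 (line_pt w) r s" "\<mu> \<noteq> 0"
    and k: "k < 2"
  defines "T \<equiv> fps_const (of_real t0) * \<gamma>$4 + fps_const (of_real t1) * \<gamma>$5"
    and "L \<equiv> fps_const (of_real l0) * fps.coord x (uvw \<gamma>) + fps_const (of_real l1) * fps.coord y (uvw \<gamma>)"
  shows "fps_nth (fps.coord z (uvw \<gamma>)) k = 0" "fps_nth (T - L) k = 0"
proof -
  define A B C where "A = fps.coord x (uvw \<gamma>)" "B = fps.coord y (uvw \<gamma>)" "C = fps.coord z (uvw \<gamma>)"
  note ABC = this
  have p0: "(\<chi> i. fps_nth (\<gamma>$i) 0) = p" using lp unfolding local_param_def Let_def by blast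
  have up: "uvw p = \<mu> *s line_pt w" unfolding p(1) by (simp only: uvw_linear uvw_emb5)
  have A0: "fps_nth A 0 = \<mu>" and B0: "fps_nth B 0 = \<mu> * w"
    unfolding ABC fps_coord_nth0 p0 up cpx.coord_linear(2) coord_line_pt by simp_all
  have g0: "fps_nth (\<gamma>$4) 0 = \<mu> * r" "fps_nth (\<gamma>$5) 0 = \<mu> * s"
    using arg_cong[OF p0, of "\<lambda>v. v$4"] arg_cong[OF p0, of "\<lambda>v. v$5"] unfolding p(1) by simp_all
  have T0: "fps_nth T 0 = \<mu> * (of_real l0 + of_real l1 * w)"
    unfolding T_def rel[symmetric] by (simp add: g0 algebra_simps)
  have L0: "fps_nth L 0 = \<mu> * (of_real l0 + of_real l1 * w)"
    unfolding L_def ABC[symmetric] by (simp add: A0 B0 algebra_simps)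
  have root: "poly (line_poly M1 M2 M3 x y) w = 0" "poly (pderiv (line_poly M1 M2 M3 x y)) w = 0"
    unfolding fact pderiv_smult pderiv_mult poly_smult poly_mult poly_add using w by auto
  let ?F = "\<lambda>v. B - fps_const v * A"
  have Xw: "fps_X dvd ?F w" by (rule fps_X_power_dvd_linear) (simp add: A0 B0)
  have order: "fps_X ^ n dvd C" if "fps_X ^ n dvd ?F \<alpha> * ?F (cnj \<alpha>) * ?F \<alpha> * ?F (cnj \<alpha>)" for n
    unfolding ABC by (rule normal_coord_order[OF sym smooth fact root(2,1) lp up p(2) ABC(1,2) that])
  have CT: "C dvd (T - L) * (T + L)"
    unfolding ABC T_def L_def by (rule relation_product[OF sym sq lp])
  have "fps_X ^ 2 dvd C \<and> fps_X ^ 2 dvd T - L"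
    using cases
  proof
    assume nr: "\<alpha> \<notin> \<real> \<and> (l0 \<noteq> 0 \<or> l1 \<noteq> 0)"
    have "fps_X * fps_X dvd ?F w * ?F w" using Xw by (rule mult_dvd_mono) (rule Xw)
    moreover have "?F \<alpha> * ?F (cnj \<alpha>) * ?F \<alpha> * ?F (cnj \<alpha>) = (?F \<alpha> * ?F \<alpha>) * (?F (cnj \<alpha>) * ?F (cnj \<alpha>))"
      by (simp only: ac_simps)
    ultimately have "fps_X ^ 2 dvd ?F \<alpha> * ?F (cnj \<alpha>) * ?F \<alpha> * ?F (cnj \<alpha>)"
      using w by (auto simp only: power2_eq_square intro: dvd_mult dvd_mult2)
    then have C2: "fps_X ^ 2 dvd C" by (rule order)
    have "w \<notin> \<real>" using w nr by (metis Reals_cnj_iff complex_cnj_cnj)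
    then have "of_real l0 + of_real l1 * w \<noteq> 0" using nonreal_linear_form nr by blast
    then have "fps_nth (T + L) 0 \<noteq> 0" using T0 L0 p(2) by simp
    then have "fps_X ^ 2 dvd T - L" using fps_X_power_dvd_mult_unit dvd_trans[OF C2 CT] by blast
    then show ?thesis using C2 by blast
  next
    assume re: "\<alpha> \<in> \<real> \<and> l0 = 0 \<and> l1 = 0"
    then have cn: "cnj \<alpha> = \<alpha>" "w = \<alpha>" using w by (auto simp: Reals_cnj_iff)
    have "fps_X * fps_X dvd ?F \<alpha> * ?F \<alpha>" using Xw cn by (intro mult_dvd_mono) auto
    then have "(fps_X * fps_X) * fps_X dvd ?F \<alpha> * ?F \<alpha> * ?F \<alpha>" using Xw cn by (intro mult_dvd_mono) auto
    then have "(fps_X * fps_X) * fps_X * fps_X dvd ?F \<alpha> * ?F \<alpha> * ?F \<alpha> * ?F \<alpha>" using Xw cn by (intro mult_dvd_mono) auto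
    then have C4: "fps_X ^ 4 dvd C" using order[of 4] cn by (simp add: power4_eq_xxxx)
    \<comment> \<open>Here L = 0, so the fourfold zero of \<open>C\<close> passes to
      \<open>T^2\<close>, and \<open>T\<close> vanishes to order two.\<close>
    then have "fps_X ^ 4 dvd (T - L) * (T + L)" using CT dvd_trans by blast
    moreover have L: "L = 0" using re by (simp add: L_def)
    ultimately have T4: "fps_X ^ 4 dvd T * T" by simp
    have T0': "fps_nth T 0 = 0" using T0 re by simp
    have "fps_nth (T * T) 2 = fps_nth T 1 * fps_nth T 1"
      using T0' by (simp add: fps_mult_nth numeral_2_eq_2)
    then have "fps_nth T 1 = 0" using fps_X_power_dvd_nth[OF T4, of 2] by simp
    have "fps_nth T n = fps_nth (fps_X ^ 2 * fps_shift 2 T) n" for n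
    proof (cases "n < 2")
      case True
      then show ?thesis using T0' \<open>fps_nth T 1 = 0\<close> by (auto simp: fps_X_power_mult_nth less_2_cases_iff)
    next
      case False
      then have "Suc (Suc (n - 2)) = n" by arith
      then show ?thesis using False by (simp add: fps_X_power_mult_nth)
    qed
    then have "T = fps_X ^ 2 * fps_shift 2 T" by (rule fps_ext)
    then have "fps_X ^ 2 dvd T" by (metis dvd_triv_left)
    moreover have "fps_X ^ 2 dvd C" using C4 by (rule power_le_dvd) simp
    ultimately show ?thesis using L by simp
  qed
  then show "fps_nth (fps.coord z (uvw \<gamma>)) k = 0" "fps_nth (T - L) k = 0"
    using fps_X_power_dvd_nth[OF _ k] unfolding ABC by blast+
qed

end

section \<open>Planarity of the real divisors\<close>

lemma count_distinct_le_1: "distinct [a, b, c, d] \<Longrightarrow> count {#a, b, c, d#} q \<le> 1"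
  by auto

text \<open>As \<open>y\<close> is off the quartic the restriction has degree exactly four, so no
  intersection is lost in the affine coordinate and the section prescribes the multiset of
  roots.\<close>

lemma (in frame) real_line_poly_roots:
  assumes sym: "transpose M1 = M1" "transpose M2 = M2" "transpose M3 = M3"
    and y: "quartic M1 M2 M3 y \<noteq> 0" and a: "a = \<mu> *s z"
    and E: "line_section M1 M2 M3 a (image_mset (\<lambda>w. pt (line_pt w)) {#a1, a2, a3, a4#})"
  shows "line_poly M1 M2 M3 x y
    = smult (of_real (quartic M1 M2 M3 y)) ([:-a1, 1:] * [:-a2, 1:] * [:-a3, 1:] * [:-a4, 1:])"
proof -
  let ?p = "line_poly M1 M2 M3 x y"
  obtain e0 e1 e2 e3 where p: "?p = [:e0, e1, e2, e3, of_real (quartic M1 M2 M3 y):]"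
  proof -
    have "\<exists>e0 e1 e2 e3. ?p = [:e0, e1, e2, e3, of_real (quartic M1 M2 M3 y):]"
      unfolding line_poly_def quartic_def by (simp add: power2_eq_square mult.commute)
    then show ?thesis using that by blast
  qed
  then have nz: "?p \<noteq> 0" and lead: "lead_coeff ?p = of_real (quartic M1 M2 M3 y)" using y by auto
  have "proots ?p = {#a1, a2, a3, a4#}"
  proof (rule multiset_eqI)
    fix w
    have "count (proots ?p) w = count (image_mset (\<lambda>w. pt (line_pt w)) {#a1, a2, a3, a4#}) (pt (line_pt w))"
      using line_section_order[OF sym a E nz, of w] nz by simp
    also have "\<dots> = count {#a1, a2, a3, a4#} w"
    proof -
      have "pt (line_pt v) = pt (line_pt w) \<longleftrightarrow> v = w" for v using inj_line_pt by (metis injD)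
      then show ?thesis by (simp del: vec_lambda_beta)
    qed
    finally show "count (proots ?p) w = count {#a1, a2, a3, a4#} w" .
  qed
  then show ?thesis using complex_poly_decompose_multiset[of ?p] unfolding lead
    by (simp only: image_mset_add_mset image_mset_empty prod_mset.add_mset prod_mset_empty mult_1_right mult.assoc)
qed

lemma divisors_planar:
  assumes sym: "transpose M1 = M1" "transpose M2 = M2" "transpose M3 = M3"
    and smooth: "smooth_plane_quartic M1 M2 M3"
    and neg: "\<And>u. u \<noteq> 0 \<Longrightarrow> \<nu>0^2 * qform M1 u + 2 * \<nu>0 * \<nu>1 * qform M2 u + \<nu>1^2 * qform M3 u < 0"
    and line: "\<And>a. a \<noteq> 0 \<Longrightarrow> \<exists>u. u \<noteq> 0 \<and> a \<bullet> u = 0 \<and> quartic M1 M2 M3 u < 0"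
  shows "Ptilde1_real_divisors M1 M2 M3 = {}"
proof (rule equals0I)
  fix D assume "D \<in> Ptilde1_real_divisors M1 M2 M3"
  then obtain a where size: "size D = 4" and cover: "set_mset D \<subseteq> cover_points M1 M2 M3"
    and conj: "image_mset conj_pt D = D" and a: "a \<noteq> 0"
    and sec: "line_section M1 M2 M3 a (image_mset ((`) uvw) D)"
    and nonplanar: "\<not> contained_in_plane M1 M2 M3 D"
    unfolding Ptilde1_real_divisors_def by blast
  define z where "z = a /\<^sub>R norm a"
  have z: "norm z = 1" "a = norm a *s z" using a by (simp_all add: z_def scalar_mult_eq_scaleR)
  obtain y where y: "norm y = 1" "y \<bullet> z = 0" "quartic M1 M2 M3 y \<noteq> 0"
    using smooth_contains_no_line[OF sym smooth z(1)] .
  obtain x where "frame x y z" using frame_exists[OF y(1) z(1) y(2)] .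
  then interpret frame x y z .
  let ?F = "on_cover (cmat M1) (cmat M2) (cmat M3)"
  define rep where "rep P T \<longleftrightarrow> (case T of (w, r, s) \<Rightarrow> P = pt (emb5 (line_pt w) r s) \<and> ?F (emb5 (line_pt w) r s))"
    for P T
  have "\<exists>T. rep P T" if P: "P \<in># D" for P
  proof -
    obtain p where p: "P = pt p" "p \<noteq> 0" "?F p" using P cover by (auto simp: cover_points_def)
    have "pt (uvw p) \<in># image_mset ((`) uvw) D" using P unfolding p(1) uvw_pt[symmetric] by auto
    then obtain u where u: "(\<Sum>i\<in>UNIV. cvec a $ i * u $ i) = 0" "pt (uvw p) = pt u"
      using sec unfolding line_section_def Let_def by blast
    obtain c where c: "uvw p = c *s u" using pt_eqD[OF u(2)] .
    have "(\<Sum>i\<in>UNIV. cvec a $ i * u $ i) = of_real (norm a) * cpx.coord z u"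
      by (subst z(2)) (simp add: cpx.coord_def sum_distrib_left mult.assoc)
    then have "cpx.coord z u = 0" using u(1) a by simp
    then have "cpx.coord z (uvw p) = 0" unfolding c by (simp add: cpx.coord_linear)
    then obtain w r s where "pt p = pt (emb5 (line_pt w) r s)" "?F (emb5 (line_pt w) r s)"
      using cover_point_over_line[OF sym y(3) p(2,3)] by metis
    then have "rep P (w, r, s)" using p(1) by (simp add: rep_def)
    then show ?thesis ..
  qed
  \<comment> \<open>One choice of coordinates for each point: equal points of the divisor get equal
    lifts, as needed for R = P.\<close>
  then obtain \<tau> where \<tau>: "\<And>P. P \<in># D \<Longrightarrow> rep P (\<tau> P)" by metis
  obtain P R where D: "D = {#P, conj_pt P, R, conj_pt R#}" and RP: "R \<noteq> conj_pt P"
  proof (rule real_divisor_cases[OF size conj conj_pt_invol])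
    show "conj_pt Q \<noteq> Q" if "Q \<in># D" for Q
      using cover_no_real_point[OF sym neg] that cover by blast
  qed
  obtain \<alpha> r s where \<tau>P: "\<tau> P = (\<alpha>, r, s)" by (metis prod_cases3)
  obtain \<beta> r' s' where \<tau>R: "\<tau> R = (\<beta>, r', s')" by (metis prod_cases3)
  have P: "P = pt (emb5 (line_pt \<alpha>) r s)" "?F (emb5 (line_pt \<alpha>) r s)"
    using \<tau>[of P] \<tau>P D by (simp_all add: rep_def del: vec_lambda_beta)
  have R: "R = pt (emb5 (line_pt \<beta>) r' s')" "?F (emb5 (line_pt \<beta>) r' s')"
    using \<tau>[of R] \<tau>R D by (simp_all add: rep_def del: vec_lambda_beta)
  have cnj_emb: "cnjv (emb5 (line_pt w) q t) = emb5 (line_pt (cnj w)) (cnj q) (cnj t)" for w q t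
    by (simp add: vec_eq_iff forall_5)
  have cP: "conj_pt P = pt (emb5 (line_pt (cnj \<alpha>)) (cnj r) (cnj s))" 
    unfolding P(1) conj_pt cnj_emb ..
  have cR: "conj_pt R = pt (emb5 (line_pt (cnj \<beta>)) (cnj r') (cnj s'))"
    unfolding R(1) conj_pt cnj_emb ..
  have img: "image_mset ((`) uvw) D = image_mset (\<lambda>w. pt (line_pt w)) {#\<alpha>, cnj \<alpha>, \<beta>, cnj \<beta>#}"
    unfolding D cP cR by (simp add: P(1) R(1) uvw_pt del: vec_lambda_beta)
  define c where "c = quartic M1 M2 M3 y"
  have fact: "line_poly M1 M2 M3 x y = smult (of_real c) ([:-\<alpha>, 1:] * [:-cnj \<alpha>, 1:] * [:-\<beta>, 1:] * [:-cnj \<beta>, 1:])"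
    unfolding c_def by (rule real_line_poly_roots[OF sym y(3) z(2) sec[unfolded img]])
  let ?b1 = "binform (qform M1 x) (polar M1 x y) (qform M1 y)"
    and ?b2 = "binform (qform M2 x) (polar M2 x y) (qform M2 y)"
    and ?b3 = "binform (qform M3 x) (polar M3 x y) (qform M3 y)"
  have qb: "qform M1 (A *s x + B *s y) = ?b1 A B" "qform M2 (A *s x + B *s y) = ?b2 A B"
    "qform M3 (A *s x + B *s y) = ?b3 A B" for A B
    using sym by (simp_all add: qform_lincomb)
  have real_fact: "?b1 A B * ?b3 A B - (?b2 A B)^2
      = c * (cmod (of_real B - \<alpha> * of_real A))^2 * (cmod (of_real B - \<beta> * of_real A))^2" for A B
  proof -
    have cb: "complex_of_real (binform k m n A B) = binform (of_real k) (of_real m) (of_real n) (of_real A) (of_real B)" for k m n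
      by (simp add: binform_def)
    have "complex_of_real (?b1 A B * ?b3 A B - (?b2 A B)^2) = of_real c * ((of_real B - \<alpha> * of_real A) * (of_real B - cnj \<alpha> * of_real A)
        * (of_real B - \<beta> * of_real A) * (of_real B - cnj \<beta> * of_real A))"
      unfolding of_real_diff of_real_mult of_real_power cb
      using fact[unfolded line_poly_def] cid.ring_hom_pair_axioms by (rule binform_factorization)
    also have "\<dots> = of_real c * (of_real ((cmod (of_real B - \<alpha> * of_real A))^2) * of_real ((cmod (of_real B - \<beta> * of_real A))^2))"
      unfolding complex_norm_square by (simp add: mult.assoc)
    also have "\<dots> = of_real (c * (cmod (of_real B - \<alpha> * of_real A))^2 * (cmod (of_real B - \<beta> * of_real A))^2)"
      by (simp only: of_real_mult mult.assoc)
    finally show ?thesis by (simp only: of_real_eq_iff)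
  qed
  \<comment> \<open>On the line the quartic is \<open>c\<close> times squares of absolute values, so
    one negative value fixes the sign.\<close>
  have c: "c < 0"
  proof -
    obtain u where u: "u \<noteq> 0" "a \<bullet> u = 0" "quartic M1 M2 M3 u < 0" using line[OF a] by blast
    have "z \<bullet> u = 0" using u(2) by (simp add: z_def)
    moreover have "u = (x \<bullet> u) *s x + (y \<bullet> u) *s y + (z \<bullet> u) *s z"
    proof (unfold vec_eq_iff, rule allI)
      fix i
      have "u$i = (\<Sum>j\<in>UNIV. (x$i * x$j + y$i * y$j + z$i * z$j) * u$j)"
        unfolding complete by (simp add: if_distrib[of "\<lambda>c. c * _"] cong: if_cong)
      also have "\<dots> = ((x \<bullet> u) *s x + (y \<bullet> u) *s y + (z \<bullet> u) *s z)$i"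
        by (simp add: inner_vec_def sum_3 algebra_simps)
      finally show "u$i = ((x \<bullet> u) *s x + (y \<bullet> u) *s y + (z \<bullet> u) *s z)$i" .
    qed
    ultimately have "u = (x \<bullet> u) *s x + (y \<bullet> u) *s y" by simp
    then have "quartic M1 M2 M3 ((x \<bullet> u) *s x + (y \<bullet> u) *s y) < 0" using u(3) by metis
    then have "c * (cmod (of_real (y \<bullet> u) - \<alpha> * of_real (x \<bullet> u)))^2 * (cmod (of_real (y \<bullet> u) - \<beta> * of_real (x \<bullet> u)))^2 < 0"
      unfolding quartic_def qb real_fact .
    then show ?thesis by (metis not_less mult_nonneg_nonneg zero_le_power2)
  qed
  have at: "cbin (qform M x) (polar M x y) (qform M y) w = qform (cmat M) (line_pt w)"
    if "transpose M = M" for M w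
    using qform_lincomb[OF cpx.hom_transpose[OF that], of 1 "cpx.lift x" w "cpx.lift y"]
    by (simp add: cpx.hom_qform cpx.hom_polar)
  have cov: "qform (cmat M1) (line_pt w) = q^2" "qform (cmat M2) (line_pt w) = q * t" "qform (cmat M3) (line_pt w) = t^2"
    if "?F (emb5 (line_pt w) q t)" for w q t
    using that unfolding on_cover_def uvw_emb5 by simp_all
  have nontriv: "q \<noteq> 0 \<or> t \<noteq> 0" if "?F (emb5 (line_pt w) q t)" for w q t
  proof (rule ccontr)
    assume "\<not> ?thesis"
    then have zero: "qform (cmat M1) (line_pt w) = 0" "qform (cmat M2) (line_pt w) = 0" "qform (cmat M3) (line_pt w) = 0"
      using cov[OF that] by auto
    then have "quartic (cmat M1) (cmat M2) (cmat M3) (line_pt w) = 0"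
      unfolding quartic_def by simp
    from smooth_gradient[OF sym smooth line_pt_nonzero this] show False
      unfolding dquartic_def zero by auto
  qed
  have neg': "\<nu>0^2 * ?b1 A B + 2 * \<nu>0 * \<nu>1 * ?b2 A B + \<nu>1^2 * ?b3 A B < 0" if "A \<noteq> 0 \<or> B \<noteq> 0" for A B
  proof -
    have "x \<bullet> (A *s x + B *s y) = A" "y \<bullet> (A *s x + B *s y) = B" using unit orth
      by (simp_all add: scalar_mult_eq_scaleR inner_add_right norm_eq_1 inner_commute)
    then have "A *s x + B *s y \<noteq> 0" using that by auto
    from neg[OF this] show ?thesis unfolding qb .
  qed
  obtain t0 t1 l0 l1 :: real where t: "t0 \<noteq> 0 \<or> t1 \<noteq> 0"
    and sq: "t0^2 * qform M1 x + 2 * t0 * t1 * qform M2 x + t1^2 * qform M3 x = l0^2"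
      "t0^2 * polar M1 x y + 2 * t0 * t1 * polar M2 x y + t1^2 * polar M3 x y = l0 * l1"
      "t0^2 * qform M1 y + 2 * t0 * t1 * qform M2 y + t1^2 * qform M3 y = l1^2"
    and relP: "of_real t0 * r + of_real t1 * s = of_real l0 + of_real l1 * \<alpha>"
    and relR: "of_real t0 * r' + of_real t1 * s' = of_real l0 + of_real l1 * \<beta>"
    and dbl: "\<alpha> = \<beta> \<and> r = r' \<and> s = s' \<longrightarrow> (\<alpha> \<notin> \<real> \<and> (l0 \<noteq> 0 \<or> l1 \<noteq> 0)) \<or> (\<alpha> \<in> \<real> \<and> l0 = 0 \<and> l1 = 0)"
    by (rule real_plane_through_conjugate_lifts[OF neg' real_fact c
        cov(1)[OF P(2), folded at[OF sym(1)]] cov(2)[OF P(2), folded at[OF sym(2)]] cov(3)[OF P(2), folded at[OF sym(3)]]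
        cov(1)[OF R(2), folded at[OF sym(1)]] cov(2)[OF R(2), folded at[OF sym(2)]] cov(3)[OF R(2), folded at[OF sym(3)]]
        nontriv[OF P(2)] nontriv[OF R(2)]])
  have cnj_rel: "of_real t0 * cnj q + of_real t1 * cnj t = of_real l0 + of_real l1 * cnj w"
    if "of_real t0 * q + of_real t1 * t = of_real l0 + of_real l1 * w" for q t w
    using arg_cong[OF that, of cnj] by simp
  \<comment> \<open>The relation has real coefficients, so it passes to the conjugate
    points.\<close>
  have on_D: "\<exists>w q t. Q = pt (emb5 (line_pt w) q t) \<and> of_real t0 * q + of_real t1 * t = of_real l0 + of_real l1 * w
      \<and> (Q = P \<or> Q = conj_pt P \<longrightarrow> w = \<alpha> \<or> w = cnj \<alpha>)" if "Q \<in># D" for Q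
  proof -
    consider "Q = P" | "Q = conj_pt P" | "Q = R" "Q \<noteq> P" "Q \<noteq> conj_pt P" | "Q = conj_pt R" "Q \<noteq> P" "Q \<noteq> conj_pt P"
      using \<open>Q \<in># D\<close> unfolding D by auto
    then show ?thesis
      using P(1) R(1) cP cR relP relR cnj_rel[OF relP] cnj_rel[OF relR] by cases blast+
  qed
  have "contained_in_plane M1 M2 M3 D"
  proof (rule contained_in_plane_relation[OF t])
    fix p \<gamma> k assume lp: "local_param M1 M2 M3 p \<gamma>" and k: "k < count D (pt p)"
    have pD: "pt p \<in># D" using k by (metis count_greater_zero_iff le_less_trans zero_le)
    obtain w q t where Q: "pt p = pt (emb5 (line_pt w) q t)"
      and rel: "of_real t0 * q + of_real t1 * t = of_real l0 + of_real l1 * w"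
      and w: "pt p = P \<or> pt p = conj_pt P \<longrightarrow> w = \<alpha> \<or> w = cnj \<alpha>"
      using on_D[OF pD] by blast
    obtain \<mu> where \<mu>: "p = \<mu> *s emb5 (line_pt w) q t" using pt_eqD[OF Q] .
    have p0: "(\<chi> i. fps_nth (\<gamma>$i) 0) = p" and "p \<noteq> 0" using lp unfolding local_param_def Let_def by blast+
    then have \<mu>0: "\<mu> \<noteq> 0" using \<mu> by auto
    let ?U = "fps_const (of_real t0) * \<gamma>$4 + fps_const (of_real t1) * \<gamma>$5 -
        (fps_const (of_real l0) * fps.coord x (uvw \<gamma>) + fps_const (of_real l1) * fps.coord y (uvw \<gamma>))"
    show "fps_nth (fps.coord z (uvw \<gamma>)) k = 0 \<and> fps_nth ?U k = 0"
    proof (cases "k = 0")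
      case True
      have up: "uvw p = \<mu> *s line_pt w" unfolding \<mu> by (simp only: uvw_linear uvw_emb5)
      have g0: "fps_nth (\<gamma>$4) 0 = \<mu> * q" "fps_nth (\<gamma>$5) 0 = \<mu> * t"
        using arg_cong[OF p0, of "\<lambda>v. v$4"] arg_cong[OF p0, of "\<lambda>v. v$5"] unfolding \<mu> by simp_all
      have xy0: "fps_nth (fps.coord x (uvw \<gamma>)) 0 = \<mu>" "fps_nth (fps.coord y (uvw \<gamma>)) 0 = \<mu> * w"
        unfolding fps_coord_nth0 p0 up cpx.coord_linear(2) coord_line_pt by simp_all
      have "fps_nth ?U 0 = \<mu> * (of_real t0 * q + of_real t1 * t - (of_real l0 + of_real l1 * w))"
        by (simp add: g0 xy0 algebra_simps)
      then have "fps_nth ?U 0 = 0" unfolding rel by simp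
      moreover have "fps_nth (fps.coord z (uvw \<gamma>)) 0 = 0"
        unfolding fps_coord_nth0 p0 up cpx.coord_linear(2) coord_line_pt by simp
      ultimately show ?thesis unfolding True by blast
    next
      \<comment> \<open>A positive \<open>k\<close> requires a repeated point. As P and R are not
        real and R is not conj P, this means R = P, and the multiplicity is two.\<close>
      case False
      have inv: "conj_pt (conj_pt Q) = Q" for Q :: "(complex^5) set" by (rule conj_pt_invol)
      have PcP: "P \<noteq> conj_pt P" using cover_no_real_point[OF sym neg, of P] cover unfolding D by auto
      have RcR: "R \<noteq> conj_pt R" using cover_no_real_point[OF sym neg, of R] cover unfolding D by auto
      have eq: "R = P"
      proof (rule ccontr)
        assume "R \<noteq> P"
        then have "conj_pt R \<noteq> conj_pt P" "conj_pt R \<noteq> P" using RP inv by metis+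
        then have "distinct [P, conj_pt P, R, conj_pt R]" using \<open>R \<noteq> P\<close> RP PcP RcR by (simp add: not_sym)
        then have "count D (pt p) \<le> 1" unfolding D by (rule count_distinct_le_1)
        then show False using k False by simp
      qed
      then have same: "\<alpha> = \<beta>" "r = r'" "s = s'" using \<tau>P \<tau>R by auto
      have k2: "k < 2" using k PcP unfolding D eq by (auto split: if_splits)
      have "pt p = P \<or> pt p = conj_pt P" using pD unfolding D eq by auto
      then have w': "w = \<alpha> \<or> w = cnj \<alpha>" using w by blast
      have cases: "(\<alpha> \<notin> \<real> \<and> (l0 \<noteq> 0 \<or> l1 \<noteq> 0)) \<or> (\<alpha> \<in> \<real> \<and> l0 = 0 \<and> l1 = 0)"
        using dbl same by simp
      show ?thesis
        by (intro conjI double_point[OF sym smooth sq fact[folded same] w' cases rel lp \<mu> \<mu>0 k2])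
    qed
  qed
  then show False using nonplanar by blast
qed

section \<open>The real projective plane and nested ovals\<close>

abbreviation PP :: "(real^3) set topology" where "PP \<equiv> real_projective_plane"

lemma openin_PP: "openin PP U \<longleftrightarrow> U \<subseteq> pt ` (UNIV - {0}) \<and> open {x. x \<noteq> 0 \<and> pt x \<in> U}"
proof -
  have "{x \<in> UNIV - {0}. pt x \<in> U} = {x. x \<noteq> 0 \<and> pt x \<in> U}" by auto
  moreover have "openin (top_of_set (UNIV - {0})) V \<longleftrightarrow> open V \<and> V \<subseteq> UNIV - {0}" for V :: "(real^3) set"
    by (rule openin_open_eq) (simp add: open_delete)
  ultimately show ?thesis
    unfolding real_projective_plane_def openin_quotient_topology by auto
qed

lemma quotient_map_pt: "quotient_map (top_of_set (UNIV - {0})) PP pt"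
  unfolding real_projective_plane_def by (rule quotient_map_quotient_topology)

lemma topspace_PP: "topspace PP = pt ` (UNIV - {0})"
  using quotient_imp_surjective_map[OF quotient_map_pt] by simp

lemma pt_in_PP: "x \<noteq> 0 \<Longrightarrow> pt x \<in> topspace PP"
  by (simp add: topspace_PP)

lemma PP_cases:
  assumes "P \<in> topspace PP" obtains x where "x \<noteq> 0" "P = pt x"
  using assms by (auto simp: topspace_PP)

lemma continuous_map_pt: "continuous_map (top_of_set (UNIV - {0})) PP pt"
  by (rule quotient_imp_continuous_map[OF quotient_map_pt])

lemma pt_eq_iff:
  assumes "x \<noteq> 0" "y \<noteq> 0"
  shows "pt x = pt y \<longleftrightarrow> (\<exists>c. c \<noteq> 0 \<and> x = c *s y)"
proof
  assume "pt x = pt y"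
  then obtain c where "x = c *s y" by (rule pt_eqD)
  then show "\<exists>c. c \<noteq> 0 \<and> x = c *s y" using assms(1) by auto
qed (auto simp: pt_scale)

lemma connectedin_pt_image:
  assumes "connected C" "0 \<notin> C"
  shows "connectedin PP (pt ` C)"
  by (rule connectedin_continuous_map_image[OF continuous_map_pt])
    (use assms in \<open>auto simp: connectedin_subtopology\<close>)

definition hset :: "(real^3 \<Rightarrow> bool) \<Rightarrow> (real^3) set set" where
  "hset Q = pt ` {x. x \<noteq> 0 \<and> Q x}"

definition homog :: "(real^3 \<Rightarrow> bool) \<Rightarrow> bool" where
  "homog Q \<longleftrightarrow> (\<forall>c x. c \<noteq> 0 \<longrightarrow> Q (c *s x) = Q x)"

lemma pt_in_hset: "homog Q \<Longrightarrow> x \<noteq> 0 \<Longrightarrow> pt x \<in> hset Q \<longleftrightarrow> Q x"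
  unfolding hset_def homog_def by (auto simp: pt_eq_iff)

lemma hset_subset: "hset Q \<subseteq> topspace PP"
  by (auto simp: hset_def topspace_PP)

lemma openin_hset:
  assumes "homog Q" "open {x. Q x}"
  shows "openin PP (hset Q)"
proof -
  have "{x. x \<noteq> 0 \<and> pt x \<in> hset Q} = {x. Q x} - {0}" using assms(1) by (auto simp: pt_in_hset)
  then show ?thesis
    using assms(2) hset_subset unfolding openin_PP topspace_PP by (simp add: open_delete)
qed

text \<open>The orthogonal projector onto the line spanned by \<open>x\<close> depends only on the point of the
  projective plane, and embeds the latter into the space of matrices.\<close>

definition projector :: "real^3 \<Rightarrow> real^3^3" where
  "projector x = (\<chi> i j. x$i * x$j / (x \<bullet> x))"

definition PP_projector :: "(real^3) set \<Rightarrow> real^3^3" where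
  "PP_projector P = projector (SOME x. x \<noteq> 0 \<and> pt x = P)"

lemma projector_scale: "c \<noteq> 0 \<Longrightarrow> projector (c *s x) = projector x"
  by (simp add: projector_def vec_eq_iff scalar_mult_eq_scaleR)

lemma PP_projector_pt: "x \<noteq> 0 \<Longrightarrow> PP_projector (pt x) = projector x"
  unfolding PP_projector_def
  by (rule someI2[of _ x]) (auto simp: pt_eq_iff projector_scale)

lemma projector_apply: "projector x *v v = ((x \<bullet> v) / (x \<bullet> x)) *s x"
  by (simp add: projector_def matrix_vector_mult_def vec_eq_iff inner_vec_def sum_divide_distrib sum_distrib_right
      sum_distrib_left mult.commute mult.left_commute)

lemma continuous_PP_projector: "continuous_map PP euclidean PP_projector"
proof -
  have "continuous_on (UNIV - {0}) projector"
    unfolding projector_def by (intro continuous_intros) auto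
  then have "continuous_on (UNIV - {0}) (PP_projector \<circ> pt)"
    by (rule continuous_on_cong[THEN iffD1, rotated -1]) (auto simp: PP_projector_pt)
  then have "continuous_map (top_of_set (UNIV - {0})) euclidean (PP_projector \<circ> pt)"
    by (simp only: continuous_map_iff_continuous)
  then show ?thesis by (rule continuous_compose_quotient_map[OF quotient_map_pt])
qed

text \<open>On the model the relevant function is the squared sine of the latitude; it takes the values
  \<open>1/2\<close> and \<open>1/5\<close> on the two circles.\<close>

definition lat :: "(real^3) set \<Rightarrow> real" where
  "lat P = PP_projector P $ 3 $ 3"

lemma lat_pt: "x \<noteq> 0 \<Longrightarrow> lat (pt x) = (x$3)^2 / (x \<bullet> x)"
  by (simp add: lat_def PP_projector_pt projector_def power2_eq_square)

lemma continuous_lat: "continuous_map PP euclideanreal lat"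
proof -
  have "continuous_map euclidean euclideanreal (\<lambda>A :: real^3^3. A $ 3 $ 3)"
    by (simp add: continuous_intros)
  then have "continuous_map PP euclideanreal ((\<lambda>A. A $ 3 $ 3) \<circ> PP_projector)"
    by (rule continuous_map_compose[OF continuous_PP_projector])
  then show ?thesis by (simp add: o_def lat_def[abs_def])
qed

lemma inner_3: "x \<bullet> x = (x$1)^2 + (x$2)^2 + (x$3)^2" for x :: "real^3"
  by (simp add: inner_vec_def sum_3 power2_eq_square)

lemma lat_bounds: "P \<in> topspace PP \<Longrightarrow> lat P \<in> {0..1}"
proof (erule PP_cases)
  fix x :: "real^3" assume x: "x \<noteq> 0" "P = pt x"
  have "(x$3)^2 \<le> x \<bullet> x" by (simp add: inner_3)
  then show ?thesis using x by (simp add: lat_pt divide_le_eq_1)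
qed

text \<open>In spherical coordinates the set is the image of the connected strip of all longitudes
  and all values in \<open>J\<close>.\<close>

lemma connectedin_lat:
  assumes J: "connected J" "J \<subseteq> {0..1}"
  shows "connectedin PP {P \<in> topspace PP. lat P \<in> J}"
proof -
  define c where "c = (\<lambda>p. (sqrt (1 - snd p) * cos (fst p)) *\<^sub>R axis 1 1 + (sqrt (1 - snd p) * sin (fst p)) *\<^sub>R axis 2 1
    + sqrt (snd p) *\<^sub>R axis 3 (1::real) :: real^3)"
  have c_nth: "c (\<theta>, k) $ 1 = sqrt (1 - k) * cos \<theta>" "c (\<theta>, k) $ 2 = sqrt (1 - k) * sin \<theta>" "c (\<theta>, k) $ 3 = sqrt k" for \<theta> k
    by (simp_all add: c_def axis_def)
  have c_inner: "c (\<theta>, k) \<bullet> c (\<theta>, k) = 1" if "k \<in> J" for \<theta> k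
  proof -
    have "c (\<theta>, k) \<bullet> c (\<theta>, k) = (1 - k) * ((cos \<theta>)^2 + (sin \<theta>)^2) + k"
    proof -
      have "(sqrt (1 - k))^2 = 1 - k" "(sqrt k)^2 = k" using that J(2) by auto
      then show ?thesis unfolding inner_3 c_nth power_mult_distrib by (simp only: distrib_left)
    qed
    then show ?thesis by simp
  qed
  have "continuous_on (UNIV \<times> J) c" unfolding c_def by (intro continuous_intros)
  then have "connected (c ` (UNIV \<times> J))" using J(1) by (intro connected_continuous_image connected_Times) auto
  moreover have "0 \<notin> c ` (UNIV \<times> J)"
  proof
    assume "0 \<in> c ` (UNIV \<times> J)"
    then obtain \<theta> k where "k \<in> J" "c (\<theta>, k) = 0" by auto
    then show False using c_inner[of k \<theta>] by simp
  qed
  ultimately have "connectedin PP (pt ` c ` (UNIV \<times> J))" by (rule connectedin_pt_image)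
  moreover have "pt ` c ` (UNIV \<times> J) = {P \<in> topspace PP. lat P \<in> J}"
  proof (intro equalityI subsetI)
    fix P assume "P \<in> pt ` c ` (UNIV \<times> J)"
    then obtain \<theta> k where P: "k \<in> J" "P = pt (c (\<theta>, k))" by auto
    moreover have nz: "c (\<theta>, k) \<noteq> 0" using c_inner[OF P(1), of \<theta>] by auto
    moreover have "lat P = k" unfolding P(2) lat_pt[OF nz] c_inner[OF P(1)] c_nth using P(1) J(2) by auto
    ultimately show "P \<in> {P \<in> topspace PP. lat P \<in> J}" by (simp add: pt_in_PP)
  next
    fix P assume "P \<in> {P \<in> topspace PP. lat P \<in> J}"
    then obtain x0 where x0: "x0 \<noteq> 0" "P = pt x0" "lat P \<in> J" using PP_cases by blast
    \<comment> \<open>The unit representative with nonnegative third coordinate, since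
      \<open>c\<close> uses the nonnegative square root.\<close>
    define x where "x = ((if x0$3 < 0 then - 1 else 1) / norm x0) *s x0"
    have x: "x \<noteq> 0" "P = pt x" using x0(1,2) by (simp_all add: x_def pt_scale)
    have "x$3 \<ge> 0" by (simp add: x_def)
    have "norm x = 1" using x0(1) by (simp add: x_def scalar_mult_eq_scaleR)
    then have xx: "x \<bullet> x = 1" by (simp add: norm_eq_1)
    define k where "k = (x$3)^2"
    have k: "k \<in> J" using x0(3) unfolding x(2) lat_pt[OF x(1)] xx k_def by simp
    have r: "(x$1)^2 + (x$2)^2 = 1 - k" using xx unfolding inner_3 k_def by simp
    have "\<exists>\<theta>. x$1 = sqrt (1 - k) * cos \<theta> \<and> x$2 = sqrt (1 - k) * sin \<theta>"
    proof (cases "1 - k = 0")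
      case True
      then show ?thesis using r by (simp add: sum_power2_eq_zero_iff)
    next
      case False
      then have s: "sqrt (1 - k) \<noteq> 0" by simp
      have "(sqrt (1 - k))^2 = (x$1)^2 + (x$2)^2" using r k J(2) by auto
      then have "(x$1 / sqrt (1 - k))^2 + (x$2 / sqrt (1 - k))^2 = 1"
        unfolding power_divide add_divide_distrib[symmetric] using s by (metis divide_self power_not_zero)
      then obtain \<theta> where "x$1 / sqrt (1 - k) = cos \<theta>" "x$2 / sqrt (1 - k) = sin \<theta>" using sincos_total_2pi by metis
      then have "x$1 = sqrt (1 - k) * cos \<theta>" "x$2 = sqrt (1 - k) * sin \<theta>" using s by (auto simp: field_simps)
      then show ?thesis by blast
    qed
    then obtain \<theta> where "x = c (\<theta>, k)"
      using \<open>x$3 \<ge> 0\<close> by (auto simp: vec_eq_iff forall_3 c_nth k_def)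
    then show "P \<in> pt ` c ` (UNIV \<times> J)" using x(2) k by blast
  qed
  ultimately show ?thesis by simp
qed

section \<open>Lifting an isotopy to the sphere\<close>

lemma norm_matrix_vector_le: "norm (A *v x) \<le> norm A * norm x" for A :: "real^'n^'m"
proof -
  have "norm (A *v x) \<le> L2_set (\<lambda>i. norm (A$i) * norm x) UNIV"
    unfolding norm_vec_def[of "A *v x"]
    by (intro L2_set_mono) (simp_all add: matrix_vector_mul_component Cauchy_Schwarz_ineq2)
  also have "\<dots> = norm A * norm x" unfolding norm_vec_def[of A]
    by (simp add: L2_set_left_distrib)
  finally show ?thesis .
qed

text \<open>An isotopy of the projective plane lifts to the sphere: cut the time interval into short steps and
  project orthogonally from each line to the next.\<close>

lemma isotopy_lift:
  assumes H: "continuous_map (prod_topology (top_of_set {0..1::real}) PP) PP H"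
    and H0: "\<And>P. P \<in> topspace PP \<Longrightarrow> H (0, P) = P"
  obtains v where "continuous_on (sphere 0 1) v" "\<And>x. norm x = 1 \<Longrightarrow> v x \<noteq> 0 \<and> pt (v x) = H (1, pt x)"
    "\<And>x. norm x = 1 \<Longrightarrow> v (- x) = - v x"
proof -
  \<comment> \<open>The projector onto the line \<open>H (t, pt x)\<close>, which varies
    continuously although no representative of that line has been chosen.\<close>
  define G where "G t x = PP_projector (H (t, pt x))" for t and x :: "real^3"
  have HP: "H (t, P) \<in> topspace PP" if "t \<in> {0..1}" "P \<in> topspace PP" for t P
    using continuous_map_image_subset_topspace[OF H] that by (auto simp: image_subset_iff)
  have contG: "continuous_on ({0..1} \<times> sphere 0 1) (\<lambda>p. G (fst p) (snd p))"
  proof -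
    have "continuous_map (top_of_set ({0..1} \<times> sphere 0 1)) (top_of_set {0..1}) (fst :: real \<times> (real^3) \<Rightarrow> real)"
      by (auto intro!: continuous_intros)
    moreover have "continuous_map (top_of_set ({0..1} \<times> sphere 0 1)) (top_of_set (UNIV - {0})) (snd :: real \<times> (real^3) \<Rightarrow> real^3)"
      by (auto intro!: continuous_intros)
    then have "continuous_map (top_of_set ({0..1} \<times> sphere 0 1)) PP (pt \<circ> (snd :: real \<times> (real^3) \<Rightarrow> real^3))"
      using continuous_map_pt continuous_map_compose by blast
    ultimately have "continuous_map (top_of_set ({0..1} \<times> sphere 0 1)) (prod_topology (top_of_set {0..1}) PP)
      (\<lambda>p :: real \<times> (real^3). (fst p, pt (snd p)))"
      unfolding continuous_map_pairwise o_def fst_conv snd_conv by (rule conjI)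
    then have "continuous_map (top_of_set ({0..1} \<times> sphere 0 1)) euclidean (PP_projector \<circ> (H \<circ> (\<lambda>p :: real \<times> (real^3). (fst p, pt (snd p)))))"
      by (rule continuous_map_compose[OF continuous_map_compose[OF _ H] continuous_PP_projector])
    then show ?thesis by (simp add: G_def o_def)
  qed
  have "compact ({0..1::real} \<times> sphere (0 :: real^3) 1)" by (intro compact_Times) auto
  then have "uniformly_continuous_on ({0..1} \<times> sphere 0 1) (\<lambda>p. G (fst p) (snd p))"
    using contG compact_uniformly_continuous by blast
  then obtain d where d: "d > 0" "\<And>p q. p \<in> {0..1} \<times> sphere 0 1 \<Longrightarrow> q \<in> {0..1} \<times> sphere 0 1 \<Longrightarrow> dist q p < d
      \<Longrightarrow> dist (G (fst q) (snd q)) (G (fst p) (snd p)) < 1"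
    unfolding uniformly_continuous_on_def by (meson zero_less_one)
  obtain N :: nat where N: "1 / d < real N" using reals_Archimedean2 by blast
  then have N0: "N > 0" using d(1) by (cases N) (auto simp: zero_less_divide_iff dest: less_asym)
  define \<tau> where "\<tau> k = real k / real N" for k
  have \<tau>: "\<tau> k \<in> {0..1}" if "k \<le> N" for k using that N0 by (simp add: \<tau>_def)
  have step: "norm (G (\<tau> (Suc k)) x - G (\<tau> k) x) < 1" if "Suc k \<le> N" "norm x = 1" for k x
  proof -
    have "dist (\<tau> (Suc k), x) (\<tau> k, x) = 1 / N"
      by (simp add: dist_Pair_Pair \<tau>_def dist_real_def diff_divide_distrib[symmetric])
    also have "\<dots> < d" using N N0 d(1) by (simp add: field_simps)
    finally show ?thesis
      using d(2)[of "(\<tau> k, x)" "(\<tau> (Suc k), x)"] \<tau>[of k] \<tau>[of "Suc k"] that by (simp add: dist_norm)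
  qed
  define v where "v = rec_nat (\<lambda>x :: real^3. x) (\<lambda>k w x. G (\<tau> (Suc k)) x *v w x)"
  have v0: "v 0 x = x" and vS: "v (Suc k) x = G (\<tau> (Suc k)) x *v v k x" for k x by (simp_all add: v_def)
  have rep: "\<exists>w. w \<noteq> 0 \<and> H (t, pt x) = pt w \<and> G t x = projector w" if tx: "t \<in> {0..1}" "norm x = 1" for t x
  proof -
    have "pt x \<in> topspace PP" using tx(2) by (intro pt_in_PP) auto
    then obtain w where "w \<noteq> 0" "H (t, pt x) = pt w" using HP[OF tx(1)] PP_cases by metis
    then show ?thesis by (auto simp: G_def PP_projector_pt)
  qed
  have on_line: "pt u = H (t, pt x)" if tx: "t \<in> {0..1}" "norm x = 1" "G t x *v u = u" "u \<noteq> 0" for t x u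
  proof -
    obtain w where w: "w \<noteq> 0" "H (t, pt x) = pt w" "G t x = projector w" using rep[OF tx(1,2)] by blast
    have "u = ((w \<bullet> u) / (w \<bullet> w)) *s w" using tx(3) unfolding w(3) projector_apply by simp
    then have "pt u = pt w" using tx(4) w(1) by (metis pt_scale vector_smult_lzero)
    then show ?thesis using w(2) by simp
  qed
  have idem: "G t x *v (G t x *v u) = G t x *v u" if tx: "t \<in> {0..1}" "norm x = 1" for t x u
  proof -
    obtain w where w: "w \<noteq> 0" "G t x = projector w" using rep[OF tx] by blast
    show ?thesis unfolding w(2) projector_apply using w(1) by (simp add: scalar_mult_eq_scaleR)
  qed
  have main: "v k x \<noteq> 0 \<and> G (\<tau> k) x *v v k x = v k x" if "k \<le> N" "norm x = 1" for k x
    using that(1)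
  proof (induction k)
    case 0
    have x: "x \<noteq> 0" "pt x \<in> topspace PP" using that(2) by (auto intro: pt_in_PP)
    have "G (\<tau> 0) x = projector x" using H0[OF x(2)] x(1) by (simp add: G_def \<tau>_def PP_projector_pt)
    then show ?case using x(1) by (simp add: v0 projector_apply)
  next
    case (Suc k)
    then have IH: "v k x \<noteq> 0" "G (\<tau> k) x *v v k x = v k x" by auto
    \<comment> \<open>If the next line were orthogonal to \<open>v k x\<close>, the difference of
      the two projectors would send that vector to its negative, but its norm is below 1.\<close>
    have "v (Suc k) x \<noteq> 0"
    proof
      assume "v (Suc k) x = 0"
      then have "(G (\<tau> (Suc k)) x - G (\<tau> k) x) *v v k x = - v k x"
        by (simp add: matrix_vector_mult_diff_rdistrib IH vS)
      then have "norm (v k x) \<le> norm (G (\<tau> (Suc k)) x - G (\<tau> k) x) * norm (v k x)"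
        by (metis norm_matrix_vector_le norm_minus_cancel)
      moreover have "norm (G (\<tau> (Suc k)) x - G (\<tau> k) x) * norm (v k x) < 1 * norm (v k x)"
        using step[OF Suc.prems that(2)] IH(1) by (intro mult_strict_right_mono) auto
      ultimately show False by simp
    qed
    then show ?case unfolding vS using idem[OF \<tau>[OF Suc.prems] that(2)] by blast
  qed
  have cont: "continuous_on (sphere 0 1) (v k)" if "k \<le> N" for k
    using that
  proof (induction k)
    case 0
    then show ?case by (simp add: v0[abs_def])
  next
    case (Suc k)
    have "continuous_on (sphere 0 1) (\<lambda>x. G (\<tau> (Suc k)) x)"
      using continuous_on_compose2[OF contG, of "sphere 0 1" "\<lambda>x. (\<tau> (Suc k), x)"] \<tau>[OF Suc.prems]
      by (force intro!: continuous_intros)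
    moreover have "continuous_on (sphere 0 1) (v k)" using Suc by simp
    ultimately show ?case
      unfolding vS[abs_def] matrix_vector_mult_def by (intro continuous_intros)
  qed
  \<comment> \<open>\<open>G\<close> depends only on the point [x], and each step is linear in the
    previous vector.\<close>
  have odd: "v k (- x) = - v k x" if "norm x = 1" for k x
  proof (induction k)
    case 0
    then show ?case by (simp add: v0)
  next
    case (Suc k)
    have "pt (- x) = pt x" using pt_scale[of "-1" x] by simp
    then have "G t (- x) = G t x" for t by (simp add: G_def)
    then show ?case using Suc by (simp add: vS vec.neg)
  qed
  have "\<tau> N = 1" using N0 by (simp add: \<tau>_def)
  then have "pt (v N x) = H (1, pt x)" if "norm x = 1" for x
    using on_line[of 1 x "v N x"] main[OF le_refl that] that by simp
  then show ?thesis using that[of "v N"] cont main odd by blast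
qed

text \<open>Hence a line cannot be moved into the affine chart \<open>w \<noteq> 0\<close>: the lift of its great circle would have
  a nowhere vanishing third coordinate, which is an odd function.\<close>

lemma line_meets_infinity:
  assumes H: "continuous_map (prod_topology (top_of_set {0..1::real}) PP) PP H"
    and H0: "\<And>P. P \<in> topspace PP \<Longrightarrow> H (0, P) = P" and a: "a \<noteq> 0"
  obtains x y where "x \<noteq> 0" "a \<bullet> x = 0" "y \<noteq> 0" "H (1, pt x) = pt y" "y$3 = 0"
proof -
  obtain v where v: "continuous_on (sphere 0 1) v" "\<And>x. norm x = 1 \<Longrightarrow> v x \<noteq> 0 \<and> pt (v x) = H (1, pt x)"
    "\<And>x. norm x = 1 \<Longrightarrow> v (- x) = - v x" using isotopy_lift[OF H H0] by blast
  define z where "z = a /\<^sub>R norm a"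
  have z: "norm z = 1" using a by (simp add: z_def)
  obtain y0 where y0: "y0 \<noteq> 0" "orthogonal z y0" using orthogonal_to_vector_exists[of z] by auto
  define y where "y = y0 /\<^sub>R norm y0"
  have y: "norm y = 1" "y \<bullet> z = 0" using y0 by (simp_all add: y_def orthogonal_def inner_commute)
  obtain x where "frame x y z" using frame_exists[OF y(1) z y(2)] .
  then interpret frame x y z .
  have "continuous_on (sphere 0 1) (\<lambda>x. v x $ 3)" using v(1) by (intro continuous_intros)
  moreover have "v (- w) $ 3 = - (v w $ 3)" if "norm w = 1" for w using v(3)[OF that] by simp
  ultimately obtain c d where cd: "c^2 + d^2 = 1" "v (c *s x + d *s y) $ 3 = 0"
    using odd_function_zero[of "\<lambda>x. v x $ 3" x y] unit(1,2) orth(1) by metis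
  let ?w = "c *s x + d *s y"
  have "?w \<bullet> ?w = c^2 + d^2" using unit orth
    by (simp add: scalar_mult_eq_scaleR inner_add_left inner_add_right norm_eq_1 inner_commute power2_eq_square)
  then have w: "norm ?w = 1" using cd(1) by (simp add: norm_eq_1)
  have "z \<bullet> ?w = 0" using orth by (simp add: scalar_mult_eq_scaleR inner_add_right inner_commute)
  then have "a \<bullet> ?w = 0" using a by (simp add: z_def)
  then show ?thesis using that[of ?w "v ?w"] v(2)[OF w] w cd(2) by force
qed

section \<open>The pieces cut out by two nested ovals\<close>

abbreviation rho :: "real^3 \<Rightarrow> real" where "rho x \<equiv> (x$1)^2 + (x$2)^2"

text \<open>\<open>D\<close> is an open disc, \<open>A\<close> an open annulus and \<open>B\<close> an open Moebius band; the ovals \<open>O1\<close> and \<open>O2\<close>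
  separate them.\<close>

lemma nested_ovals_pieces:
  assumes "two_nested_ovals S" "S \<subseteq> topspace PP"
  obtains D O1 A O2 B where "topspace PP = D \<union> O1 \<union> A \<union> O2 \<union> B" "S = O1 \<union> O2"
    "D \<inter> (O1 \<union> A \<union> O2 \<union> B) = {}" "O1 \<inter> (A \<union> O2 \<union> B) = {}" "A \<inter> (O2 \<union> B) = {}" "O2 \<inter> B = {}"
    "connectedin PP D" "connectedin PP A" "connectedin PP B"
    "connectedin PP (D \<union> O1)" "connectedin PP (O1 \<union> A \<union> O2)" "connectedin PP (O2 \<union> B)"
    "closedin PP (D \<union> O1)" "closedin PP (O2 \<union> B)"
    "D \<noteq> {}" "O1 \<noteq> {}" "A \<noteq> {}" "O2 \<noteq> {}" "B \<noteq> {}"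
    "\<forall>a. a \<noteq> 0 \<longrightarrow> (\<exists>x. x \<noteq> 0 \<and> a \<bullet> x = 0 \<and> pt x \<in> B)"
proof -
  obtain H where H: "continuous_map (prod_topology (top_of_set {0..1::real}) PP) PP H"
    and hom: "\<forall>t\<in>{0..1}. homeomorphic_map PP PP (\<lambda>x. H (t, x))" and H0: "\<forall>x\<in>topspace PP. H (0, x) = x"
    and HS: "(\<lambda>x. H (1, x)) ` S = {pt x | x. x \<noteq> 0 \<and> (rho x = (x$3)^2 \<or> rho x = 4 * (x$3)^2)}"
    using assms(1) unfolding two_nested_ovals_def ambient_isotopic_def by blast
  define h where "h P = H (1, P)" for P
  have hh: "homeomorphic_map PP PP h" using hom by (simp add: h_def[abs_def])
  then obtain g where g: "homeomorphic_maps PP PP h g" using homeomorphic_map_maps by blast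
  have gh: "g (h P) = P" and hg: "h (g P) = P" and hP: "h P \<in> topspace PP" and gP: "g P \<in> topspace PP"
    if "P \<in> topspace PP" for P
    using g that unfolding homeomorphic_maps_def continuous_map_def by auto
  have contl: "continuous_map PP euclideanreal (lat \<circ> h)"
    using continuous_lat homeomorphic_imp_continuous_map[OF hh] continuous_map_compose by blast
  \<comment> \<open>Preimages under the final map of the isotopy, so that the topology can be read
    off from the latitude on the model.\<close>
  define pre where "pre J = {P \<in> topspace PP. lat (h P) \<in> J}" for J
  have un: "pre J \<union> pre K = pre (J \<union> K)" for J K unfolding pre_def by auto
  have clo: "closedin PP (pre J)" if "closed J" for J
    using closedin_continuous_map_preimage[OF contl, of J] that by (simp add: pre_def)
  have pre: "pre J = g ` {P \<in> topspace PP. lat P \<in> J}" for J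
  proof (intro equalityI subsetI)
    fix P assume P: "P \<in> pre J"
    then have "h P \<in> {P \<in> topspace PP. lat P \<in> J}" using hP by (simp add: pre_def)
    then show "P \<in> g ` {P \<in> topspace PP. lat P \<in> J}" using gh[of P] P unfolding pre_def by force
  qed (auto simp: pre_def gP hg)
  have conn: "connectedin PP (pre J)" if "connected J" "J \<subseteq> {0..1}" for J
    unfolding pre using connectedin_lat[OF that] g unfolding homeomorphic_maps_def
    by (blast intro: connectedin_continuous_map_image)
  have ne: "pre J \<noteq> {}" if k: "k \<in> J" "0 \<le> k" "k \<le> 1" for k J
  proof -
    define x :: "real^3" where "x = vector [sqrt (1 - k), 0, sqrt k]"
    have "x \<bullet> x = 1" using k by (simp add: inner_3 x_def)
    moreover from this have "x \<noteq> 0" by auto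
    ultimately have "lat (pt x) = k" using k by (simp add: lat_pt x_def)
    then show ?thesis unfolding pre using k(1) \<open>x \<noteq> 0\<close> pt_in_PP by blast
  qed
  have model: "rho x = (x$3)^2 \<longleftrightarrow> lat (pt x) = 1/2" "rho x = 4 * (x$3)^2 \<longleftrightarrow> lat (pt x) = 1/5" if "x \<noteq> 0" for x
  proof -
    have "x \<bullet> x > 0" using that by simp
    then show "rho x = (x$3)^2 \<longleftrightarrow> lat (pt x) = 1/2" "rho x = 4 * (x$3)^2 \<longleftrightarrow> lat (pt x) = 1/5"
      unfolding lat_pt[OF that] by (auto simp: inner_3 field_simps)
  qed
  have hS: "h ` S = {P \<in> topspace PP. lat P = 1/2 \<or> lat P = 1/5}"
    unfolding h_def HS using model by (auto simp: topspace_PP)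
  have S: "S = pre ({1/2} \<union> {1/5})"
  proof (intro equalityI subsetI)
    fix P assume "P \<in> S"
    then show "P \<in> pre ({1/2} \<union> {1/5})" using assms(2) hS unfolding pre_def by blast
  next
    fix P assume "P \<in> pre ({1/2} \<union> {1/5})"
    then have "P \<in> topspace PP" "h P \<in> h ` S" unfolding hS pre_def using hP by auto
    then obtain P' where P': "P \<in> topspace PP" "P' \<in> S" "h P = h P'" by blast
    then have "P = P'" using gh assms(2) by (metis subsetD)
    then show "P \<in> S" using P'(2) by simp
  qed
  have ivl: "{1/2<..1} \<union> {1/2} = {1/2..1::real}" "{1/2} \<union> {1/5<..<1/2} \<union> {1/5} = {1/5..1/2::real}"
    "{1/5} \<union> {0..<1/5} = {0..1/5::real}" by auto
  show ?thesis
  proof (rule that[of "pre {1/2<..1}" "pre {1/2}" "pre {1/5<..<1/2}" "pre {1/5}" "pre {0..<1/5}"])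
    show "topspace PP = pre {1/2<..1} \<union> pre {1/2} \<union> pre {1/5<..<1/2} \<union> pre {1/5} \<union> pre {0..<1/5}"
      unfolding un using lat_bounds hP by (force simp: pre_def)
    show "connectedin PP (pre {1/2<..1} \<union> pre {1/2})" "connectedin PP (pre {1/2} \<union> pre {1/5<..<1/2} \<union> pre {1/5})"
      "connectedin PP (pre {1/5} \<union> pre {0..<1/5})" "closedin PP (pre {1/2<..1} \<union> pre {1/2})"
      "closedin PP (pre {1/5} \<union> pre {0..<1/5})"
      unfolding un ivl by (auto intro!: conn clo)
    show "S = pre {1/2} \<union> pre {1/5}" unfolding S un ..
    show "\<forall>a. a \<noteq> 0 \<longrightarrow> (\<exists>x. x \<noteq> 0 \<and> a \<bullet> x = 0 \<and> pt x \<in> pre {0..<1/5})"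
    proof (intro allI impI)
      fix a :: "real^3" assume a: "a \<noteq> 0"
      \<comment> \<open>Some point of the line is moved to latitude 0, which belongs to the Moebius
        band.\<close>
      obtain x y where *: "x \<noteq> 0" "a \<bullet> x = 0" "y \<noteq> 0" "H (1, pt x) = pt y" "y$3 = 0"
        using line_meets_infinity[OF H _ a] H0 by blast
      then show "\<exists>x. x \<noteq> 0 \<and> a \<bullet> x = 0 \<and> pt x \<in> pre {0..<1/5}"
        by (intro exI[of _ x]) (simp add: pre_def h_def pt_in_PP lat_pt)
    qed
    show "pre {1/2<..1} \<noteq> {}" by (rule ne[of 1]) auto
    show "pre {1/2} \<noteq> {}" by (rule ne[of "1/2"]) auto
    show "pre {1/5<..<1/2} \<noteq> {}" by (rule ne[of "1/3"]) auto
    show "pre {1/5} \<noteq> {}" by (rule ne[of "1/5"]) auto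
    show "pre {0..<1/5} \<noteq> {}" by (rule ne[of 0]) auto
    show "connectedin PP (pre {1/2<..1})" "connectedin PP (pre {1/5<..<1/2})" "connectedin PP (pre {0..<1/5})"
      by (auto intro!: conn)
  qed (auto simp: pre_def)
qed

section \<open>The real points of the double cover\<close>

lemma continuous_quartic: "continuous_on S (quartic M1 M2 M3 :: real^3 \<Rightarrow> real)"
  unfolding quartic_def by (intro continuous_intros continuous_qform)

lemma even_power_sign:
  fixes c f :: real
  assumes "c \<noteq> 0" "even n"
  shows "c ^ n * f > 0 \<longleftrightarrow> f > 0" "c ^ n * f < 0 \<longleftrightarrow> f < 0" "c ^ n * f \<ge> 0 \<longleftrightarrow> f \<ge> 0"
proof -
  define P where "P = c ^ n"
  have "P > 0" using assms by (simp add: P_def zero_less_power_eq)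
  then show "c ^ n * f > 0 \<longleftrightarrow> f > 0" "c ^ n * f < 0 \<longleftrightarrow> f < 0" "c ^ n * f \<ge> 0 \<longleftrightarrow> f \<ge> 0"
    unfolding P_def[symmetric] by (simp_all add: zero_less_mult_iff mult_less_0_iff zero_le_mult_iff)
qed

lemma homog_forms:
  "homog (\<lambda>x. quartic M1 M2 M3 x > 0)" "homog (\<lambda>x. quartic M1 M2 M3 x < 0)"
  "homog (\<lambda>x. qform M x > 0)" "homog (\<lambda>x. qform M x < 0)"
  unfolding homog_def quartic_scale qform_scale by (intro allI impI even_power_sign even_numeral; assumption)+

text \<open>Only the sign of \<open>f\<close> is defined on the projective plane; the two sign sets
  are open and would separate \<open>C\<close>.\<close>

lemma constant_sign:
  fixes f :: "real^3 \<Rightarrow> real"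
  assumes C: "connectedin PP C" and f: "continuous_on UNIV f" and h: "homog (\<lambda>x. f x > 0)" "homog (\<lambda>x. f x < 0)"
    and nz: "\<And>x. x \<noteq> 0 \<Longrightarrow> pt x \<in> C \<Longrightarrow> f x \<noteq> 0"
  shows "(\<forall>x. x \<noteq> 0 \<and> pt x \<in> C \<longrightarrow> f x > 0) \<or> (\<forall>x. x \<noteq> 0 \<and> pt x \<in> C \<longrightarrow> f x < 0)"
proof (rule ccontr)
  assume neg: "\<not> ?thesis"
  then obtain x y where xy: "x \<noteq> 0" "pt x \<in> C" "f x < 0" "y \<noteq> 0" "pt y \<in> C" "f y > 0"
    using nz by (metis linorder_neqE)
  let ?U = "hset (\<lambda>x. f x > 0)" and ?V = "hset (\<lambda>x. f x < 0)"
  have "openin PP ?U" "openin PP ?V"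
    using h f by (auto intro!: openin_hset open_Collect_less continuous_intros)
  moreover have "C \<subseteq> ?U \<union> ?V"
  proof
    fix P assume P: "P \<in> C"
    then obtain w where "w \<noteq> 0" "P = pt w" using C connectedin_subset_topspace PP_cases by blast
    then show "P \<in> ?U \<union> ?V" using nz[of w] P h by (auto simp: pt_in_hset)
  qed
  moreover have "?U \<inter> ?V \<inter> C = {}"
  proof -
    have "?U \<inter> ?V = {}"
    proof (rule equals0I)
      fix P assume P: "P \<in> ?U \<inter> ?V"
      then obtain w where "w \<noteq> 0" "P = pt w" using hset_subset PP_cases by blast
      then show False using P h by (auto simp: pt_in_hset)
    qed
    then show ?thesis by blast
  qed
  moreover have "?U \<inter> C \<noteq> {}" "?V \<inter> C \<noteq> {}" using xy h pt_in_hset by blast+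
  ultimately show False using C unfolding connectedin by blast
qed

text \<open>The fibre of \<open>Y\<close> over \<open>[x]\<close> is the real conic \<open>z^2 = q(t)\<close> for the binary form \<open>q = netform M1 M2 M3 x\<close>.\<close>

definition netform :: "real^3^3 \<Rightarrow> real^3^3 \<Rightarrow> real^3^3 \<Rightarrow> real^3 \<Rightarrow> real^2 \<Rightarrow> real" where
  "netform M1 M2 M3 x t = (t$1)^2 * qform M1 x + 2 * t$1 * t$2 * qform M2 x + (t$2)^2 * qform M3 x"

lemma netform_scale: "netform M1 M2 M3 x (c *s t) = c^2 * netform M1 M2 M3 x t"
  by (simp add: netform_def power2_eq_square algebra_simps)

lemma Y_cone_netform: "(t, x, w) \<in> Y_cone M1 M2 M3 \<longleftrightarrow> t \<noteq> 0 \<and> x \<noteq> 0 \<and> w^2 = netform M1 M2 M3 x t"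
  by (auto simp: Y_cone_def netform_def)

lemma continuous_map_Y_pt: "continuous_map (top_of_set (Y_cone M1 M2 M3)) (Y_real M1 M2 M3) Y_pt"
  unfolding Y_real_def by (rule quotient_imp_continuous_map[OF quotient_map_quotient_topology])

lemma topspace_Y: "topspace (Y_real M1 M2 M3) = Y_pt ` Y_cone M1 M2 M3"
  using quotient_imp_surjective_map[OF quotient_map_quotient_topology[of "top_of_set (Y_cone M1 M2 M3)" Y_pt]]
  unfolding Y_real_def by simp

lemma Y_pt_scale: "l \<noteq> 0 \<Longrightarrow> m \<noteq> 0 \<Longrightarrow> Y_pt (l *s t, m *s x, l * m * w) = Y_pt (t, x, w)"
  unfolding Y_pt_def prod.case
proof (intro equalityI subsetI)
  assume lm: "l \<noteq> 0" "m \<noteq> 0"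
  { fix p assume "p \<in> {(a *s (l *s t), b *s (m *s x), a * b * (l * m * w)) | a b. a \<noteq> 0 \<and> b \<noteq> 0}"
    then obtain a b where ab: "a \<noteq> 0" "b \<noteq> 0" "p = (a *s (l *s t), b *s (m *s x), a * b * (l * m * w))" by blast
    then have "p = ((a * l) *s t, (b * m) *s x, (a * l) * (b * m) * w)" by simp
    then show "p \<in> {(a *s t, b *s x, a * b * w) | a b. a \<noteq> 0 \<and> b \<noteq> 0}"
      using ab(1,2) lm by (metis (mono_tags, lifting) mem_Collect_eq mult_eq_0_iff) }
  { fix p assume "p \<in> {(a *s t, b *s x, a * b * w) | a b. a \<noteq> 0 \<and> b \<noteq> 0}"
    then obtain a b where ab: "a \<noteq> 0" "b \<noteq> 0" "p = (a *s t, b *s x, a * b * w)" by blast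
    then have "p = ((a / l) *s (l *s t), (b / m) *s (m *s x), (a / l) * (b / m) * (l * m * w))" using lm by simp
    then show "p \<in> {(a *s (l *s t), b *s (m *s x), a * b * (l * m * w)) | a b. a \<noteq> 0 \<and> b \<noteq> 0}"
      using ab(1,2) lm by (metis (mono_tags, lifting) mem_Collect_eq divide_eq_0_iff) }
qed

lemma connectedin_Y_image:
  assumes "connected C" "C \<subseteq> Y_cone M1 M2 M3"
  shows "connectedin (Y_real M1 M2 M3) (Y_pt ` C)"
  by (rule connectedin_continuous_map_image[OF continuous_map_Y_pt])
    (use assms in \<open>auto simp: connectedin_subtopology\<close>)

lemma vec2_eq: "t = u \<longleftrightarrow> t$1 = u$1 \<and> t$2 = u$2" for t u :: "'a^2"
  by (simp add: vec_eq_iff forall_2)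

lemma nonzero_vec2: "t \<noteq> 0 \<longleftrightarrow> t$1 \<noteq> 0 \<or> t$2 \<noteq> 0" for t :: "real^2"
  by (simp add: vec2_eq)

lemma continuous_netform:
  "continuous_on S (\<lambda>p. netform M1 M2 M3 (f p) (g p))" if "continuous_on S f" "continuous_on S g"
  for f :: "'b::topological_space \<Rightarrow> real^3" and g :: "'b \<Rightarrow> real^2"
  unfolding netform_def by (intro continuous_intros continuous_qform that)

lemma fibre_connected_section:
  assumes x: "x \<noteq> 0" and T: "connected T" "0 \<notin> T" "\<And>t. t \<in> T \<Longrightarrow> netform M1 M2 M3 x t \<ge> 0"
  shows "connectedin (Y_real M1 M2 M3) (Y_pt ` (\<lambda>t. (t, x, sqrt (netform M1 M2 M3 x t))) ` T)"
proof (rule connectedin_Y_image)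
  show "connected ((\<lambda>t. (t, x, sqrt (netform M1 M2 M3 x t))) ` T)"
    using T(1) by (intro connected_continuous_image) (auto intro!: continuous_intros continuous_netform)
  show "(\<lambda>t. (t, x, sqrt (netform M1 M2 M3 x t))) ` T \<subseteq> Y_cone M1 M2 M3"
    using x T by (auto simp: Y_cone_netform)
qed

text \<open>(t, x, w) and (-t, x, -w) are the same point, so the section by the nonnegative square
  root reaches the whole fibre.\<close>

lemma fibre_normal_form:
  assumes "(t, x, w) \<in> Y_cone M1 M2 M3"
  obtains t' where "t' \<noteq> 0" "netform M1 M2 M3 x t' \<ge> 0" "Y_pt (t, x, w) = Y_pt (t', x, sqrt (netform M1 M2 M3 x t'))"
proof -
  have t: "t \<noteq> 0" "w^2 = netform M1 M2 M3 x t" using assms by (auto simp: Y_cone_netform)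
  have nn: "netform M1 M2 M3 x t \<ge> 0" using t(2) by (metis zero_le_power2)
  show ?thesis
  proof (cases "w \<ge> 0")
    case True
    then have "sqrt (netform M1 M2 M3 x t) = w" using t(2) by (metis real_sqrt_abs abs_of_nonneg)
    then show ?thesis using that[of t] t nn by simp
  next
    case False
    have n: "netform M1 M2 M3 x (- t) = netform M1 M2 M3 x t" by (simp add: netform_def)
    have "sqrt (netform M1 M2 M3 x (- t)) = - w" using t(2) False unfolding n by (metis real_sqrt_abs abs_of_neg not_le)
    moreover have "Y_pt ((-1) *s t, 1 *s x, (-1) * 1 * w) = Y_pt (t, x, w)" by (rule Y_pt_scale) auto
    ultimately show ?thesis using that[of "- t"] t(1) nn n by simp
  qed
qed

text \<open>The choice of \<open>e\<close> makes the polar term nonnegative, so the form stays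
  nonnegative on the way to a zero.\<close>

lemma netform_segment:
  assumes "netform M1 M2 M3 x t \<ge> 0" "netform M1 M2 M3 x u = 0" "u \<noteq> 0"
  obtains e where "e = 1 \<or> e = -1" "\<And>s. 0 \<le> s \<Longrightarrow> s \<le> 1 \<Longrightarrow> netform M1 M2 M3 x ((1 - s) *s t + s *s (e *s u)) \<ge> 0"
proof -
  define B where "B = t$1 * u$1 * qform M1 x + (t$1 * u$2 + t$2 * u$1) * qform M2 x + t$2 * u$2 * qform M3 x"
  define e :: real where "e = (if B \<ge> 0 then 1 else -1)"
  have e: "e * B \<ge> 0" by (auto simp: e_def)
  have "netform M1 M2 M3 x ((1 - s) *s t + s *s (e *s u)) =
    (1 - s)^2 * netform M1 M2 M3 x t + 2 * s * (1 - s) * (e * B) + s^2 * e^2 * netform M1 M2 M3 x u" for s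
    unfolding netform_def B_def by (simp add: power2_eq_square algebra_simps)
  then have "netform M1 M2 M3 x ((1 - s) *s t + s *s (e *s u)) \<ge> 0" if "0 \<le> s" "s \<le> 1" for s
    using that assms e by (simp add: add_nonneg_nonneg)
  moreover have "e = 1 \<or> e = -1" by (simp add: e_def)
  ultimately show ?thesis using that by blast
qed

text \<open>Any point of a fibre can be joined to a zero of \<open>q\<close>, if there is one; otherwise \<open>q\<close> is positive definite
  and \<open>\<surd>q\<close> is a section over the punctured plane.\<close>

lemma fibre_connected:
  assumes p: "(t, x, w) \<in> Y_cone M1 M2 M3" "(t', x, w') \<in> Y_cone M1 M2 M3"
  obtains C where "connectedin (Y_real M1 M2 M3) C" "Y_pt (t, x, w) \<in> C" "Y_pt (t', x, w') \<in> C"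
proof -
  have x: "x \<noteq> 0" using p by (simp add: Y_cone_netform)
  let ?n = "netform M1 M2 M3 x" and ?s = "\<lambda>t. (t, x, sqrt (netform M1 M2 M3 x t))"
  obtain a where a: "a \<noteq> 0" "?n a \<ge> 0" "Y_pt (t, x, w) = Y_pt (?s a)" using fibre_normal_form[OF p(1)] .
  obtain b where b: "b \<noteq> 0" "?n b \<ge> 0" "Y_pt (t', x, w') = Y_pt (?s b)" using fibre_normal_form[OF p(2)] .
  show ?thesis
  proof (cases "\<exists>u. u \<noteq> 0 \<and> ?n u = 0")
    case True
    then obtain u where u: "u \<noteq> 0" "?n u = 0" by blast
    have join: "\<exists>C. connectedin (Y_real M1 M2 M3) C \<and> Y_pt (?s c) \<in> C \<and> Y_pt (?s u) \<in> C"
      if c: "c \<noteq> 0" "?n c \<ge> 0" for c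
    proof -
      obtain e where e: "e = 1 \<or> e = -1" "\<And>s. 0 \<le> s \<Longrightarrow> s \<le> 1 \<Longrightarrow> ?n ((1 - s) *s c + s *s (e *s u)) \<ge> 0"
        using netform_segment[OF c(2) u(2,1)] by metis
      have eu: "?n (e *s u) = 0" using u(2) e(1) by (auto simp: netform_def)
      have e0: "e \<noteq> 0" using e(1) by auto
      have Yu: "Y_pt (?s (e *s u)) = Y_pt (?s u)"
        using Y_pt_scale[OF e0, of 1 u x 0] by (simp add: eu u(2))
      let ?T = "(\<lambda>s. (1 - s) *s c + s *s (e *s u)) ` {0..1}"
      show ?thesis
      proof (cases "0 \<in> ?T")
        case False
        have "connected ?T"
          by (intro connected_continuous_image) (auto simp: scalar_mult_eq_scaleR intro!: continuous_intros)
        moreover have "?n d \<ge> 0" if d: "d \<in> ?T" for d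
        proof -
          obtain s where "s \<in> {0..1}" "d = (1 - s) *s c + s *s (e *s u)" using d by blast
          then show ?thesis using e(2)[of s] by simp
        qed
        ultimately have conn: "connectedin (Y_real M1 M2 M3) (Y_pt ` ?s ` ?T)"
          by (intro fibre_connected_section[OF x _ False])
        have "c \<in> ?T" by (rule image_eqI[of _ _ 0]) auto
        then have "Y_pt (?s c) \<in> Y_pt ` ?s ` ?T" by (intro imageI)
        moreover have "e *s u \<in> ?T" by (rule image_eqI[of _ _ 1]) auto
        then have "Y_pt (?s u) \<in> Y_pt ` ?s ` ?T" unfolding Yu[symmetric] by (intro imageI)
        ultimately show ?thesis using conn by blast
      next
        \<comment> \<open>The segment meets the origin only if \<open>c\<close> is a multiple of
          \<open>u\<close>; then both give the same point of the fibre.\<close>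
        case True
        then obtain s where s: "0 \<le> s" "s \<le> 1" "(1 - s) *s c + s *s (e *s u) = 0" by auto
        then have "s \<noteq> 1" using u(1) e0 by auto
        then have "c = (- s * e / (1 - s)) *s u"
          using s(3) by (simp add: vec2_eq field_simps eq_neg_iff_add_eq_0)
        then obtain k where k: "c = k *s u" by blast
        then have k0: "k \<noteq> 0" using c(1) by auto
        have "?n (k *s u) = 0" using u(2) by (simp add: netform_scale)
        then have "Y_pt (?s c) = Y_pt (?s u)"
          using Y_pt_scale[OF k0, of 1 u x 0] by (simp add: k u(2))
        moreover have "Y_pt (?s u) \<in> topspace (Y_real M1 M2 M3)"
          unfolding topspace_Y using u x by (intro imageI) (simp add: Y_cone_netform)
        ultimately show ?thesis by (metis connectedin_sing insertI1)
      qed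
    qed
    obtain Ca where Ca: "connectedin (Y_real M1 M2 M3) Ca" "Y_pt (?s a) \<in> Ca" "Y_pt (?s u) \<in> Ca" using join[OF a(1,2)] by blast
    obtain Cb where Cb: "connectedin (Y_real M1 M2 M3) Cb" "Y_pt (?s b) \<in> Cb" "Y_pt (?s u) \<in> Cb" using join[OF b(1,2)] by blast
    have "connectedin (Y_real M1 M2 M3) (Ca \<union> Cb)" using Ca Cb by (intro connectedin_Un) auto
    then show ?thesis using that[of "Ca \<union> Cb"] Ca(2) Cb(2) a(3) b(3) by auto
  next
    case False
    have conn: "connected (UNIV - {0 :: real^2})" 
      using connected_punctured_universe[of "0 :: real^2"] by (simp add: Compl_eq_Diff_UNIV)
    have pos: "?n c > 0" if c: "c \<noteq> 0" for c
    proof (rule ccontr)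
      assume "\<not> ?n c > 0"
      then have "?n c < 0" using False c by (metis linorder_neqE)
      moreover have "connected (?n ` (UNIV - {0}))"
        using conn by (intro connected_continuous_image continuous_netform) (auto intro!: continuous_intros)
      ultimately have "0 \<in> ?n ` (UNIV - {0})"
        using connectedD_interval[of "?n ` (UNIV - {0})" "?n c" "?n a" 0] a c by auto
      then show False using False by auto
    qed
    have "connectedin (Y_real M1 M2 M3) (Y_pt ` ?s ` (UNIV - {0}))"
      using pos by (intro fibre_connected_section[OF x conn]) (auto intro: less_imp_le)
    moreover have "Y_pt (?s a) \<in> Y_pt ` ?s ` (UNIV - {0})" "Y_pt (?s b) \<in> Y_pt ` ?s ` (UNIV - {0})"
      by (intro imageI; use a(1) b(1) in simp)+
    ultimately show ?thesis using that unfolding a(3) b(3) by blast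
  qed
qed

section \<open>From the plane to the double cover\<close>

lemma connectedin_closed_cover:
  assumes "connectedin X S" "closedin X E1" "closedin X E2" "S \<subseteq> E1 \<union> E2" "E1 \<inter> E2 = {}"
    "S \<inter> E1 \<noteq> {}" "S \<inter> E2 \<noteq> {}"
  shows False
  using assms unfolding connectedin_closedin by blast

text \<open>The projector embeds the projective plane into the matrices, so the image is the
  preimage of a compact set of matrices.\<close>

lemma closedin_pt_image:
  assumes "compact C" "0 \<notin> C"
  shows "closedin PP (pt ` C)"
proof -
  have "continuous_on C projector"
    unfolding projector_def using assms(2) by (intro continuous_intros) auto
  then have "closed (projector ` C)" using assms(1) compact_continuous_image compact_imp_closed by blast
  then have "closedin euclidean (projector ` C)" by (simp only: closed_closedin)
  then have "closedin PP {P \<in> topspace PP. PP_projector P \<in> projector ` C}"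
    by (rule closedin_continuous_map_preimage[OF continuous_PP_projector])
  moreover have "{P \<in> topspace PP. PP_projector P \<in> projector ` C} = pt ` C"
  proof (intro equalityI subsetI)
    fix P assume "P \<in> {P \<in> topspace PP. PP_projector P \<in> projector ` C}"
    then have P: "P \<in> topspace PP" "PP_projector P \<in> projector ` C" by auto
    obtain x where x: "x \<noteq> 0" "P = pt x" using PP_cases[OF P(1)] by blast
    then obtain y where xy: "x \<noteq> 0" "P = pt x" "y \<in> C" "projector x = projector y"
      using P(2) by (auto simp: PP_projector_pt)
    have "x = projector x *v x" unfolding projector_apply using xy(1) by simp
    also have "\<dots> = ((y \<bullet> x) / (y \<bullet> y)) *s y" unfolding xy(4) projector_apply ..
    finally have "pt x = pt y" using xy(1) by (metis pt_scale vector_smult_lzero)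
    then show "P \<in> pt ` C" using xy by blast
  next
    fix P assume "P \<in> pt ` C"
    then obtain y where "y \<in> C" "P = pt y" by blast
    moreover from this have "y \<noteq> 0" using assms(2) by auto
    ultimately show "P \<in> {P \<in> topspace PP. PP_projector P \<in> projector ` C}"
      by (simp add: pt_in_PP PP_projector_pt)
  qed
  ultimately show ?thesis by simp
qed

text \<open>The image of the real points of \<open>Y\<close> in the plane.\<close>

definition nonempty_fibres :: "real^3^3 \<Rightarrow> real^3^3 \<Rightarrow> real^3^3 \<Rightarrow> (real^3) set set" where
  "nonempty_fibres M1 M2 M3 = {pt x | x. x \<noteq> 0 \<and> (\<exists>t. t \<noteq> 0 \<and> netform M1 M2 M3 x t \<ge> 0)}"

lemma netform_scale_x: "netform M1 M2 M3 (c *s x) t = c^2 * netform M1 M2 M3 x t"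
  by (simp add: netform_def qform_scale algebra_simps)

lemma Y_unit_representative:
  assumes "p \<in> topspace (Y_real M1 M2 M3)"
  obtains t x where "norm t = 1" "norm x = 1" "netform M1 M2 M3 x t \<ge> 0" "p = Y_pt (t, x, sqrt (netform M1 M2 M3 x t))"
proof -
  obtain t x w where p: "p = Y_pt (t, x, w)" "(t, x, w) \<in> Y_cone M1 M2 M3"
    using assms unfolding topspace_Y by (metis imageE prod_cases3)
  obtain u where u: "u \<noteq> 0" "netform M1 M2 M3 x u \<ge> 0" "Y_pt (t, x, w) = Y_pt (u, x, sqrt (netform M1 M2 M3 x u))"
    using fibre_normal_form[OF p(2)] .
  have x: "x \<noteq> 0" using p(2) by (simp add: Y_cone_netform)
  define l m where "l = inverse (norm u)" "m = inverse (norm x)"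
  have lm: "l > 0" "m > 0" using u(1) x by (simp_all add: l_m_def)
  have n: "netform M1 M2 M3 (m *s x) (l *s u) = (l * m)^2 * netform M1 M2 M3 x u"
    by (simp add: netform_scale netform_scale_x power_mult_distrib)
  have "sqrt (netform M1 M2 M3 (m *s x) (l *s u)) = l * m * sqrt (netform M1 M2 M3 x u)"
    unfolding n real_sqrt_mult using lm by simp
  then have "p = Y_pt (l *s u, m *s x, sqrt (netform M1 M2 M3 (m *s x) (l *s u)))"
    using Y_pt_scale[of l m u x "sqrt (netform M1 M2 M3 x u)"] lm u(3) p(1) by simp
  moreover have "norm (l *s u) = 1" "norm (m *s x) = 1"
    using u(1) x by (simp_all add: l_m_def scalar_mult_eq_scaleR)
  moreover have "netform M1 M2 M3 (m *s x) (l *s u) \<ge> 0" unfolding n using u(2) by simp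
  ultimately show ?thesis using that by blast
qed

text \<open>The projection to the plane has connected fibres, and it is closed because the unit representatives
  form a compact set.\<close>

lemma connected_Y:
  assumes "connectedin PP (nonempty_fibres M1 M2 M3)"
  shows "connected_space (Y_real M1 M2 M3)"
proof (rule ccontr)
  let ?Y = "Y_real M1 M2 M3" and ?n = "netform M1 M2 M3"
  assume "\<not> connected_space ?Y"
  then obtain U V where UV: "openin ?Y U" "openin ?Y V" "topspace ?Y \<subseteq> U \<union> V" "U \<inter> V = {}" "U \<noteq> {}" "V \<noteq> {}"
    unfolding connected_space_def by blast
  define K where "K = {(t, x) \<in> sphere (0::real^2) 1 \<times> sphere (0::real^3) 1. ?n x t \<ge> 0}"
  define \<sigma> where "\<sigma> = (\<lambda>(t, x). Y_pt (t, x, sqrt (?n x t)))"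
  have K: "K = (sphere 0 1 \<times> sphere 0 1) \<inter> {p. ?n (snd p) (fst p) \<ge> 0}" by (auto simp: K_def)
  have "compact K"
    unfolding K by (intro compact_Int_closed compact_Times closed_Collect_le)
      (auto intro!: continuous_intros continuous_netform)
  have \<sigma>: "continuous_map (top_of_set K) ?Y \<sigma>"
  proof -
    have "continuous_on K (\<lambda>p. (fst p, snd p, sqrt (?n (snd p) (fst p))))"
      by (intro continuous_intros continuous_netform)
    moreover have "(\<lambda>p. (fst p, snd p, sqrt (?n (snd p) (fst p)))) ` K \<subseteq> Y_cone M1 M2 M3"
      by (auto simp: K_def Y_cone_netform)
    ultimately have "continuous_map (top_of_set K) (top_of_set (Y_cone M1 M2 M3)) (\<lambda>p. (fst p, snd p, sqrt (?n (snd p) (fst p))))"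
      by (simp add: image_subset_iff_funcset)
    then have "continuous_map (top_of_set K) ?Y (Y_pt \<circ> (\<lambda>p. (fst p, snd p, sqrt (?n (snd p) (fst p)))))"
      using continuous_map_Y_pt continuous_map_compose by blast
    moreover have "Y_pt \<circ> (\<lambda>p. (fst p, snd p, sqrt (?n (snd p) (fst p)))) = \<sigma>" by (auto simp: \<sigma>_def)
    ultimately show ?thesis by simp
  qed
  have in_Y: "\<sigma> p \<in> topspace ?Y" if "p \<in> K" for p
    using continuous_map_image_subset_topspace[OF \<sigma>] that by auto
  define part where "part W = {p \<in> K. \<sigma> p \<in> W}" for W
  have compact_part: "compact (part W)" if W: "openin ?Y W'" "W \<inter> W' = {}" "topspace ?Y \<subseteq> W \<union> W'" for W W'
  proof -
    have "openin (top_of_set K) {p \<in> topspace (top_of_set K). \<sigma> p \<in> W'}"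
      using \<sigma> W(1) by (rule openin_continuous_map_preimage)
    from closedin_diff[OF closedin_topspace this] have "closedin (top_of_set K) (K - {p \<in> K. \<sigma> p \<in> W'})" by simp
    moreover have "K - {p \<in> K. \<sigma> p \<in> W'} = part W" using in_Y W(2,3) unfolding part_def by blast
    ultimately show ?thesis using \<open>compact K\<close> closedin_compact by metis
  qed
  have cU: "compact (part U)" using compact_part[OF UV(2,4,3)] .
  have cV: "compact (part V)" using compact_part[OF UV(1)] UV(3,4) by blast
  have closed: "closedin PP (pt ` snd ` part W)" if "compact (part W)" for W
  proof (rule closedin_pt_image)
    show "compact (snd ` part W)" using that by (intro compact_continuous_image continuous_intros)
    show "0 \<notin> snd ` part W" by (auto simp: part_def K_def)
  qed
  have ne: "nonempty_fibres M1 M2 M3 \<inter> pt ` snd ` part W \<noteq> {}" if W: "openin ?Y W" "W \<noteq> {}" for W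
  proof -
    obtain q where q: "q \<in> W" using W(2) by blast
    then have "q \<in> topspace ?Y" using openin_subset[OF W(1)] by blast
    then obtain t x where tx: "norm t = 1" "norm x = 1" "?n x t \<ge> 0" "q = Y_pt (t, x, sqrt (?n x t))"
      using Y_unit_representative by metis
    then have "(t, x) \<in> part W" using q by (simp add: part_def K_def \<sigma>_def)
    then have "pt x \<in> pt ` snd ` part W" by force
    moreover have "x \<noteq> 0" "t \<noteq> 0" using tx by auto
    then have "pt x \<in> nonempty_fibres M1 M2 M3" using tx(3) unfolding nonempty_fibres_def by blast
    ultimately show ?thesis by blast
  qed
  have cover: "nonempty_fibres M1 M2 M3 \<subseteq> pt ` snd ` part U \<union> pt ` snd ` part V"
  proof
    fix P assume "P \<in> nonempty_fibres M1 M2 M3"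
    then obtain x t where xt: "P = pt x" "x \<noteq> 0" "t \<noteq> 0" "?n x t \<ge> 0" unfolding nonempty_fibres_def by blast
    define t' x' where "t' = inverse (norm t) *s t" "x' = inverse (norm x) *s x"
    have "?n x' t' = (inverse (norm t))^2 * ((inverse (norm x))^2 * ?n x t)"
      unfolding t'_x'_def by (simp only: netform_scale netform_scale_x)
    then have "(t', x') \<in> K" using xt unfolding K_def t'_x'_def by (simp add: scalar_mult_eq_scaleR)
    then have "(t', x') \<in> part U \<union> part V" using in_Y UV(3) unfolding part_def by blast
    moreover have "pt x' = P" using xt(1,2) unfolding t'_x'_def by (simp add: pt_scale)
    ultimately show "P \<in> pt ` snd ` part U \<union> pt ` snd ` part V" by force
  qed
  have disj: "pt ` snd ` part U \<inter> pt ` snd ` part V = {}"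
  proof (rule equals0I)
    fix P assume "P \<in> pt ` snd ` part U \<inter> pt ` snd ` part V"
    then obtain t x t' x' where p: "(t, x) \<in> part U" "(t', x') \<in> part V" "pt x = pt x'" by force
    then have nz: "x \<noteq> 0" "x' \<noteq> 0" "t \<noteq> 0" "t' \<noteq> 0" "?n x t \<ge> 0" "?n x' t' \<ge> 0"
      by (auto simp: part_def K_def)
    obtain c where c: "c \<noteq> 0" "x' = c *s x" using p(3) pt_eq_iff[OF nz(2,1)] by metis
    \<comment> \<open>Rescaling \<open>x'\<close> to \<open>x\<close> divides the coordinate of the
      cover by \<open>c\<close>, so \<open>w\<close> may be negative.\<close>
    define w where "w = sqrt (?n x' t') / c"
    have "w^2 = ?n x t'" using nz(6) c(1) by (simp add: w_def power_divide c(2) netform_scale_x)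
    then have "(t', x, w) \<in> Y_cone M1 M2 M3" using nz by (simp add: Y_cone_netform)
    moreover have "(t, x, sqrt (?n x t)) \<in> Y_cone M1 M2 M3" using nz by (simp add: Y_cone_netform)
    ultimately obtain C where C: "connectedin ?Y C" "Y_pt (t', x, w) \<in> C" "Y_pt (t, x, sqrt (?n x t)) \<in> C"
      using fibre_connected by metis
    have "Y_pt (1 *s t', c *s x, 1 * c * w) = Y_pt (t', x, w)" using c(1) by (intro Y_pt_scale) auto
    then have "Y_pt (t', x, w) = \<sigma> (t', x')" using c by (simp add: \<sigma>_def w_def)
    then have "V \<inter> C \<noteq> {}" using p(2) C(2) by (auto simp: part_def)
    moreover have "U \<inter> C \<noteq> {}" using p(1) C(3) by (auto simp: part_def \<sigma>_def)
    moreover have "C \<subseteq> topspace ?Y" using C(1) by (rule connectedin_subset_topspace)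
    ultimately show False using C(1) UV(1-4) unfolding connectedin by blast
  qed
  show False
    by (rule connectedin_closed_cover[OF assms closed[OF cU] closed[OF cV] cover disj ne[OF UV(1,5)] ne[OF UV(2,6)]])
qed

text \<open>For fixed \<open>t\<close> the set of all \<open>[x]\<close> with \<open>netform M1 M2 M3 x t \<ge> 0\<close> is connected, so it lies in \<open>E1\<close> or in
  \<open>E2\<close>. As the circle of all \<open>t\<close> is connected, it must be empty for some \<open>t\<close>.\<close>

lemma negative_definite_member:
  assumes sym: "transpose M1 = M1" "transpose M2 = M2" "transpose M3 = M3"
    and closed: "closedin PP E1" "closedin PP E2" and disj: "E1 \<inter> E2 = {}"
    and cover: "nonempty_fibres M1 M2 M3 \<subseteq> E1 \<union> E2"
    and ne: "nonempty_fibres M1 M2 M3 \<inter> E1 \<noteq> {}" "nonempty_fibres M1 M2 M3 \<inter> E2 \<noteq> {}"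
  obtains t where "\<And>x. x \<noteq> 0 \<Longrightarrow> netform M1 M2 M3 x t < 0"
proof (rule ccontr)
  let ?n = "netform M1 M2 M3"
  assume "\<not> thesis"
  then have all: "\<exists>x. x \<noteq> 0 \<and> ?n x t \<ge> 0" for t using that by (metis not_less)
  \<comment> \<open>The parameters whose form is nonnegative somewhere over \<open>E\<close>. For
    closed \<open>E\<close> this is the projection of a compact set.\<close>
  define T where "T E = fst ` {p \<in> sphere (0::real^2) 1 \<times> sphere (0::real^3) 1. pt (snd p) \<in> E \<and> ?n (snd p) (fst p) \<ge> 0}" for E
  have T_iff: "t \<in> T E \<longleftrightarrow> norm t = 1 \<and> (\<exists>x. norm x = 1 \<and> pt x \<in> E \<and> ?n x t \<ge> 0)" for t E
    unfolding T_def by force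
  have T_intro: "inverse (norm t) *s t \<in> T E" if tx: "t \<noteq> 0" "x \<noteq> 0" "pt x \<in> E" "?n x t \<ge> 0" for t x E
    unfolding T_iff
  proof (intro conjI exI[of _ "inverse (norm x) *s x"])
    show "norm (inverse (norm t) *s t) = 1" "norm (inverse (norm x) *s x) = 1"
      using tx by (simp_all add: scalar_mult_eq_scaleR)
    show "pt (inverse (norm x) *s x) \<in> E" using tx by (simp add: pt_scale)
    show "?n (inverse (norm x) *s x) (inverse (norm t) *s t) \<ge> 0"
      unfolding netform_scale netform_scale_x using tx by simp
  qed
  have closed_T: "closed (T E)" if E: "closedin PP E" for E
  proof -
    have "openin PP (topspace PP - E)" using E by (simp add: closedin_def)
    then have "open {x. x \<noteq> 0 \<and> pt x \<in> topspace PP - E}" by (simp add: openin_PP)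
    then have "closed (- {x. x \<noteq> 0 \<and> pt x \<in> topspace PP - E})" by (rule closed_Compl)
    moreover have "- {x. x \<noteq> 0 \<and> pt x \<in> topspace PP - E} = {x. x = 0 \<or> pt x \<in> E}"
      using pt_in_PP by blast
    ultimately have "closed {x. x = 0 \<or> pt x \<in> E}" by simp
    then have "closed (UNIV \<times> {x. x = 0 \<or> pt x \<in> E} :: ((real^2) \<times> (real^3)) set)" by (intro closed_Times) auto
    moreover have "closed {p. ?n (snd p) (fst p) \<ge> 0}"
      by (intro closed_Collect_le) (auto intro!: continuous_intros continuous_netform)
    ultimately have "compact ((sphere (0::real^2) 1 \<times> sphere (0::real^3) 1) \<inter> ((UNIV \<times> {x. x = 0 \<or> pt x \<in> E}) \<inter> {p. ?n (snd p) (fst p) \<ge> 0}))"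
      by (intro compact_Int_closed compact_Times closed_Int) auto
    moreover have "(sphere (0::real^2) 1 \<times> sphere (0::real^3) 1) \<inter> ((UNIV \<times> {x. x = 0 \<or> pt x \<in> E}) \<inter> {p. ?n (snd p) (fst p) \<ge> 0})
      = {p \<in> sphere (0::real^2) 1 \<times> sphere (0::real^3) 1. pt (snd p) \<in> E \<and> ?n (snd p) (fst p) \<ge> 0}" by auto
    ultimately have "compact {p \<in> sphere (0::real^2) 1 \<times> sphere (0::real^3) 1. pt (snd p) \<in> E \<and> ?n (snd p) (fst p) \<ge> 0}"
      by (simp only:)
    then have "compact (T E)" unfolding T_def by (intro compact_continuous_image continuous_intros)
    then show ?thesis by (rule compact_imp_closed)
  qed
  have T_cover: "sphere 0 1 \<subseteq> T E1 \<union> T E2"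
  proof
    fix t :: "real^2" assume "t \<in> sphere 0 1"
    then have t: "norm t = 1" "t \<noteq> 0" by auto
    obtain x where x: "x \<noteq> 0" "?n x t \<ge> 0" using all by blast
    then have "pt x \<in> E1 \<union> E2" using cover t(2) unfolding nonempty_fibres_def by blast
    moreover have "inverse (norm t) *s t = t" using t(1) by simp
    ultimately show "t \<in> T E1 \<union> T E2" using T_intro[OF t(2) x(1) _ x(2)] by fastforce
  qed
  have T_disj: "T E1 \<inter> T E2 \<inter> sphere 0 1 = {}"
  proof (rule equals0I)
    fix t assume "t \<in> T E1 \<inter> T E2 \<inter> sphere 0 1"
    then obtain x y where t: "t \<noteq> 0" and x: "x \<noteq> 0" "pt x \<in> E1" "?n x t \<ge> 0" and y: "y \<noteq> 0" "pt y \<in> E2" "?n y t \<ge> 0"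
      unfolding T_iff Int_iff by (metis norm_zero zero_neq_one)
    define B where "B = (t$1)^2 * polar M1 x y + 2 * t$1 * t$2 * polar M2 x y + (t$2)^2 * polar M3 x y"
    \<comment> \<open>With this sign the polar term is nonnegative, so the form at \<open>t\<close>
      stays nonnegative on the segment from \<open>x\<close> to \<open>e y\<close>, which joins
      \<open>E1\<close> to \<open>E2\<close>.\<close>
    define e :: real where "e = (if B \<ge> 0 then 1 else -1)"
    have e: "e * B \<ge> 0" "e \<noteq> 0" by (auto simp: e_def)
    let ?c = "\<lambda>s. (1 - s) *s x + s *s (e *s y)"
    have seg: "?n (?c s) t = (1 - s)^2 * ?n x t + 2 * s * (1 - s) * (e * B) + s^2 * (e^2 * ?n y t)" for s
      unfolding netform_def B_def qform_add[OF sym(1)] qform_add[OF sym(2)] qform_add[OF sym(3)] qform_scale polar_linear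
      by (simp add: power2_eq_square algebra_simps)
    have pos: "?n (?c s) t \<ge> 0" if s: "0 \<le> s" "s \<le> 1" for s
    proof -
      have "(1 - s)^2 * ?n x t \<ge> 0" "s^2 * (e^2 * ?n y t) \<ge> 0" using x(3) y(3) by simp_all
      moreover have "2 * s * (1 - s) * (e * B) \<ge> 0" using s by (intro mult_nonneg_nonneg[OF _ e(1)]) auto
      ultimately show ?thesis unfolding seg by linarith
    qed
    have nz: "?c s \<noteq> 0" if s: "0 \<le> s" "s \<le> 1" for s
    proof
      assume z: "?c s = 0"
      then have s0: "s \<noteq> 0" using x(1) by auto
      have "(1 - s) *s x = - (s *s (e *s y))" using z by (rule eq_neg_iff_add_eq_0[THEN iffD2])
      then have "y = (- (1 - s) / (s * e)) *s x" using s0 e(2) by (simp add: vec_eq_iff field_simps)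
      then obtain k where "y = k *s x" by blast
      then have "pt y = pt x" using y(1) pt_scale[of k x] by auto
      then show False using x(2) y(2) disj by auto
    qed
    have "connected (?c ` {0..1})"
      by (intro connected_continuous_image) (auto simp: scalar_mult_eq_scaleR intro!: continuous_intros)
    then have conn: "connectedin PP (pt ` ?c ` {0..1})" using nz by (intro connectedin_pt_image) force+
    have sub: "pt ` ?c ` {0..1} \<subseteq> E1 \<union> E2"
    proof
      fix P assume "P \<in> pt ` ?c ` {0..1}"
      then obtain s where "0 \<le> s" "s \<le> 1" "P = pt (?c s)" by auto
      then have "P \<in> nonempty_fibres M1 M2 M3" using t nz pos unfolding nonempty_fibres_def by blast
      then show "P \<in> E1 \<union> E2" using cover by blast
    qed
    have im: "pt (?c 0) \<in> pt ` ?c ` {0..1}" "pt (?c 1) \<in> pt ` ?c ` {0..1}" by (intro imageI; simp)+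
    have E: "pt (?c 0) \<in> E1" "pt (?c 1) \<in> E2" using x y e(2) by (simp_all add: pt_scale)
    show False
      by (rule connectedin_closed_cover[OF conn closed sub disj
            ex_in_conv[THEN iffD1, OF exI, OF IntI[OF im(1) E(1)]] ex_in_conv[THEN iffD1, OF exI, OF IntI[OF im(2) E(2)]]])
  qed
  have T_ne: "T E \<inter> sphere 0 1 \<noteq> {}" if E: "nonempty_fibres M1 M2 M3 \<inter> E \<noteq> {}" for E
  proof -
    obtain x t where "x \<noteq> 0" "t \<noteq> 0" "pt x \<in> E" "?n x t \<ge> 0"
      using E unfolding nonempty_fibres_def by blast
    then have "inverse (norm t) *s t \<in> T E" by (intro T_intro)
    moreover from this have "inverse (norm t) *s t \<in> sphere 0 1" by (simp add: T_iff)
    ultimately show ?thesis by blast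
  qed
  have "connected (sphere (0::real^2) 1)" by (rule connected_sphere) simp
  from connected_closedD[OF this T_disj T_cover closed_T[OF closed(1)] closed_T[OF closed(2)]] show False
    using T_ne[OF ne(1)] T_ne[OF ne(2)] by blast
qed

text \<open>The quartic is the determinant of the binary form in \<open>t\<close>. If it is
  nonpositive the form has a nontrivial real zero; if it is positive the form is definite with the
  sign of \<open>Q1\<close>.\<close>

lemma fibre_cases:
  assumes "x \<noteq> 0"
  shows "quartic M1 M2 M3 x \<le> 0 \<Longrightarrow> pt x \<in> nonempty_fibres M1 M2 M3"
    "qform M1 x > 0 \<Longrightarrow> pt x \<in> nonempty_fibres M1 M2 M3"
    "quartic M1 M2 M3 x > 0 \<Longrightarrow> qform M1 x < 0 \<Longrightarrow> pt x \<notin> nonempty_fibres M1 M2 M3"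
proof -
  let ?n = "netform M1 M2 M3" and ?q1 = "qform M1 x" and ?q2 = "qform M2 x" and ?q3 = "qform M3 x"
  have intro: "pt x \<in> nonempty_fibres M1 M2 M3" if "t \<noteq> 0" "?n x t \<ge> 0" for t
    using assms that unfolding nonempty_fibres_def by blast
  have v: "vector [1, 0] \<noteq> (0 :: real^2)" "?n x (vector [1, 0]) = ?q1" by (simp_all add: nonzero_vec2 netform_def)
  show "qform M1 x > 0 \<Longrightarrow> pt x \<in> nonempty_fibres M1 M2 M3" using intro[OF v(1)] v(2) by simp
  show "quartic M1 M2 M3 x \<le> 0 \<Longrightarrow> pt x \<in> nonempty_fibres M1 M2 M3"
  proof -
    assume F: "quartic M1 M2 M3 x \<le> 0"
    show ?thesis
    proof (cases "?q1 = 0")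
      case True
      then show ?thesis using intro[OF v(1)] v(2) by simp
    next
      case False
      \<comment> \<open>The quadratic formula with its denominator cleared.\<close>
      let ?t = "vector [- ?q2 + sqrt (?q2^2 - ?q1 * ?q3), ?q1] :: real^2"
      have r: "(sqrt (?q2^2 - ?q1 * ?q3))^2 = ?q2^2 - ?q1 * ?q3" using F by (simp add: quartic_def)
      have "?n x ?t = ?q1 * ((sqrt (?q2^2 - ?q1 * ?q3))^2 - (?q2^2 - ?q1 * ?q3))"
        by (simp add: netform_def power2_eq_square algebra_simps)
      then have "?n x ?t = 0" unfolding r by simp
      then show ?thesis using intro[of ?t] False by (simp add: nonzero_vec2)
    qed
  qed
  show "pt x \<notin> nonempty_fibres M1 M2 M3" if F: "quartic M1 M2 M3 x > 0" "?q1 < 0"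
  proof
    assume "pt x \<in> nonempty_fibres M1 M2 M3"
    then obtain y t where yt: "pt x = pt y" "y \<noteq> 0" "t \<noteq> 0" "?n y t \<ge> 0" unfolding nonempty_fibres_def by blast
    obtain c where c: "c \<noteq> 0" "y = c *s x" using yt(1) pt_eq_iff[OF yt(2) assms] by metis
    have "?n x t \<ge> 0" using yt(4) c unfolding c(2) netform_scale_x by (simp add: zero_le_mult_iff)
    then have le: "?q1 * ?n x t \<le> 0" using F(2) by (simp add: mult_nonpos_nonneg)
    have "?q1 * ?n x t = (t$1 * ?q1 + t$2 * ?q2)^2 + (t$2)^2 * quartic M1 M2 M3 x"
      unfolding netform_def quartic_def by (simp add: power2_eq_square algebra_simps)
    moreover have "(t$2)^2 * quartic M1 M2 M3 x \<ge> 0" using F(1) by simp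
    ultimately have z: "(t$1 * ?q1 + t$2 * ?q2)^2 = 0" "(t$2)^2 * quartic M1 M2 M3 x = 0"
      using le zero_le_power2[of "t$1 * ?q1 + t$2 * ?q2"] by linarith+
    then have "t$2 = 0" using F(1) by simp
    then have "t$1 = 0" using z(1) F(2) by simp
    then show False using yt(3) \<open>t$2 = 0\<close> by (simp add: nonzero_vec2)
  qed
qed

theorem corollary3p9:
  fixes M1 M2 M3 :: "real^3^3"
  assumes "transpose M1 = M1" and "transpose M2 = M2" and "transpose M3 = M3"
    and "smooth_plane_quartic M1 M2 M3"
    and "etale_double_cover M1 M2 M3"
    and "two_nested_ovals (real_quartic_locus M1 M2 M3)"
    and "IJT_obstruction_vanishes M1 M2 M3"
  shows "connected_space (Y_real M1 M2 M3)"
proof (rule connected_Y)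
  note sym = assms(1-3) and smooth = assms(4)
  let ?F = "quartic M1 M2 M3" and ?S = "nonempty_fibres M1 M2 M3"
  let ?Z = "real_quartic_locus M1 M2 M3"
  have Z_top: "?Z \<subseteq> topspace PP" by (auto simp: real_quartic_locus_def topspace_PP)
  obtain D O1 A O2 B where cover: "topspace PP = D \<union> O1 \<union> A \<union> O2 \<union> B" and Z: "?Z = O1 \<union> O2"
    and disj: "D \<inter> (O1 \<union> A \<union> O2 \<union> B) = {}" "O1 \<inter> (A \<union> O2 \<union> B) = {}" "A \<inter> (O2 \<union> B) = {}" "O2 \<inter> B = {}"
    and conn: "connectedin PP D" "connectedin PP A" "connectedin PP B"
    "connectedin PP (D \<union> O1)" "connectedin PP (O1 \<union> A \<union> O2)" "connectedin PP (O2 \<union> B)"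
    and closed: "closedin PP (D \<union> O1)" "closedin PP (O2 \<union> B)"
    and ne: "D \<noteq> {}" "O1 \<noteq> {}" "A \<noteq> {}" "O2 \<noteq> {}" "B \<noteq> {}"
    and line: "\<forall>a. a \<noteq> 0 \<longrightarrow> (\<exists>x. x \<noteq> 0 \<and> a \<bullet> x = 0 \<and> pt x \<in> B)"
    by (rule nested_ovals_pieces[OF assms(6) Z_top])
  have on_Z: "pt x \<in> ?Z \<longleftrightarrow> ?F x = 0" if x: "x \<noteq> 0" for x
  proof
    assume "pt x \<in> ?Z"
    then obtain y where y: "y \<noteq> 0" "?F y = 0" "pt x = pt y" unfolding real_quartic_locus_def by blast
    then obtain c where "x = c *s y" using pt_eq_iff[OF x] by blast
    then show "?F x = 0" using y(2) by (simp add: quartic_scale)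
  qed (use x in \<open>auto simp: real_quartic_locus_def\<close>)
  have sign: "(\<forall>x. x \<noteq> 0 \<and> pt x \<in> C \<longrightarrow> ?F x > 0) \<or> (\<forall>x. x \<noteq> 0 \<and> pt x \<in> C \<longrightarrow> ?F x < 0)"
    if C: "connectedin PP C" "C \<inter> ?Z = {}" for C
    using C on_Z by (intro constant_sign continuous_quartic homog_forms) auto
  have sign1: "(\<forall>x. x \<noteq> 0 \<and> pt x \<in> C \<longrightarrow> qform M1 x > 0) \<or> (\<forall>x. x \<noteq> 0 \<and> pt x \<in> C \<longrightarrow> qform M1 x < 0)"
    if C: "connectedin PP C" "\<And>x. x \<noteq> 0 \<Longrightarrow> pt x \<in> C \<Longrightarrow> ?F x > 0" for C
  proof (rule constant_sign[OF C(1) _ homog_forms(3,4)])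
    show "continuous_on UNIV (qform M1)" using continuous_qform[of UNIV "\<lambda>x. x" M1] by simp
    show "qform M1 x \<noteq> 0" if "x \<noteq> 0" "pt x \<in> C" for x
      using C(2)[OF that] by (auto simp: quartic_def)
  qed
  \<comment> \<open>The complement of a closed set is a neighbourhood of each oval point in it, so
    the quartic takes both signs there.\<close>
  have change: "\<not> (\<forall>x. x \<noteq> 0 \<and> pt x \<in> X \<longrightarrow> ?F x \<ge> 0)" "\<not> (\<forall>x. x \<noteq> 0 \<and> pt x \<in> X \<longrightarrow> ?F x \<le> 0)"
    if X: "closedin PP (topspace PP - X)" "X \<subseteq> topspace PP" "P \<in> X" "P \<in> ?Z" for X P
  proof -
    have "openin PP X" using X(1,2) by (metis openin_closedin_eq)
    then have "open {x. x \<noteq> 0 \<and> pt x \<in> X}" by (simp add: openin_PP)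
    moreover obtain p where p: "p \<noteq> 0" "P = pt p" using X(2,3) PP_cases by blast
    moreover have "?F p = 0" using on_Z[OF p(1)] X(4) p(2) by simp
    ultimately have "\<exists>y\<in>{x. x \<noteq> 0 \<and> pt x \<in> X}. ?F y > 0" "\<exists>y\<in>{x. x \<noteq> 0 \<and> pt x \<in> X}. ?F y < 0"
      using X(3) by (intro smooth_sign_change[OF sym smooth]; simp)+
    then show "\<not> (\<forall>x. x \<noteq> 0 \<and> pt x \<in> X \<longrightarrow> ?F x \<ge> 0)" "\<not> (\<forall>x. x \<noteq> 0 \<and> pt x \<in> X \<longrightarrow> ?F x \<le> 0)"
      by force+
  qed
  have X1: "topspace PP - (D \<union> O1 \<union> A) = O2 \<union> B" and X2: "topspace PP - (A \<union> O2 \<union> B) = D \<union> O1"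
    using cover disj by blast+
  have sub: "D \<union> O1 \<union> A \<subseteq> topspace PP" "A \<union> O2 \<union> B \<subseteq> topspace PP" using cover by blast+
  obtain P1 P2 where P: "P1 \<in> O1" "P2 \<in> O2" using ne by blast
  have ch1: "\<not> (\<forall>x. x \<noteq> 0 \<and> pt x \<in> D \<union> O1 \<union> A \<longrightarrow> ?F x \<ge> 0)" "\<not> (\<forall>x. x \<noteq> 0 \<and> pt x \<in> D \<union> O1 \<union> A \<longrightarrow> ?F x \<le> 0)"
    using change[of "D \<union> O1 \<union> A" P1] sub(1) closed(2) P(1) Z unfolding X1 by auto
  have ch2: "\<not> (\<forall>x. x \<noteq> 0 \<and> pt x \<in> A \<union> O2 \<union> B \<longrightarrow> ?F x \<ge> 0)" "\<not> (\<forall>x. x \<noteq> 0 \<and> pt x \<in> A \<union> O2 \<union> B \<longrightarrow> ?F x \<le> 0)"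
    using change[of "A \<union> O2 \<union> B" P2] sub(2) closed(1) P(2) Z unfolding X2 by auto
  have F0: "?F x = 0" if "x \<noteq> 0" "pt x \<in> O1 \<union> O2" for x using on_Z that Z by blast
  have sD: "(\<forall>x. x \<noteq> 0 \<and> pt x \<in> D \<longrightarrow> ?F x > 0) \<or> (\<forall>x. x \<noteq> 0 \<and> pt x \<in> D \<longrightarrow> ?F x < 0)"
    and sB: "(\<forall>x. x \<noteq> 0 \<and> pt x \<in> B \<longrightarrow> ?F x > 0) \<or> (\<forall>x. x \<noteq> 0 \<and> pt x \<in> B \<longrightarrow> ?F x < 0)"
    and sA: "(\<forall>x. x \<noteq> 0 \<and> pt x \<in> A \<longrightarrow> ?F x > 0) \<or> (\<forall>x. x \<noteq> 0 \<and> pt x \<in> A \<longrightarrow> ?F x < 0)"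
    using disj Z by (intro sign conn; blast)+
  have O_S: "O1 \<union> O2 \<subseteq> ?S"
  proof
    fix P assume "P \<in> O1 \<union> O2"
    then obtain x where "x \<noteq> 0" "P = pt x" "?F x = 0" using Z unfolding real_quartic_locus_def by blast
    then show "P \<in> ?S" using fibre_cases(1)[of x] by simp
  qed
  have rep: "\<exists>x. x \<noteq> 0 \<and> P = pt x" if "P \<in> topspace PP" for P using that by (auto simp: topspace_PP)
  have sub_S: "X \<subseteq> ?S" if X: "X \<subseteq> topspace PP" "\<And>x. x \<noteq> 0 \<Longrightarrow> pt x \<in> X \<Longrightarrow> ?F x \<le> 0 \<or> qform M1 x > 0" for X
  proof
    fix P assume P: "P \<in> X"
    then obtain x where "x \<noteq> 0" "P = pt x" using X(1) rep by blast
    then show "P \<in> ?S" using X(2)[of x] P fibre_cases(1,2)[of x] by auto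
  qed
  have disj_S: "X \<inter> ?S = {}" if X: "X \<subseteq> topspace PP" "\<And>x. x \<noteq> 0 \<Longrightarrow> pt x \<in> X \<Longrightarrow> ?F x > 0 \<and> qform M1 x < 0" for X
  proof (rule equals0I)
    fix P assume P: "P \<in> X \<inter> ?S"
    then obtain x where "x \<noteq> 0" "P = pt x" using X(1) rep by blast
    then show False using X(2)[of x] P fibre_cases(3)[of x] by auto
  qed
  have S_top: "?S \<subseteq> topspace PP" unfolding nonempty_fibres_def topspace_PP by blast
  have DM: "connectedin PP ((D \<union> O1) \<union> (O1 \<union> A \<union> O2))"
    by (rule connectedin_Un[OF conn(4,5)]) (use P in blast)
  have MB: "connectedin PP ((O1 \<union> A \<union> O2) \<union> (O2 \<union> B))"
    by (rule connectedin_Un[OF conn(5,6)]) (use P in blast)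
  have DMB: "connectedin PP (((D \<union> O1) \<union> (O1 \<union> A \<union> O2)) \<union> (O2 \<union> B))"
    by (rule connectedin_Un[OF DM conn(6)]) (use P in blast)
  from sA show "connectedin PP ?S"
  proof
    assume A: "\<forall>x. x \<noteq> 0 \<and> pt x \<in> A \<longrightarrow> ?F x < 0"
    have D: "?F x > 0" if "x \<noteq> 0" "pt x \<in> D" for x
      using sD ch1(2) A F0 that by (metis UnE UnI1 less_imp_le order_refl)
    have B: "?F x > 0" if "x \<noteq> 0" "pt x \<in> B" for x
      using sB ch2(2) A F0 that by (metis UnE UnI2 less_imp_le order_refl)
    have AS: "A \<subseteq> ?S" using A cover by (intro sub_S) (auto intro: less_imp_le)
    \<comment> \<open>Where the quartic is positive \<open>Q1\<close> has no zero, so its sign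
      decides for the whole piece whether the fibres are empty.\<close>
    have part: "X \<subseteq> ?S \<or> X \<inter> ?S = {}" if X: "connectedin PP X" "\<And>x. x \<noteq> 0 \<Longrightarrow> pt x \<in> X \<Longrightarrow> ?F x > 0" for X
      using sign1[OF X]
    proof
      assume "\<forall>x. x \<noteq> 0 \<and> pt x \<in> X \<longrightarrow> qform M1 x > 0"
      then have "X \<subseteq> ?S" using connectedin_subset_topspace[OF X(1)] by (intro sub_S) auto
      then show ?thesis ..
    next
      assume "\<forall>x. x \<noteq> 0 \<and> pt x \<in> X \<longrightarrow> qform M1 x < 0"
      then have "X \<inter> ?S = {}" using connectedin_subset_topspace[OF X(1)] X(2) by (intro disj_S) auto
      then show ?thesis ..
    qed
    \<comment> \<open>The closed annulus meets the closures of both other pieces, so the union is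
      connected whichever of them are added.\<close>
    have mid: "O1 \<union> A \<union> O2 \<subseteq> ?S" using O_S AS by blast
    from part[OF conn(1) D] part[OF conn(3) B]
    consider "D \<subseteq> ?S" "B \<subseteq> ?S" | "D \<subseteq> ?S" "B \<inter> ?S = {}" | "D \<inter> ?S = {}" "B \<subseteq> ?S" | "D \<inter> ?S = {}" "B \<inter> ?S = {}"
      by blast
    then show ?thesis
    proof cases
      case 1
      then have "?S = ((D \<union> O1) \<union> (O1 \<union> A \<union> O2)) \<union> (O2 \<union> B)" using mid S_top cover by blast
      then show ?thesis using DMB by simp
    next
      case 2
      then have "?S = (D \<union> O1) \<union> (O1 \<union> A \<union> O2)" using mid S_top cover by blast
      then show ?thesis using DM by simp
    next
      case 3
      then have "?S = (O1 \<union> A \<union> O2) \<union> (O2 \<union> B)" using mid S_top cover by blast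
      then show ?thesis using MB by simp
    next
      case 4
      then have "?S = O1 \<union> A \<union> O2" using mid S_top cover by blast
      then show ?thesis using conn by simp
    qed
  next
    assume A: "\<forall>x. x \<noteq> 0 \<and> pt x \<in> A \<longrightarrow> ?F x > 0"
    have D: "?F x < 0" if "x \<noteq> 0" "pt x \<in> D" for x
      using sD ch1(1) A F0 that by (metis UnE UnI1 less_imp_le order_refl)
    have B: "?F x < 0" if "x \<noteq> 0" "pt x \<in> B" for x
      using sB ch2(1) A F0 that by (metis UnE UnI2 less_imp_le order_refl)
    have DS: "D \<subseteq> ?S" "B \<subseteq> ?S" using D B cover by (intro sub_S; auto intro: less_imp_le)+
    from sign1[OF conn(2)] A have "(\<forall>x. x \<noteq> 0 \<and> pt x \<in> A \<longrightarrow> qform M1 x > 0) \<or> (\<forall>x. x \<noteq> 0 \<and> pt x \<in> A \<longrightarrow> qform M1 x < 0)"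
      by blast
    then show ?thesis
    proof
      assume "\<forall>x. x \<noteq> 0 \<and> pt x \<in> A \<longrightarrow> qform M1 x > 0"
      then have "A \<subseteq> ?S" using cover by (intro sub_S) auto
      then have "?S = ((D \<union> O1) \<union> (O1 \<union> A \<union> O2)) \<union> (O2 \<union> B)" using DS O_S S_top cover by blast
      then show ?thesis using DMB by simp
    next
      assume "\<forall>x. x \<noteq> 0 \<and> pt x \<in> A \<longrightarrow> qform M1 x < 0"
      then have "A \<inter> ?S = {}" using A cover by (intro disj_S) auto
      \<comment> \<open>The only disconnected case: the fibres are nonempty on both sides of the
        annulus but not over it.\<close>
      then have "?S \<subseteq> (D \<union> O1) \<union> (O2 \<union> B)" using S_top cover by blast
      moreover have "?S \<inter> (D \<union> O1) \<noteq> {}" "?S \<inter> (O2 \<union> B) \<noteq> {}" using DS ne by blast+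
      moreover have "(D \<union> O1) \<inter> (O2 \<union> B) = {}" using disj by blast
      ultimately obtain t where t: "\<And>x. x \<noteq> 0 \<Longrightarrow> netform M1 M2 M3 x t < 0"
        using negative_definite_member[OF sym closed] by metis
      have "Ptilde1_real_divisors M1 M2 M3 = {}"
        using line B by (intro divisors_planar[OF sym smooth t[unfolded netform_def]]) blast+
      then show ?thesis using assms(7) by (simp add: IJT_obstruction_vanishes_def)
    qed
  qed
qed

end
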